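(* There is an algorithm that, given a temperature-1 seeded tile assembly system $\mathcal{T} = (T,s,1)$ with a single seed tile $s \in T$ and an assembly $\alpha$ (with $|T| = O(|\alpha|)$), decides whether $\mathcal{T}$ uniquely produces $\alpha$, i.e., whether the set of producible terminal assemblies of $\mathcal{T}$ equals $\{\alpha\}$, in time $O(|\alpha| \log |T|)$.
   Context: A tile type is a unit square with, on each of its four sides, a glue label and a nonnegative integer strength; a glue of strength 0 is null. It is assumed that tile sets contain no functionally null glues, i.e., every positive-strength glue facing some direction also appears on some tile type in the opposite direction. An assembly is a partial function $\alpha:\mathbb{Z}^2 \dashrightarrow T$ with finite nonempty domain whose full grid graph is connected; $|\alpha| = |\mathrm{dom}\,\alpha|$. Two tiles at adjacent positions interact if the glue labels on their abutting sides are equal and of positive strength; the binding graph has vertices $\mathrm{dom}\,\alpha$ and edges between interacting positions, weighted by glue strength; $\alpha$ is $\tau$-stable if every cut of its binding graph has weight at least $\tau$. A seeded tile assembly system $(T,s,\tau)$ consists of a finite set $T$ of tile types, a seed tile type $s \in T$ (the seed assembly being the single tile $s$ at the origin), and temperature $\tau \in \mathbb{Z}^+$. An assembly is producible if it is the seed assembly or is obtained from a producible assembly by adding one tile at an empty position such that the result is $\tau$-stable. An assembly is terminal if no tile of a type in $T$ can be added to it so that the result is $\tau$-stable. $\mathcal{T}$ uniquely produces $\alpha$ if $\alpha$ is the only producible terminal assembly.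
   Formalization: "Uniquely produces" here also requires that no unending assembly sequence exists, because with finite assemblies alone the question is undecidable; and log|T| is read as max(1, log_2|T|), since log|T| is 0 when |T| = 1. *)

theory Defs
  imports Complex_Main
begin

section \<open>Seeded tile assembly systems\<close>

text \<open>A glue is a label together with its strength; labels are coded by natural numbers. Two glues
  match only if they agree in both components. If, as is usual, the label determines the strength,
  this is equality of labels.\<close>

datatype glue = Glue (label: nat) (strength: nat)

datatype dir = North | East | South | West

fun opp :: "dir \<Rightarrow> dir" where
  "opp North = South"
| "opp East = West"
| "opp South = North"
| "opp West = East"

type_synonym pos = "int \<times> int"
type_synonym tile = "dir \<Rightarrow> glue"
type_synonym assembly = "pos \<rightharpoonup> tile"

fun shift :: "dir \<Rightarrow> pos \<Rightarrow> pos" where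
  "shift North (x, y) = (x, y + 1)"
| "shift East (x, y) = (x + 1, y)"
| "shift South (x, y) = (x, y - 1)"
| "shift West (x, y) = (x - 1, y)"

definition grid_edges :: "assembly \<Rightarrow> (pos \<times> pos) set" where
  "grid_edges \<alpha> = {(p, q). p \<in> dom \<alpha> \<and> q \<in> dom \<alpha> \<and> (\<exists>d. q = shift d p)}"

definition is_assembly :: "tile set \<Rightarrow> assembly \<Rightarrow> bool" where
  "is_assembly T \<alpha> \<longleftrightarrow> ran \<alpha> \<subseteq> T \<and> finite (dom \<alpha>) \<and> dom \<alpha> \<noteq> {} \<and>
     (\<forall>p\<in>dom \<alpha>. \<forall>q\<in>dom \<alpha>. (p, q) \<in> (grid_edges \<alpha>)\<^sup>*)"

definition asm_size :: "assembly \<Rightarrow> nat" where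
  "asm_size \<alpha> = card (dom \<alpha>)"

text \<open>Here \<open>u\<close> is the tile at the neighbouring position of \<open>t\<close> in direction \<open>d\<close>.\<close>

definition interacts :: "dir \<Rightarrow> tile \<Rightarrow> tile \<Rightarrow> bool" where
  "interacts d t u \<longleftrightarrow> t d = u (opp d) \<and> strength (t d) > 0"

text \<open>The edges of the binding graph, each given by one endpoint and the direction of the other one;
  every undirected edge therefore occurs twice, once from either endpoint.\<close>

definition binding_edges :: "assembly \<Rightarrow> (pos \<times> dir) set" where
  "binding_edges \<alpha> = {(p, d). \<exists>t u. \<alpha> p = Some t \<and> \<alpha> (shift d p) = Some u \<and> interacts d t u}"

text \<open>The edges crossing the cut are taken from their endpoint in \<open>A\<close>, so each counts once.\<close>

definition cut_weight :: "assembly \<Rightarrow> pos set \<Rightarrow> nat" where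
  "cut_weight \<alpha> A =
     (\<Sum>(p, d) \<in> {(p, d) \<in> binding_edges \<alpha>. p \<in> A \<and> shift d p \<notin> A}. strength (the (\<alpha> p) d))"

definition stable :: "nat \<Rightarrow> assembly \<Rightarrow> bool" where
  "stable \<tau> \<alpha> \<longleftrightarrow> (\<forall>A. A \<noteq> {} \<and> A \<subset> dom \<alpha> \<longrightarrow> \<tau> \<le> cut_weight \<alpha> A)"

record tas =
  tiles :: "tile set"
  seed :: tile
  temperature :: nat

definition no_functionally_null :: "tile set \<Rightarrow> bool" where
  "no_functionally_null T \<longleftrightarrow>
     (\<forall>t\<in>T. \<forall>d. strength (t d) > 0 \<longrightarrow> (\<exists>u\<in>T. u (opp d) = t d))"

definition is_tas :: "tas \<Rightarrow> bool" where
  "is_tas S \<longleftrightarrow> finite (tiles S) \<and> seed S \<in> tiles S \<and> temperature S > 0 \<and>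
     no_functionally_null (tiles S)"

definition seed_assembly :: "tas \<Rightarrow> assembly" where
  "seed_assembly S = [(0, 0) \<mapsto> seed S]"

definition attaches :: "tas \<Rightarrow> assembly \<Rightarrow> assembly \<Rightarrow> bool" where
  "attaches S \<alpha> \<beta> \<longleftrightarrow> (\<exists>p t. p \<notin> dom \<alpha> \<and> t \<in> tiles S \<and> \<beta> = \<alpha>(p \<mapsto> t) \<and>
     stable (temperature S) \<beta>)"

inductive producible :: "tas \<Rightarrow> assembly \<Rightarrow> bool" for S where
  seed: "producible S (seed_assembly S)"
| attach: "producible S \<alpha> \<Longrightarrow> attaches S \<alpha> \<beta> \<Longrightarrow> producible S \<beta>"

definition terminal :: "tas \<Rightarrow> assembly \<Rightarrow> bool" where
  "terminal S \<alpha> \<longleftrightarrow> \<not> (\<exists>\<beta>. attaches S \<alpha> \<beta>)"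

definition grows_forever :: "tas \<Rightarrow> bool" where
  "grows_forever S \<longleftrightarrow>
     (\<exists>f :: nat \<Rightarrow> assembly. f 0 = seed_assembly S \<and> (\<forall>n. attaches S (f n) (f (Suc n))))"

text \<open>Members of \<open>producible\<close> are finite. In the abstract tile assembly model an unending assembly
  sequence also produces an assembly, its infinite limit, which extends to an infinite terminal
  assembly; the latter must not exist if \<open>\<alpha>\<close> is to be the only terminal assembly. The second
  conjunct says this without introducing infinite assemblies. Without it, a system with seed \<open>s\<close>
  to which either a dead-end tile or the first tile of an infinite line can attach would count as
  uniquely producing the two-tile assembly.\<close>

definition uniquely_produces :: "tas \<Rightarrow> assembly \<Rightarrow> bool" where
  "uniquely_produces S \<alpha> \<longleftrightarrow> {\<beta>. producible S \<beta> \<and> terminal S \<beta>} = {\<alpha>} \<and> \<not> grows_forever S"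


section \<open>Word RAM\<close>

text \<open>Algorithms are structured programs for a random access machine with finitely many named
  registers (those occurring in the program) and an integer-addressed memory. Every operation costs
  one unit. The semantics is relative to a bound \<open>W\<close> on the absolute value of machine words: a
  program that computes a value outside \<open>{-W..W}\<close>, or uses a negative address, has no execution.\<close>

type_synonym reg = string

datatype aexp =
    Num int
  | Reg reg
  | Mem aexp
  | Add aexp aexp
  | Sub aexp aexp
  | Mul aexp aexp

datatype bexp =
    Less aexp aexp
  | Equal aexp aexp
  | Not bexp
  | And bexp bexp

datatype com =
    Skip
  | Assign reg aexp
  | Store aexp aexp
  | Seq com com
  | Cond bexp com com
  | While bexp com

record state =
  regs :: "reg \<Rightarrow> int"
  mem :: "int \<Rightarrow> int"

primrec aval :: "state \<Rightarrow> aexp \<Rightarrow> int" where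
  "aval s (Num n) = n"
| "aval s (Reg r) = regs s r"
| "aval s (Mem a) = mem s (aval s a)"
| "aval s (Add a b) = aval s a + aval s b"
| "aval s (Sub a b) = aval s a - aval s b"
| "aval s (Mul a b) = aval s a * aval s b"

primrec bval :: "state \<Rightarrow> bexp \<Rightarrow> bool" where
  "bval s (Less a b) = (aval s a < aval s b)"
| "bval s (Equal a b) = (aval s a = aval s b)"
| "bval s (Not b) = (\<not> bval s b)"
| "bval s (And b c) = (bval s b \<and> bval s c)"

text \<open>\<open>afits\<close> and \<open>bfits\<close>: all intermediate values are machine words, all addresses are
  nonnegative.\<close>

primrec afits :: "int \<Rightarrow> state \<Rightarrow> aexp \<Rightarrow> bool" where
  "afits W s (Num n) = (\<bar>n\<bar> \<le> W)"
| "afits W s (Reg r) = (\<bar>regs s r\<bar> \<le> W)"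
| "afits W s (Mem a) = (afits W s a \<and> 0 \<le> aval s a \<and> \<bar>mem s (aval s a)\<bar> \<le> W)"
| "afits W s (Add a b) = (afits W s a \<and> afits W s b \<and> \<bar>aval s a + aval s b\<bar> \<le> W)"
| "afits W s (Sub a b) = (afits W s a \<and> afits W s b \<and> \<bar>aval s a - aval s b\<bar> \<le> W)"
| "afits W s (Mul a b) = (afits W s a \<and> afits W s b \<and> \<bar>aval s a * aval s b\<bar> \<le> W)"

primrec bfits :: "int \<Rightarrow> state \<Rightarrow> bexp \<Rightarrow> bool" where
  "bfits W s (Less a b) = (afits W s a \<and> afits W s b)"
| "bfits W s (Equal a b) = (afits W s a \<and> afits W s b)"
| "bfits W s (Not b) = bfits W s b"
| "bfits W s (And b c) = (bfits W s b \<and> bfits W s c)"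

primrec acost :: "aexp \<Rightarrow> nat" where
  "acost (Num n) = 1"
| "acost (Reg r) = 1"
| "acost (Mem a) = acost a + 1"
| "acost (Add a b) = acost a + acost b + 1"
| "acost (Sub a b) = acost a + acost b + 1"
| "acost (Mul a b) = acost a + acost b + 1"

primrec bcost :: "bexp \<Rightarrow> nat" where
  "bcost (Less a b) = acost a + acost b + 1"
| "bcost (Equal a b) = acost a + acost b + 1"
| "bcost (Not b) = bcost b + 1"
| "bcost (And b c) = bcost b + bcost c + 1"

text \<open>\<open>exec W c s t s'\<close>: with word bound \<open>W\<close>, program \<open>c\<close> started in \<open>s\<close> halts in \<open>s'\<close> after exactly
  \<open>t\<close> units of time.\<close>

inductive exec :: "int \<Rightarrow> com \<Rightarrow> state \<Rightarrow> nat \<Rightarrow> state \<Rightarrow> bool" for W where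
  Skip: "exec W Skip s 1 s"
| Assign: "afits W s a \<Longrightarrow>
    exec W (Assign r a) s (acost a + 1) (s\<lparr>regs := (regs s)(r := aval s a)\<rparr>)"
| Store: "afits W s a \<Longrightarrow> afits W s b \<Longrightarrow> 0 \<le> aval s a \<Longrightarrow>
    exec W (Store a b) s (acost a + acost b + 1) (s\<lparr>mem := (mem s)(aval s a := aval s b)\<rparr>)"
| Seq: "exec W c s t s' \<Longrightarrow> exec W c' s' t' s'' \<Longrightarrow> exec W (Seq c c') s (t + t') s''"
| CondTrue: "bfits W s b \<Longrightarrow> bval s b \<Longrightarrow> exec W c s t s' \<Longrightarrow>
    exec W (Cond b c c') s (bcost b + 1 + t) s'"
| CondFalse: "bfits W s b \<Longrightarrow> \<not> bval s b \<Longrightarrow> exec W c' s t s' \<Longrightarrow>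
    exec W (Cond b c c') s (bcost b + 1 + t) s'"
| WhileFalse: "bfits W s b \<Longrightarrow> \<not> bval s b \<Longrightarrow> exec W (While b c) s (bcost b + 1) s"
| WhileTrue: "bfits W s b \<Longrightarrow> bval s b \<Longrightarrow> exec W c s t s' \<Longrightarrow> exec W (While b c) s' t' s'' \<Longrightarrow>
    exec W (While b c) s (bcost b + 1 + t + t') s''"

definition initial_state :: "int list \<Rightarrow> state" where
  "initial_state xs = \<lparr>regs = (\<lambda>_. 0),
     mem = (\<lambda>a. if 0 \<le> a \<and> a < int (length xs) then xs ! nat a else 0)\<rparr>"

text \<open>Words of \<open>O(log N)\<close> bits, where \<open>N\<close> is the input length plus the largest number in the input:
  the word length parameter \<open>k\<close> is the constant factor.\<close>

definition word_bound :: "nat \<Rightarrow> int list \<Rightarrow> int" where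
  "word_bound k xs = (2 + int (length xs) + Max (insert 0 (abs ` set xs))) ^ k"

text \<open>On input \<open>xs\<close> the program halts after \<open>t\<close> steps with answer \<open>b\<close>.\<close>

definition answers_in :: "com \<Rightarrow> nat \<Rightarrow> int list \<Rightarrow> bool \<Rightarrow> nat \<Rightarrow> bool" where
  "answers_in prog k xs b t \<longleftrightarrow>
     (\<exists>s. exec (word_bound k xs) prog (initial_state xs) t s \<and>
          regs s ''out'' = (if b then 1 else 0))"


section \<open>Encoding of instances\<close>

definition tile_code :: "tile \<Rightarrow> int list" where
  "tile_code t = concat (map (\<lambda>d. [int (label (t d)), int (strength (t d))])
     [North, East, South, West])"

definition index_in :: "tile list \<Rightarrow> tile \<Rightarrow> nat" where
  "index_in ts t = (LEAST i. i < length ts \<and> ts ! i = t)"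

definition instance_code :: "tas \<Rightarrow> assembly \<Rightarrow> tile list \<Rightarrow> pos list \<Rightarrow> int list" where
  "instance_code S \<alpha> ts ps =
     [int (length ts), int (length ps), int (index_in ts (seed S))] @
     concat (map tile_code ts) @
     concat (map (\<lambda>p. [fst p, snd p, int (index_in ts (the (\<alpha> p)))]) ps)"

text \<open>The tile types and the positions of \<open>\<alpha>\<close> may be listed in any order. The temperature is not
  part of the code.\<close>

definition encodes :: "int list \<Rightarrow> tas \<Rightarrow> assembly \<Rightarrow> bool" where
  "encodes xs S \<alpha> \<longleftrightarrow> (\<exists>ts ps. distinct ts \<and> set ts = tiles S \<and> distinct ps \<and> set ps = dom \<alpha> \<and>
     xs = instance_code S \<alpha> ts ps)"

end

theory Submission
  imports Defs
begin

text \<open>At temperature 1 an assembly with the seed at the origin is producible iff it is connected by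
  bonds. Hence \<open>\<alpha>\<close> is uniquely produced iff it has the seed at the origin, is connected, each of its
  positive glues faces an occupied position (by the absence of functionally null glues some tile could
  attach otherwise), and for every position \<open>q\<close> with a positive glue facing a position \<open>p\<close> one of the
  following holds: the tile at \<open>p\<close> matches this glue and no other tile type does, or \<open>p\<close> separates
  \<open>q\<close> from the origin in the binding graph. For if \<open>q\<close> can be reached without \<open>p\<close>, one can grow the part
  reachable without \<open>p\<close> and then put a different tile at \<open>p\<close>; conversely these conditions force every
  producible assembly to be contained in \<open>\<alpha>\<close>.

  All separations are decided by one depth-first search with low points: \<open>p\<close> must be on the search
  stack when \<open>q\<close> is on top of it, and then \<open>p\<close> separates \<open>q\<close> from the root iff no edge leads from the
  subtree of the child of \<open>p\<close> above \<open>q\<close> to a vertex discovered before \<open>p\<close>. Since the memory is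
  initially zero and polynomially large addresses are machine words, glues and positions are looked up
  by direct addressing, and the algorithm runs even in time \<open>O(|\<alpha>| + |T|)\<close>.\<close>

section \<open>Unique production at temperature 1\<close>

text \<open>The low point of a vertex is final only when the vertex is popped, so a separation
  question cannot be answered at the moment it is met. It is postponed, and one bit at the child of
  \<open>p\<close> on the stack serves all such questions: once this child is fully explored,
  \<open>p\<close> separates either its whole subtree from the root or no vertex of it. Apart from a
  predecessor link the stack needs no storage: a vertex other than the top is on it as long as it is
  begun but unfinished, and the direction explored last from such a vertex leads to its child on the
  stack. The other obstacle is that \<open>exec\<close> has no run at all once a word overflows.
  Hence all stored words are kept at most \<open>N\<close>, a bound that every input word obeys, and
  only intermediate values such as table addresses exceed it. These are bounded by a power of
  \<open>N\<close> that can be read off the syntax of an expression; the word length parameter 30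
  comes from there.\<close>

definition bonds :: "assembly \<Rightarrow> (pos \<times> pos) set" where
  "bonds \<alpha> = {(p, shift d p) | p d. (p, d) \<in> binding_edges \<alpha>}"

lemma opp_opp [simp]: "opp (opp d) = d"
  by (cases d) auto

lemma shift_opp [simp]: "shift (opp d) (shift d p) = p" "shift d (shift (opp d) p) = p"
  by (cases d; cases p; simp)+

lemma shift_neq [simp]: "shift d p \<noteq> p" "p \<noteq> shift d p"
  by (cases d; cases p; simp)+

lemma interacts_sym: "interacts d t u \<Longrightarrow> interacts (opp d) u t"
  by (auto simp: interacts_def)

lemma bondsI: "\<alpha> p = Some t \<Longrightarrow> \<alpha> (shift d p) = Some u \<Longrightarrow> interacts d t u \<Longrightarrow> (p, shift d p) \<in> bonds \<alpha>"
  unfolding bonds_def binding_edges_def by blast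

lemma bondsE:
  assumes "(p, q) \<in> bonds \<alpha>"
  obtains d t u where "q = shift d p" "\<alpha> p = Some t" "\<alpha> q = Some u" "interacts d t u"
  using assms by (auto simp: bonds_def binding_edges_def)

lemma sym_bonds: "sym (bonds \<alpha>)"
proof (rule symI)
  fix p q assume "(p, q) \<in> bonds \<alpha>"
  then obtain d t u where "q = shift d p" "\<alpha> p = Some t" "\<alpha> q = Some u" "interacts d t u"
    by (rule bondsE)
  then show "(q, p) \<in> bonds \<alpha>"
    using bondsI[of \<alpha> q u "opp d" t] interacts_sym by auto
qed

lemma bonds_dom: "(p, q) \<in> bonds \<alpha> \<Longrightarrow> p \<in> dom \<alpha> \<and> q \<in> dom \<alpha>"
  by (auto elim: bondsE)

lemma bonds_mono: "\<gamma> \<subseteq>\<^sub>m \<beta> \<Longrightarrow> bonds \<gamma> \<subseteq> bonds \<beta>"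
proof (rule subrelI)
  fix p q assume le: "\<gamma> \<subseteq>\<^sub>m \<beta>" and "(p, q) \<in> bonds \<gamma>"
  then obtain d t u where "q = shift d p" "\<gamma> p = Some t" "\<gamma> q = Some u" "interacts d t u"
    by (auto elim: bondsE)
  moreover have "\<beta> p = Some t" "\<beta> q = Some u"
    using le calculation by (metis domI map_le_def)+
  ultimately show "(p, q) \<in> bonds \<beta>"
    using bondsI by blast
qed

section \<open>Stability at temperature 1 as connectivity of the binding graph\<close>

lemma finite_dirs: "finite (UNIV :: dir set)"
proof -
  have "(UNIV :: dir set) = {North, East, South, West}"
    using dir.exhaust by auto
  then show ?thesis by (metis finite.emptyI finite.insertI)
qed

text \<open>Every binding edge has positive strength, so the finite sum vanishes only when no edge
  crosses the cut.\<close>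

lemma cut_weight_ge_1_iff:
  assumes "finite (dom \<alpha>)"
  shows "1 \<le> cut_weight \<alpha> A \<longleftrightarrow> (\<exists>p q. (p, q) \<in> bonds \<alpha> \<and> p \<in> A \<and> q \<notin> A)"
proof -
  let ?X = "{(p, d) \<in> binding_edges \<alpha>. p \<in> A \<and> shift d p \<notin> A}"
  have "?X \<subseteq> dom \<alpha> \<times> UNIV" by (auto simp: binding_edges_def)
  then have fin: "finite ?X"
    using assms finite_dirs by (meson finite_SigmaI finite_subset)
  have "cut_weight \<alpha> A \<noteq> 0 \<longleftrightarrow> (\<exists>e\<in>?X. (case e of (p, d) \<Rightarrow> strength (the (\<alpha> p) d)) \<noteq> 0)"
    unfolding cut_weight_def using fin by (subst sum_eq_0_iff) auto
  also have "\<dots> \<longleftrightarrow> ?X \<noteq> {}"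
    by (fastforce simp: binding_edges_def interacts_def)
  also have "\<dots> \<longleftrightarrow> (\<exists>p q. (p, q) \<in> bonds \<alpha> \<and> p \<in> A \<and> q \<notin> A)"
    unfolding bonds_def by blast
  finally show ?thesis by (simp add: Suc_le_eq)
qed

lemma stable_1_iff:
  assumes "finite (dom \<alpha>)"
  shows "stable 1 \<alpha> \<longleftrightarrow>
    (\<forall>A. A \<noteq> {} \<and> A \<subset> dom \<alpha> \<longrightarrow> (\<exists>p q. (p, q) \<in> bonds \<alpha> \<and> p \<in> A \<and> q \<notin> A))"
  unfolding stable_def cut_weight_ge_1_iff[OF assms] ..

lemma rtrancl_leaves:
  assumes "(x, y) \<in> r\<^sup>*" "x \<in> A" "y \<notin> A"
  shows "\<exists>p q. (p, q) \<in> r \<and> p \<in> A \<and> q \<notin> A"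
  using assms by (induction rule: rtrancl_induct) auto

text \<open>The positions reachable from \<open>z\<close> form a cut that no bond crosses, unless
  they are the whole domain. Conversely, every proper cut separates \<open>z\<close> from some
  position, and a path between the two has to cross it.\<close>

lemma stable_1_iff_connected:
  assumes "finite (dom \<alpha>)" and o: "z \<in> dom \<alpha>"
  shows "stable 1 \<alpha> \<longleftrightarrow> dom \<alpha> \<subseteq> (bonds \<alpha>)\<^sup>* `` {z}"
proof
  assume st: "stable 1 \<alpha>"
  show "dom \<alpha> \<subseteq> (bonds \<alpha>)\<^sup>* `` {z}"
  proof (rule ccontr)
    assume n: "\<not> dom \<alpha> \<subseteq> (bonds \<alpha>)\<^sup>* `` {z}"
    let ?A = "(bonds \<alpha>)\<^sup>* `` {z} \<inter> dom \<alpha>"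
    have "?A \<noteq> {}" "?A \<subset> dom \<alpha>" using o n by auto
    then have "\<exists>p q. (p, q) \<in> bonds \<alpha> \<and> p \<in> ?A \<and> q \<notin> ?A"
      using st unfolding stable_1_iff[OF assms(1)] by (elim allE[of _ ?A]) simp
    then obtain p q where "(p, q) \<in> bonds \<alpha>" "p \<in> ?A" "q \<notin> ?A"
      by blast
    then show False
      using bonds_dom[of p q \<alpha>] by (auto dest: rtrancl_into_rtrancl)
  qed
next
  assume c: "dom \<alpha> \<subseteq> (bonds \<alpha>)\<^sup>* `` {z}"
  show "stable 1 \<alpha>"
    unfolding stable_1_iff[OF assms(1)]
  proof (intro allI impI, elim conjE)
    fix A assume A: "A \<noteq> {}" "A \<subset> dom \<alpha>"
    show "\<exists>p q. (p, q) \<in> bonds \<alpha> \<and> p \<in> A \<and> q \<notin> A"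
    proof (cases "z \<in> A")
      case True
      obtain b where "b \<in> dom \<alpha>" "b \<notin> A" using A by auto
      then have "(z, b) \<in> (bonds \<alpha>)\<^sup>*" using c by auto
      then show ?thesis using True \<open>b \<notin> A\<close> by (rule rtrancl_leaves)
    next
      case False
      obtain a where "a \<in> A" using A by auto
      \<comment> \<open>The crossing bond must be directed out of \<open>A\<close>, so the path from
        \<open>z\<close> is reversed.\<close>
      then have "(a, z) \<in> (bonds \<alpha>)\<^sup>*"
        using A c symD[OF sym_rtrancl[OF sym_bonds]] by blast
      then show ?thesis using \<open>a \<in> A\<close> False by (rule rtrancl_leaves)
    qed
  qed
qed

text \<open>Producibility without reference to an assembly sequence; the two notions agree by
  \<open>producible_iff_connected_seeded\<close>.\<close>

definition connected_seeded :: "tas \<Rightarrow> assembly \<Rightarrow> bool" where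
  "connected_seeded S \<beta> \<longleftrightarrow> finite (dom \<beta>) \<and> ran \<beta> \<subseteq> tiles S \<and> \<beta> (0, 0) = Some (seed S) \<and>
     dom \<beta> \<subseteq> (bonds \<beta>)\<^sup>* `` {(0, 0)}"

text \<open>Interaction is included on purpose: beside a mismatching \<open>u\<close>, any tile type
  with the facing glue is a rival for the position.\<close>

definition forced :: "tas \<Rightarrow> dir \<Rightarrow> tile \<Rightarrow> tile \<Rightarrow> bool" where
  "forced S d t u \<longleftrightarrow> interacts d t u \<and> {u' \<in> tiles S. u' (opp d) = t d} = {u}"

context
  fixes S :: tas
  assumes tas: "is_tas S" and temp: "temperature S = 1"
begin

lemma producible_imp_connected_seeded: "producible S \<beta> \<Longrightarrow> connected_seeded S \<beta>"
proof (induction rule: producible.induct)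
  case seed
  have "dom (seed_assembly S) = {(0, 0)}" "ran (seed_assembly S) = {seed S}"
    by (simp_all add: seed_assembly_def)
  then show ?case using tas
    by (simp add: connected_seeded_def is_tas_def) (simp add: seed_assembly_def)
next
  case (attach \<alpha> \<beta>)
  then obtain p t where *: "p \<notin> dom \<alpha>" "t \<in> tiles S" "\<beta> = \<alpha>(p \<mapsto> t)" "stable 1 \<beta>"
    by (auto simp: attaches_def temp)
  have "finite (dom \<beta>)" "ran \<beta> \<subseteq> tiles S" "\<beta> (0, 0) = Some (seed S)"
    using * attach by (auto simp: connected_seeded_def)
  then show ?case
    using *(4) stable_1_iff_connected[of \<beta> "(0,0)"] by (auto simp: connected_seeded_def)
qed

lemma connected_seeded_extend:
  assumes c: "connected_seeded S \<gamma>" and q: "q \<notin> dom \<gamma>" "t \<in> tiles S"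
    and u: "\<gamma> (shift d q) = Some u" "interacts d t u"
  shows "connected_seeded S (\<gamma>(q \<mapsto> t))"
proof -
  let ?\<beta> = "\<gamma>(q \<mapsto> t)"
  have le: "\<gamma> \<subseteq>\<^sub>m ?\<beta>" using q by (auto simp: map_le_def)
  have "(shift d q, shift (opp d) (shift d q)) \<in> bonds ?\<beta>"
    by (rule bondsI[of _ _ u _ t]) (use u interacts_sym in auto)
  then have e: "(shift d q, q) \<in> bonds ?\<beta>" by simp
  have sub: "(bonds \<gamma>)\<^sup>* \<subseteq> (bonds ?\<beta>)\<^sup>*" using bonds_mono[OF le] by (rule rtrancl_mono)
  have "(\<gamma>(q \<mapsto> t)) (0,0) = Some (seed S)" using c q by (auto simp: connected_seeded_def)
  moreover have "((0,0), p) \<in> (bonds ?\<beta>)\<^sup>*" if "p \<in> dom \<gamma>" for p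
    using that c sub by (auto simp: connected_seeded_def)
  moreover from this have "((0,0), q) \<in> (bonds ?\<beta>)\<^sup>*"
    using e u by (meson domI rtrancl.rtrancl_into_rtrancl)
  moreover have "ran ?\<beta> \<subseteq> tiles S"
    using c q by (auto simp: connected_seeded_def ran_def)
  ultimately show ?thesis
    using c unfolding connected_seeded_def by auto
qed

text \<open>Stability is tested on the cut around the new position alone, which is proper because
  the origin is occupied already, and which yields a bond. In the other direction a single bond
  keeps the assembly connected.\<close>

lemma attaches_iff:
  assumes c: "connected_seeded S \<gamma>"
  shows "attaches S \<gamma> \<beta> \<longleftrightarrow> (\<exists>q t d u. q \<notin> dom \<gamma> \<and> t \<in> tiles S \<and> \<beta> = \<gamma>(q \<mapsto> t) \<and>
    \<gamma> (shift d q) = Some u \<and> interacts d t u)"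
proof
  assume "attaches S \<gamma> \<beta>"
  then obtain q t where *: "q \<notin> dom \<gamma>" "t \<in> tiles S" "\<beta> = \<gamma>(q \<mapsto> t)" "stable 1 \<beta>"
    by (auto simp: attaches_def temp)
  have fin: "finite (dom \<beta>)" using c * by (auto simp: connected_seeded_def)
  have "{q} \<subset> dom \<beta>" using c *(1,3) by (auto simp: connected_seeded_def)
  then obtain x y where "(x, y) \<in> bonds \<beta>" "x \<in> {q}" "y \<notin> {q}"
    using *(4) unfolding stable_1_iff[OF fin] by blast
  then obtain d t' u where "y = shift d q" "\<beta> q = Some t'" "\<beta> y = Some u" "interacts d t' u" "y \<noteq> q"
    by (auto elim: bondsE)
  then show "\<exists>q t d u. q \<notin> dom \<gamma> \<and> t \<in> tiles S \<and> \<beta> = \<gamma>(q \<mapsto> t) \<and>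
    \<gamma> (shift d q) = Some u \<and> interacts d t u"
    using * by (metis fun_upd_other fun_upd_same option.inject)
next
  assume "\<exists>q t d u. q \<notin> dom \<gamma> \<and> t \<in> tiles S \<and> \<beta> = \<gamma>(q \<mapsto> t) \<and>
    \<gamma> (shift d q) = Some u \<and> interacts d t u"
  then obtain q t d u where *: "q \<notin> dom \<gamma>" "t \<in> tiles S" "\<beta> = \<gamma>(q \<mapsto> t)"
    "\<gamma> (shift d q) = Some u" "interacts d t u" by blast
  have "connected_seeded S \<beta>"
    unfolding *(3) by (rule connected_seeded_extend[OF c *(1,2,4,5)])
  then have "stable 1 \<beta>"
    using stable_1_iff_connected[of \<beta> "(0,0)"] by (auto simp: connected_seeded_def)
  then show "attaches S \<gamma> \<beta>"
    using * unfolding attaches_def temp by blast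
qed

text \<open>A path in \<open>\<beta>\<close> from the origin to a position missing in
  \<open>\<gamma>\<close> leaves \<open>dom \<gamma>\<close> along some bond; the tile at its outer
  end can be added next.\<close>

lemma attaches_towards:
  assumes c: "connected_seeded S \<gamma>" and c': "connected_seeded S \<beta>"
    and le: "\<gamma> \<subseteq>\<^sub>m \<beta>" and ne: "\<gamma> \<noteq> \<beta>"
  obtains q where "q \<in> dom \<beta> - dom \<gamma>" "attaches S \<gamma> (\<gamma>(q := \<beta> q))"
proof -
  have "dom \<gamma> \<subset> dom \<beta>"
    using le ne by (metis map_le_antisym map_le_def map_le_implies_dom_le psubsetI)
  moreover have "(0,0) \<in> dom \<gamma>" using c by (auto simp: connected_seeded_def)
  ultimately obtain y where "((0,0), y) \<in> (bonds \<beta>)\<^sup>*" "(0,0) \<in> dom \<gamma>" "y \<notin> dom \<gamma>"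
    using c' unfolding connected_seeded_def by blast
  from rtrancl_leaves[OF this] obtain x q
    where xq: "(x, q) \<in> bonds \<beta>" "x \<in> dom \<gamma>" "q \<notin> dom \<gamma>"
    by blast
  then have "(q, x) \<in> bonds \<beta>" using sym_bonds by (meson symD)
  then obtain d t u where *: "x = shift d q" "\<beta> q = Some t" "\<beta> x = Some u" "interacts d t u"
    by (rule bondsE)
  have "\<gamma> x = Some u" using xq le * by (metis map_le_def)
  moreover have "t \<in> tiles S" using *(2) c' unfolding connected_seeded_def by (blast intro: ranI)
  ultimately have "attaches S \<gamma> (\<gamma>(q := \<beta> q))"
    unfolding attaches_iff[OF c] using * xq(3) by metis
  then show thesis using that[of q] xq bonds_dom by blast
qed

lemma producible_iff_connected_seeded: "producible S \<beta> \<longleftrightarrow> connected_seeded S \<beta>"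
proof
  assume c': "connected_seeded S \<beta>"
  have "\<gamma> \<subseteq>\<^sub>m \<beta> \<Longrightarrow> producible S \<gamma> \<Longrightarrow> producible S \<beta>" for \<gamma>
  proof (induction "card (dom \<beta> - dom \<gamma>)" arbitrary: \<gamma> rule: less_induct)
    case less
    show ?case
    proof (cases "\<gamma> = \<beta>")
      case False
      obtain q where q: "q \<in> dom \<beta> - dom \<gamma>" "attaches S \<gamma> (\<gamma>(q := \<beta> q))"
        using attaches_towards[OF producible_imp_connected_seeded[OF less.prems(2)] c' less.prems(1) False]
        by blast
      let ?\<gamma> = "\<gamma>(q := \<beta> q)"
      have "dom \<beta> - dom ?\<gamma> \<subset> dom \<beta> - dom \<gamma>" using q by auto
      then have "card (dom \<beta> - dom ?\<gamma>) < card (dom \<beta> - dom \<gamma>)"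
        using c' by (intro psubset_card_mono) (auto simp: connected_seeded_def)
      moreover have "?\<gamma> \<subseteq>\<^sub>m \<beta>" using less.prems(1) by (auto simp: map_le_def)
      moreover have "producible S ?\<gamma>" using less.prems(2) q(2) by (rule producible.attach)
      ultimately show ?thesis by (rule less.hyps)
    qed (use less in simp)
  qed
  moreover have "seed_assembly S \<subseteq>\<^sub>m \<beta>"
    using c' by (auto simp: seed_assembly_def connected_seeded_def map_le_def)
  ultimately show "producible S \<beta>" using producible.seed by blast
qed (rule producible_imp_connected_seeded)

section \<open>Infinite growth and terminal extensions\<close>

lemma grows_forever_prepend:
  assumes "(attaches S)\<^sup>*\<^sup>* \<beta> (g 0)" "\<And>n. attaches S (g n) (g (Suc n))"
  shows "\<exists>f. f 0 = \<beta> \<and> (\<forall>n::nat. attaches S (f n) (f (Suc n)))"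
  using assms(1)
proof (induction rule: converse_rtranclp_induct)
  case base
  then show ?case using assms(2) by blast
next
  case (step y z)
  then obtain f where "f 0 = z" "\<forall>n::nat. attaches S (f n) (f (Suc n))" by auto
  then show ?case using step(1)
    by (intro exI[of _ "case_nat y f"]) (auto split: nat.split)
qed

lemma producible_reach: "producible S \<beta> \<Longrightarrow> (attaches S)\<^sup>*\<^sup>* (seed_assembly S) \<beta>"
  by (induction rule: producible.induct) auto

text \<open>Otherwise every producible extension of \<open>\<gamma>\<close> could grow further, and
  dependent choice would give an unending sequence; preceded by the sequence that builds
  \<open>\<gamma>\<close>, it starts at the seed.\<close>

lemma producible_terminal_extension:
  assumes "producible S \<gamma>" "\<not> grows_forever S"
  obtains \<delta> where "producible S \<delta>" "terminal S \<delta>" "\<gamma> \<subseteq>\<^sub>m \<delta>"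
proof (rule ccontr)
  assume "\<not> thesis"
  then have nt: "\<not> terminal S \<delta>" if "producible S \<delta>" "\<gamma> \<subseteq>\<^sub>m \<delta>" for \<delta>
    using that \<open>\<And>\<delta>. producible S \<delta> \<Longrightarrow> terminal S \<delta> \<Longrightarrow> \<gamma> \<subseteq>\<^sub>m \<delta> \<Longrightarrow> thesis\<close> by blast
  define P where "P \<delta> \<longleftrightarrow> producible S \<delta> \<and> \<gamma> \<subseteq>\<^sub>m \<delta>" for \<delta>
  have next_ex: "\<exists>\<beta>. P \<beta> \<and> attaches S \<delta> \<beta>" if P: "P \<delta>" for \<delta>
  proof -
    obtain \<beta> where \<beta>: "attaches S \<delta> \<beta>"
      using nt[of \<delta>] P unfolding terminal_def P_def by blast
    then have "\<delta> \<subseteq>\<^sub>m \<beta>"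
      unfolding attaches_def map_le_def by (metis fun_upd_other)
    then show ?thesis
      using \<beta> P unfolding P_def by (meson map_le_trans producible.attach)
  qed
  have "\<exists>g. \<forall>n. (P (g n) \<and> (n = 0 \<longrightarrow> g n = \<gamma>)) \<and> attaches S (g n) (g (Suc n))"
  proof (rule dependent_nat_choice[of "\<lambda>n x. P x \<and> (n = 0 \<longrightarrow> x = \<gamma>)" "\<lambda>_. attaches S"])
    show "\<exists>x. P x \<and> (0 = (0::nat) \<longrightarrow> x = \<gamma>)" using assms(1) by (simp add: P_def)
  next
    fix \<delta> and n :: nat assume "P \<delta> \<and> (n = 0 \<longrightarrow> \<delta> = \<gamma>)"
    then show "\<exists>\<beta>. (P \<beta> \<and> (Suc n = 0 \<longrightarrow> \<beta> = \<gamma>)) \<and> attaches S \<delta> \<beta>"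
      using next_ex by blast
  qed
  then obtain g where "g 0 = \<gamma>" "\<And>n. attaches S (g n) (g (Suc n))" by blast
  then have "grows_forever S"
    using grows_forever_prepend[of "seed_assembly S" g] producible_reach[OF assms(1)]
    by (auto simp: grows_forever_def)
  then show False using assms(2) by simp
qed

theorem uniquely_produces_iff:
  assumes fin: "finite (dom \<alpha>)" and ran: "ran \<alpha> \<subseteq> tiles S"
  shows "uniquely_produces S \<alpha> \<longleftrightarrow>
    \<alpha> (0, 0) = Some (seed S) \<and>
    dom \<alpha> \<subseteq> (bonds \<alpha>)\<^sup>* `` {(0, 0)} \<and>
    (\<forall>q t d. \<alpha> q = Some t \<and> strength (t d) > 0 \<longrightarrow> shift d q \<in> dom \<alpha>) \<and>
    (\<forall>q t d u. \<alpha> q = Some t \<and> \<alpha> (shift d q) = Some u \<and> strength (t d) > 0 \<and> \<not> forced S d t u \<longrightarrow>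
      ((0, 0), q) \<notin> (Restr (bonds \<alpha>) (- {shift d q}))\<^sup>*)" (is "_ \<longleftrightarrow> ?seed \<and> ?conn \<and> ?term \<and> ?bad")
proof
  assume uniq: "uniquely_produces S \<alpha>"
  then have prod: "producible S \<alpha>" and trm: "terminal S \<alpha>" and ngf: "\<not> grows_forever S"
    and only: "\<And>\<beta>. producible S \<beta> \<Longrightarrow> terminal S \<beta> \<Longrightarrow> \<beta> = \<alpha>"
    by (auto simp: uniquely_produces_def)
  note cs = producible_imp_connected_seeded[OF prod]
  have nfn: "no_functionally_null (tiles S)" using tas by (simp add: is_tas_def)
  have ?seed ?conn using cs by (auto simp: connected_seeded_def)
  moreover have ?term
  proof (intro allI impI, elim conjE, rule ccontr)
    fix q t d assume q: "\<alpha> q = Some t" "strength (t d) > 0" "shift d q \<notin> dom \<alpha>"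
    have "t \<in> tiles S" using q(1) ran by (blast intro: ranI)
    then obtain u where u: "u \<in> tiles S" "u (opp d) = t d"
      using nfn q(2) unfolding no_functionally_null_def by blast
    have "attaches S \<alpha> (\<alpha>(shift d q \<mapsto> u))"
      unfolding attaches_iff[OF cs]
      by (rule exI[of _ "shift d q"], rule exI[of _ u], rule exI[of _ "opp d"], rule exI[of _ t])
        (use q u in \<open>auto simp: interacts_def\<close>)
    then show False using trm by (auto simp: terminal_def)
  qed
  moreover have ?bad
  proof (intro allI impI, elim conjE, rule notI)
    fix q t d u
    assume q: "\<alpha> q = Some t" "\<alpha> (shift d q) = Some u" "strength (t d) > 0" "\<not> forced S d t u"
      and reach: "((0, 0), q) \<in> (Restr (bonds \<alpha>) (- {shift d q}))\<^sup>*"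
    let ?p = "shift d q" and ?E = "Restr (bonds \<alpha>) (- {shift d q})"
    have "t \<in> tiles S" using q(1) ran by (blast intro: ranI)
    then obtain u0 where u0: "u0 \<in> tiles S" "u0 (opp d) = t d"
      using nfn q(3) unfolding no_functionally_null_def by blast
    \<comment> \<open>A rival tile for the position \<open>?p\<close>. If \<open>u\<close>
      mismatches, any tile with the facing glue will do, and one exists as no glue is functionally
      null; if \<open>u\<close> matches, the failure of \<open>forced\<close> supplies a second
      tile.\<close>
    obtain u' where u': "u' \<in> tiles S" "u' (opp d) = t d" "u' \<noteq> u"
    proof (cases "u (opp d) = t d")
      case True
      then have "{u' \<in> tiles S. u' (opp d) = t d} \<noteq> {u}"
        using q(3,4) by (auto simp: forced_def interacts_def)
      moreover have "u \<in> tiles S" using q(2) ran by (blast intro: ranI)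
      ultimately show thesis using True that by blast
    next
      case False
      then show thesis using u0 that by blast
    qed
    define R where "R = ?E\<^sup>* `` {(0,0)}"
    define \<gamma> where "\<gamma> = \<alpha> |` R"
    \<comment> \<open>No edge of \<open>?E\<close> starts at \<open>?p\<close>. Were
      \<open>?p\<close> the origin, only the empty path would remain, and \<open>q\<close> would
      coincide with its own neighbour.\<close>
    have p0: "?p \<noteq> (0,0)"
    proof
      assume "?p = (0,0)"
      then have "q = (0,0)" using reach by (auto elim: converse_rtranclE)
      then show False using \<open>?p = (0,0)\<close> shift_neq by metis
    qed
    have pR: "?p \<notin> R" using p0 unfolding R_def by (auto elim: rtranclE)
    have sub: "?E \<inter> R \<times> R \<subseteq> bonds \<gamma>"
    proof (rule subrelI)
      fix x y assume xy: "(x, y) \<in> ?E \<inter> R \<times> R"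
      then have "(x, y) \<in> bonds \<alpha>" by auto
      then obtain d' t' u' where "y = shift d' x" "\<alpha> x = Some t'" "\<alpha> y = Some u'" "interacts d' t' u'"
        by (auto elim: bondsE)
      then show "(x, y) \<in> bonds \<gamma>"
        using xy bondsI[of \<gamma> x t' d' u'] by (auto simp: \<gamma>_def)
    qed
    have rR: "((0,0), y) \<in> (bonds \<gamma>)\<^sup>*" if "y \<in> R" for y
    proof -
      have "((0,0), y) \<in> ?E\<^sup>*" using that by (simp add: R_def)
      then show ?thesis
      proof (induction rule: rtrancl_induct)
        case (step y z)
        then have "(y, z) \<in> ?E \<inter> R \<times> R"
          unfolding R_def by (auto intro: rtrancl_into_rtrancl)
        then show ?case using step.IH sub by (meson rtrancl.simps subsetD)
      qed simp
    qed
    have "connected_seeded S \<gamma>"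
      unfolding connected_seeded_def
    proof (intro conjI)
      show "finite (dom \<gamma>)" using fin by (auto simp: \<gamma>_def)
      show "ran \<gamma> \<subseteq> tiles S" using ran by (auto simp: \<gamma>_def ran_def restrict_map_def split: if_splits)
      show "\<gamma> (0, 0) = Some (seed S)" using cs by (auto simp: \<gamma>_def R_def connected_seeded_def)
      show "dom \<gamma> \<subseteq> (bonds \<gamma>)\<^sup>* `` {(0, 0)}" using rR by (auto simp: \<gamma>_def)
    qed
    note c\<gamma> = this
    have "connected_seeded S (\<gamma>(?p \<mapsto> u'))"
    proof (rule connected_seeded_extend[OF c\<gamma>, of ?p u' "opp d" t])
      show "?p \<notin> dom \<gamma>" using pR by (auto simp: \<gamma>_def)
      show "\<gamma> (shift (opp d) ?p) = Some t" using reach q by (auto simp: \<gamma>_def R_def)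
    qed (use u' q in \<open>auto simp: interacts_def\<close>)
    then have "producible S (\<gamma>(?p \<mapsto> u'))" by (simp add: producible_iff_connected_seeded)
    then obtain \<delta> where "producible S \<delta>" "terminal S \<delta>" "\<gamma>(?p \<mapsto> u') \<subseteq>\<^sub>m \<delta>"
      using producible_terminal_extension ngf by blast
    then have "\<gamma>(?p \<mapsto> u') \<subseteq>\<^sub>m \<alpha>" using only by blast
    then have "\<alpha> ?p = Some u'" unfolding map_le_def by (metis domI fun_upd_same)
    then show False using q(2) u'(3) by simp
  qed
  ultimately show "?seed \<and> ?conn \<and> ?term \<and> ?bad" by blast
next
  assume "?seed \<and> ?conn \<and> ?term \<and> ?bad"
  then have seed: ?seed and conn: ?conn and trm: ?term and bad: ?bad by blast+
  have cs: "connected_seeded S \<alpha>"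
    using fin ran seed conn by (simp add: connected_seeded_def)
  \<comment> \<open>Induction step for the claim that all producible assemblies lie inside
    \<open>\<alpha>\<close>. Since \<open>p\<close> is still empty, \<open>\<beta>\<close> connects
    the attaching neighbour to the origin without \<open>p\<close>, so \<open>bad\<close> makes the
    tile of \<open>\<alpha>\<close> at \<open>p\<close> the forced one.\<close>
  have step: "\<beta>' \<subseteq>\<^sub>m \<alpha>" if c: "connected_seeded S \<beta>" and le: "\<beta> \<subseteq>\<^sub>m \<alpha>" and a: "attaches S \<beta> \<beta>'" for \<beta> \<beta>'
  proof -
    obtain p t d u where *: "p \<notin> dom \<beta>" "t \<in> tiles S" "\<beta>' = \<beta>(p \<mapsto> t)" "\<beta> (shift d p) = Some u"
      "interacts d t u"
      using a unfolding attaches_iff[OF c] by blast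
    let ?q = "shift d p"
    have q: "\<alpha> ?q = Some u" using le * by (metis domI map_le_def)
    have "strength (u (opp d)) > 0" "u (opp d) = t d" using *(5) by (auto simp: interacts_def)
    then obtain t' where t': "\<alpha> p = Some t'" using trm q by (metis domD shift_opp(1))
    have "?q \<in> dom \<beta>" using * by auto
    then have "((0,0), ?q) \<in> (bonds \<beta>)\<^sup>*" using c by (auto simp: connected_seeded_def)
    moreover have "bonds \<beta> \<subseteq> Restr (bonds \<alpha>) (- {p})"
    proof (rule subrelI)
      fix x y assume "(x, y) \<in> bonds \<beta>"
      then show "(x, y) \<in> Restr (bonds \<alpha>) (- {p})"
        using bonds_mono[OF le] bonds_dom[of x y \<beta>] *(1) by blast
    qed
    ultimately have "((0,0), ?q) \<in> (Restr (bonds \<alpha>) (- {p}))\<^sup>*"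
      by (meson rtrancl_mono subsetD)
    then have "forced S (opp d) u t'"
      using bad[rule_format, of ?q u "opp d" t'] q t' \<open>strength (u (opp d)) > 0\<close> by auto
    then have "{u' \<in> tiles S. u' d = u (opp d)} = {t'}" by (simp add: forced_def)
    then have "t = t'" using *(2) \<open>u (opp d) = t d\<close> by auto
    then show ?thesis using *(3) le t' by (auto simp: map_le_def)
  qed
  have sub: "\<beta> \<subseteq>\<^sub>m \<alpha>" if "producible S \<beta>" for \<beta>
    using that
  proof (induction rule: producible.induct)
    case seed
    have "dom (seed_assembly S) = {(0, 0)}" by (simp add: seed_assembly_def)
    then show ?case using \<open>?seed\<close> by (simp add: map_le_def) (simp add: seed_assembly_def)
  next
    case (attach \<beta> \<beta>')
    then show ?case using step producible_imp_connected_seeded by blast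
  qed
  have pa: "producible S \<alpha>" using cs by (simp add: producible_iff_connected_seeded)
  have "terminal S \<alpha>"
    unfolding terminal_def
  proof
    assume "\<exists>\<beta>. attaches S \<alpha> \<beta>"
    then obtain \<beta> where \<beta>: "attaches S \<alpha> \<beta>" ..
    then have "\<beta> \<subseteq>\<^sub>m \<alpha>" using sub pa producible.attach by blast
    then show False using \<beta> by (auto simp: attaches_def dest!: map_le_implies_dom_le)
  qed
  moreover have "\<beta> = \<alpha>" if "producible S \<beta>" "terminal S \<beta>" for \<beta>
    using attaches_towards[OF producible_imp_connected_seeded[OF that(1)] cs sub[OF that(1)]] that(2)
    unfolding terminal_def by blast
  moreover have "\<not> grows_forever S"
  proof
    assume "grows_forever S"
    then obtain f where f: "f 0 = seed_assembly S" "\<And>n. attaches S (f n) (f (Suc n))"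
      by (auto simp: grows_forever_def)
    have p: "producible S (f n)" for n
    proof (induction n)
      case 0
      show ?case unfolding f(1) by (rule producible.seed)
    next
      case (Suc n)
      then show ?case using f(2) by (rule producible.attach)
    qed
    \<comment> \<open>Each attachment occupies a new position, whereas all assemblies stay within
      the finite domain of \<open>\<alpha>\<close>.\<close>
    have "card (dom (f n)) \<ge> n" for n
    proof (induction n)
      case (Suc n)
      have "finite (dom (f n))" using producible_imp_connected_seeded[OF p] by (simp add: connected_seeded_def)
      moreover obtain x t where "x \<notin> dom (f n)" "f (Suc n) = (f n)(x \<mapsto> t)"
        using f(2)[of n] unfolding attaches_def by blast
      moreover from this(2) have "dom (f (Suc n)) = insert x (dom (f n))"
        by (simp only: dom_fun_upd option.simps if_False)
      ultimately have "card (dom (f (Suc n))) = Suc (card (dom (f n)))"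
        by (metis card_insert_disjoint)
      then show ?case using Suc by linarith
    qed simp
    moreover have "card (dom (f n)) \<le> card (dom \<alpha>)" for n
      using sub[OF p, of n] fin by (simp add: card_mono map_le_implies_dom_le)
    ultimately show False by (metis Suc_n_not_le_n le_trans)
  qed
  ultimately show "uniquely_produces S \<alpha>"
    using pa unfolding uniquely_produces_def by blast
qed

end

section \<open>Domination by depth-first search\<close>

text \<open>Tables with four entries per vertex, 0 for none. \<open>A\<close> is an undirected
  graph; \<open>B\<close> lists the vertices required to dominate and need not follow edges of
  \<open>A\<close>, since a mismatching neighbour is joined by no bond. Tiles, grid and machine do
  not enter this part.\<close>

locale bad_graph =
  fixes n :: int and A B :: "int \<Rightarrow> int \<Rightarrow> int" and r :: int
  assumes root: "1 \<le> r" "r \<le> n"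
    and A_range: "\<And>v k. v \<in> {1..n} \<Longrightarrow> k \<in> {0..<4} \<Longrightarrow> A v k \<in> {0..n}"
    and B_range: "\<And>v k. v \<in> {1..n} \<Longrightarrow> k \<in> {0..<4} \<Longrightarrow> B v k \<in> {0..n}"
    and A_sym: "\<And>v k. v \<in> {1..n} \<Longrightarrow> k \<in> {0..<4} \<Longrightarrow> A v k \<noteq> 0 \<Longrightarrow> \<exists>k'\<in>{0..<4}. A (A v k) k' = v"
    and B_irrefl: "\<And>v k. v \<in> {1..n} \<Longrightarrow> k \<in> {0..<4} \<Longrightarrow> B v k \<noteq> v"
begin

definition E :: "(int \<times> int) set" where
  "E = {(v, A v k) | v k. v \<in> {1..n} \<and> k \<in> {0..<4} \<and> A v k \<noteq> 0}"

text \<open>The empty path survives every restriction, so nothing dominates \<open>r\<close>, and a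
  request made at the root is always violated.\<close>

definition dominates :: "int \<Rightarrow> int \<Rightarrow> bool" where
  "dominates p q \<longleftrightarrow> (r, q) \<notin> (Restr E (- {p}))\<^sup>*"

text \<open>The search never meets vertices out of reach of \<open>r\<close>; whether there are any
  is decided separately, by counting.\<close>

definition all_dominated :: bool where
  "all_dominated \<longleftrightarrow> (\<forall>q k. (r, q) \<in> E\<^sup>* \<and> k \<in> {0..<4} \<and> B q k \<noteq> 0 \<longrightarrow> dominates (B q k) q)"

lemma E_I: "v \<in> {1..n} \<Longrightarrow> k \<in> {0..<4} \<Longrightarrow> A v k \<noteq> 0 \<Longrightarrow> (v, A v k) \<in> E"
  unfolding E_def by blast

lemma E_E:
  assumes "(v, w) \<in> E"
  obtains k where "v \<in> {1..n}" "w \<in> {1..n}" "k \<in> {0..<4}" "A v k = w" "w \<noteq> 0"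
proof -
  obtain k where k: "v \<in> {1..n}" "k \<in> {0..<4}" "A v k = w" "w \<noteq> 0"
    using assms unfolding E_def by blast
  then have "w \<in> {1..n}" using A_range[of v k] by auto
  with k that show thesis by blast
qed

lemma sym_E: "sym E"
proof (rule symI)
  fix v w assume "(v, w) \<in> E"
  then obtain k where k: "v \<in> {1..n}" "w \<in> {1..n}" "k \<in> {0..<4}" "A v k = w" "w \<noteq> 0"
    by (rule E_E)
  then obtain k' where "k' \<in> {0..<4}" "A w k' = v" using A_sym[of v k] by auto
  then show "(w, v) \<in> E" using E_I[of w k'] k by auto
qed

lemma sym_Restr_E: "sym (Restr E X)"
  using sym_E by (auto simp: sym_def)

end

text \<open>The list \<open>xs\<close> is the search stack, top first; it is not stored by the algorithm, which
  keeps the predecessor \<open>R\<close> only. \<open>D\<close> is the discovery number (\<open>0\<close> if undiscovered), \<open>P\<close> the number of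
  explored directions, \<open>5\<close> when the vertex has been removed from the stack.
  While \<open>x\<close> is on the stack, its discovered descendants are the vertices \<open>u\<close> with \<open>D x \<le> D u\<close>.\<close>

locale dfs_state = bad_graph +
  fixes xs :: "int list" and P D R :: "int \<Rightarrow> int" and c :: int
  assumes xs_V: "set xs \<subseteq> {1..n}" and dist: "distinct xs"
    and last: "xs \<noteq> [] \<Longrightarrow> last xs = r"
    and decr: "\<And>i j. i < j \<Longrightarrow> j < length xs \<Longrightarrow> D (xs ! j) < D (xs ! i)"
    and chain: "\<And>i. Suc i < length xs \<Longrightarrow> R (xs ! i) = xs ! Suc i \<and> 1 \<le> P (xs ! Suc i) \<and>
       A (xs ! Suc i) (P (xs ! Suc i) - 1) = xs ! i"
    and R_root: "R r = 0"
    and D_le: "\<And>u. 0 \<le> D u \<and> D u \<le> c" and D_V: "\<And>u. D u \<noteq> 0 \<Longrightarrow> u \<in> {1..n}"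
    and D_root: "D r \<noteq> 0" and D_xs: "\<And>u. u \<in> set xs \<Longrightarrow> D u \<noteq> 0"
    and c_card: "c = int (card {u. D u \<noteq> 0})"
    and P_new: "\<And>u. u \<in> {1..n} \<Longrightarrow> D u = 0 \<Longrightarrow> P u = 0"
    and P_xs: "\<And>u. u \<in> set xs \<Longrightarrow> 0 \<le> P u \<and> P u \<le> 4"
    and P_done: "\<And>u. D u \<noteq> 0 \<Longrightarrow> u \<notin> set xs \<Longrightarrow> P u = 5"
    and explored: "\<And>u k. u \<in> {1..n} \<Longrightarrow> k \<in> {0..<4} \<Longrightarrow> k < P u \<Longrightarrow> A u k \<noteq> 0 \<Longrightarrow> D (A u k) \<noteq> 0"
    and no_cross: "\<And>x u k. x \<in> set xs \<Longrightarrow> D u \<noteq> 0 \<Longrightarrow> u \<notin> set xs \<Longrightarrow> D u < D x \<Longrightarrow> k \<in> {0..<4} \<Longrightarrow>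
       A u k \<noteq> 0 \<Longrightarrow> D (A u k) < D x"
    and below: "\<And>x u. x \<in> set xs \<Longrightarrow> D x \<le> D u \<Longrightarrow> (x, u) \<in> (Restr E {w. D x \<le> D w})\<^sup>*"
    and D_reach: "\<And>u. D u \<noteq> 0 \<Longrightarrow> (r, u) \<in> E\<^sup>*"
begin

lemma chain_edge: "Suc i < length xs \<Longrightarrow> (xs ! Suc i, xs ! i) \<in> E"
proof -
  assume i: "Suc i < length xs"
  let ?y = "xs ! Suc i"
  have y: "?y \<in> {1..n}" "xs ! i \<in> {1..n}" using xs_V i by (auto simp: subset_iff)
  have "P ?y - 1 \<in> {0..<4}" using chain[OF i] P_xs[of ?y] i by auto
  then show ?thesis using E_I[OF y(1), of "P ?y - 1"] chain[OF i] y by auto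
qed

text \<open>Read from bottom to top, the stack is a tree path from \<open>r\<close>; this path is
  the witness against domination by any vertex that is not on it.\<close>

lemma stack_reach:
  "i < length xs \<Longrightarrow> p \<notin> set (drop i xs) \<Longrightarrow> (r, xs ! i) \<in> (Restr E (- {p}))\<^sup>*"
proof (induction "length xs - i" arbitrary: i rule: less_induct)
  case less
  show ?case
  proof (cases "Suc i < length xs")
    case True
    have d: "drop i xs = xs ! i # drop (Suc i) xs" "drop (Suc i) xs = xs ! Suc i # drop (Suc (Suc i)) xs"
      using True less.prems by (simp_all add: Cons_nth_drop_Suc)
    then have "(r, xs ! Suc i) \<in> (Restr E (- {p}))\<^sup>*"
      using less.hyps[of "Suc i"] True less.prems by auto
    moreover have "(xs ! Suc i, xs ! i) \<in> Restr E (- {p})"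
      using chain_edge[OF True] d less.prems by auto
    ultimately show ?thesis by (rule rtrancl_into_rtrancl)
  next
    case False
    then have "xs \<noteq> []" "i = length xs - 1" using less.prems by auto
    then show ?thesis using last by (simp add: last_conv_nth)
  qed
qed

lemma decr_iff: "i < length xs \<Longrightarrow> j < length xs \<Longrightarrow> D (xs ! j) < D (xs ! i) \<longleftrightarrow> i < j"
  using decr by (metis less_asym linorder_neqE_nat)

lemma decr_le: "i < length xs \<Longrightarrow> j < length xs \<Longrightarrow> D (xs ! j) \<le> D (xs ! i) \<longleftrightarrow> i \<le> j"
  using decr_iff by (metis linorder_not_less)

lemma not_dominates_if_off_stack:
  assumes "xs = x # ys" "w \<notin> set xs"
  shows "\<not> dominates w x"
  using stack_reach[of 0 w] assms by (auto simp: dominates_def)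

lemma finite_D: "finite {u. D u \<noteq> 0}"
  by (rule finite_subset[of _ "{1..n}"]) (use D_V in auto)

lemma c_le: "c \<le> n"
proof -
  have "card {u. D u \<noteq> 0} \<le> card {1..n}" using D_V by (intro card_mono) auto
  then show ?thesis using c_card root by simp
qed

text \<open>Membership in the stack as the program tests it. A vertex below the top has explored at
  least the direction of its child on the stack, and removal sets \<open>P\<close> to 5. The top is
  excluded because its \<open>P\<close> may still be 0.\<close>

lemma set_tl_iff:
  assumes "xs = x # ys" "w \<noteq> x" "w \<in> {1..n}"
  shows "w \<in> set xs \<longleftrightarrow> 1 \<le> P w \<and> P w \<le> 4"
proof
  assume "w \<in> set xs"
  then obtain i where "i < length ys" "ys ! i = w" using assms by (auto simp: in_set_conv_nth)
  then show "1 \<le> P w \<and> P w \<le> 4" using chain[of i] P_xs[of w] assms \<open>w \<in> set xs\<close> by auto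
next
  assume "1 \<le> P w \<and> P w \<le> 4"
  then show "w \<in> set xs" using P_new[of w] P_done[of w] assms by fastforce
qed

text \<open>All discovered vertices are finished, so the discovered set is closed under
  edges.\<close>

lemma empty_reach: assumes "xs = []" shows "D u \<noteq> 0 \<longleftrightarrow> (r, u) \<in> E\<^sup>*"
proof
  assume "(r, u) \<in> E\<^sup>*"
  then show "D u \<noteq> 0"
  proof (induction rule: rtrancl_induct)
    case (step v w)
    then obtain k where "v \<in> {1..n}" "k \<in> {0..<4}" "A v k = w" "w \<noteq> 0" by (auto elim: E_E)
    then show ?case using explored[of v k] P_done[of v] step assms by auto
  qed (rule D_root)
qed (rule D_reach)

section \<open>The search invariant under the three moves of the search\<close>

lemma stay:
  assumes "xs = x # ys" "P x < 4" "A x (P x) = 0 \<or> D (A x (P x)) \<noteq> 0"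
  shows "dfs_state n A B r xs (P(x := P x + 1)) D R c"
proof -
  have "x \<in> {1..n}" "0 \<le> P x" using xs_V P_xs[of x] assms(1) by auto
  have nx: "xs ! Suc i \<noteq> x" if "Suc i < length xs" for i
    using dist assms(1) that by auto
  have x0: "D x \<noteq> 0" "x \<in> set xs" using D_xs assms(1) by auto
  \<comment> \<open>Case numbers here and below count the assumptions that \<open>dfs_state\<close>
    adds, from \<open>xs_V\<close> as 1 to \<open>D_reach\<close> as 18.\<close>
  show ?thesis
  proof (unfold_locales, goal_cases)
    case (5 i)
    then show ?case using chain[OF 5] nx[OF 5] by simp
  next
    case (12 u)
    then show ?case using P_new x0 by auto
  next
    case (13 u)
    then show ?case using P_xs[of u] assms by auto
  next
    case (14 u)
    then show ?case using P_done[of u] x0 by auto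
  next
    case (15 u k)
    then show ?case using explored[of u k] assms by (cases "u = x \<and> k = P x") (auto split: if_splits)
  qed (use xs_V dist last decr R_root D_le D_V D_root D_xs c_card no_cross below D_reach in auto)
qed

text \<open>The new vertex gets the largest number and thus joins the subtree of every stack vertex;
  it is reached there through \<open>x\<close> and the tree edge from \<open>x\<close>.\<close>

lemma push:
  assumes x: "xs = x # ys" "P x < 4" and u: "A x (P x) = u" "u \<noteq> 0" "D u = 0"
  shows "dfs_state n A B r (u # xs) (P(x := P x + 1)) (D(u := c + 1)) (R(u := x)) (c + 1)"
proof -
  let ?D = "D(u := c + 1)" and ?P = "P(x := P x + 1)"
  have xV: "x \<in> {1..n}" "0 \<le> P x" using xs_V P_xs[of x] assms(1) by auto
  have uV: "u \<in> {1..n}" using A_range[of x "P x"] xV x u by auto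
  have xu: "(x, u) \<in> E" using E_I[of x "P x"] xV x u by auto
  have nx: "xs ! Suc i \<noteq> x" if "Suc i < length xs" for i
    using dist assms(1) that by auto
  have nu: "u \<notin> set xs" "u \<noteq> x" using D_xs u x by auto
  have nu': "xs ! i \<noteq> u" if "i < length xs" for i using that nu by (metis nth_mem)
  have x0: "D x \<noteq> 0" "x \<in> set xs" using D_xs assms(1) by auto
  have c0: "c \<ge> 0" using D_le[of u] by simp
  have mono: "D w \<le> ?D w" for w using D_le[of w] u by simp
  have sub: "(Restr E {w. D z \<le> D w})\<^sup>* \<subseteq> (Restr E {w. D z \<le> ?D w})\<^sup>*" for z
    by (intro rtrancl_mono) (use mono order_trans in blast)
  have Dx: "D x \<le> c" using D_le by auto
  show ?thesis
  proof (unfold_locales, goal_cases)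
    case 1
    then show ?case using uV xs_V by auto
  next
    case 2
    then show ?case using nu dist by auto
  next
    case 3
    then show ?case using last x by auto
  next
    case (4 i j)
    then obtain j' where j': "j = Suc j'" by (cases j) auto
    show ?case
    proof (cases i)
      case 0
      then show ?thesis using 4 j' nu' D_le[of "xs ! j'"] by auto
    next
      case (Suc i')
      then show ?thesis using 4 j' nu' decr[of i' j'] by auto
    qed
  next
    case (5 i)
    show ?case
    proof (cases i)
      case 0
      then show ?thesis using x u xV by auto
    next
      case (Suc i')
      then show ?thesis using 5 chain[of i'] nx[of i'] nu'[of i'] by auto
    qed
  next
    case 6
    then show ?case using R_root nu u D_root by auto
  next
    case (7 v)
    then show ?case using D_le[of v] c0 by auto
  next
    case (8 v)
    then show ?case using D_V[of v] uV by (auto split: if_splits)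
  next
    case 9
    then show ?case using D_root c0 by auto
  next
    case (10 v)
    then show ?case using D_xs[of v] c0 by auto
  next
    case 11
    have "{v. ?D v \<noteq> 0} = insert u {v. D v \<noteq> 0}" using c0 by auto
    then show ?case using c_card finite_D u by simp
  next
    case (12 v)
    then show ?case using P_new[of v] x0 c0 by (auto split: if_splits)
  next
    case (13 v)
    then show ?case using P_xs[of v] P_new[of u] u uV assms by auto
  next
    case (14 v)
    then show ?case using P_done[of v] x0 by (auto split: if_splits)
  next
    case (15 v k)
    have "D (A v k) \<noteq> 0 \<or> A v k = u"
      using explored[of v k] 15 u by (cases "v = x \<and> k = P x") (auto split: if_splits)
    then show ?case using c0 by auto
  next
    case (16 z v k)
    have v: "v \<noteq> u" "v \<notin> set xs" "D v \<noteq> 0" using 16 by auto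
    have "v \<in> {1..n}" "P v = 5" using v D_V P_done by auto
    \<comment> \<open>A finished vertex has discovered neighbours only, so the new vertex is not
      among them and \<open>no_cross\<close> is preserved.\<close>
    then have w: "D (A v k) \<noteq> 0" using explored[of v k] 16 by auto
    then have "A v k \<noteq> u" using u by auto
    then show ?case using 16 no_cross[of z v k] v D_le[of "A v k"] D_le[of v] by (cases "z = u") auto
  next
    case (17 z v)
    show ?case
    proof (cases "z = u")
      case True
      then show ?thesis using 17 D_le[of v] by (cases "v = u") auto
    next
      case False
      then have z: "z \<in> set xs" "?D z = D z" using 17 by auto
      have zx: "D z \<le> D x"
      proof -
        obtain i where "i < length xs" "xs ! i = z" using z by (auto simp: in_set_conv_nth)
        then show ?thesis using decr_le[of 0 i] x by auto
      qed
      show ?thesis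
      proof (cases "v = u")
        case True
        have "(z, x) \<in> (Restr E {w. D z \<le> ?D w})\<^sup>*" using below[OF z(1) zx] sub by blast
        moreover have "(x, u) \<in> Restr E {w. D z \<le> ?D w}"
          using xu zx Dx nu by auto
        ultimately show ?thesis using True z by (simp only: rtrancl_into_rtrancl)
      next
        case False
        then have "(z, v) \<in> (Restr E {w. D z \<le> D w})\<^sup>*" using below[OF z(1), of v] z 17 by auto
        then show ?thesis unfolding z(2) using sub by blast
      qed
    qed
  next
    case (18 v)
    then show ?case using D_reach[of v] D_reach[OF x0(1)] xu
      by (cases "v = u") (auto intro: rtrancl_into_rtrancl)
  qed
qed

text \<open>\<open>x\<close> carries the largest number on the stack. Hence no remaining stack
  vertex was discovered after it, and \<open>no_cross\<close> asks nothing of the newly finished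
  \<open>x\<close>.\<close>

lemma pop:
  assumes x: "xs = x # ys" "P x = 4"
  shows "dfs_state n A B r ys (P(x := 5)) D R c"
proof -
  have x0: "D x \<noteq> 0" "x \<in> set xs" "x \<notin> set ys" using D_xs assms(1) dist by auto
  have top: "D z \<le> D x" if "z \<in> set ys" for z
  proof -
    obtain i where "i < length ys" "ys ! i = z" using \<open>z \<in> set ys\<close> by (auto simp: in_set_conv_nth)
    then show ?thesis using decr[of 0 "Suc i"] x by auto
  qed
  show ?thesis
  proof (unfold_locales, goal_cases)
    case (4 i j)
    then show ?case using decr[of "Suc i" "Suc j"] x by auto
  next
    case (5 i)
    then have "ys ! Suc i \<noteq> x" using x0 by auto
    then show ?case using chain[of "Suc i"] 5 x by auto
  next
    case (12 v)
    then show ?case using P_new[of v] x0 by auto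
  next
    case (13 v)
    then show ?case using P_xs[of v] x0 x by auto
  next
    case (14 v)
    then show ?case using P_done[of v] x by auto
  next
    case (15 v k)
    then show ?case using explored[of v k] x by (auto split: if_splits)
  next
    case (16 z v k)
    then have "v \<noteq> x" using top[of z] by auto
    then show ?case using no_cross[of z v k] 16 x by auto
  qed (use x xs_V dist last R_root D_le D_V D_root D_xs c_card below D_reach in auto)
qed

end

text \<open>Low points. What \<open>Lw\<close> knows about the subtree of a stack vertex is still distributed over this
  vertex and the vertices above it on the stack, whence the quantifier over \<open>j \<le> i\<close>.\<close>

locale low_state = dfs_state +
  fixes Lw :: "int \<Rightarrow> int"
  assumes Lw_range: "\<And>x. x \<in> set xs \<Longrightarrow> 1 \<le> Lw x \<and> Lw x \<le> D x"
    and Lw_sound: "\<And>x. x \<in> set xs \<Longrightarrow> Lw x < D x \<Longrightarrow>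
      \<exists>u k. D x \<le> D u \<and> k \<in> {0..<4} \<and> A u k \<noteq> 0 \<and> D (A u k) = Lw x"
    and Lw_complete: "\<And>i u k. i < length xs \<Longrightarrow> u \<in> {1..n} \<Longrightarrow> D (xs ! i) \<le> D u \<Longrightarrow> k \<in> {0..<4} \<Longrightarrow> k < P u \<Longrightarrow>
      A u k \<noteq> 0 \<Longrightarrow> \<exists>j\<le>i. Lw (xs ! j) \<le> D (A u k)"
begin

text \<open>An edge out of the fully explored subtree of \<open>x\<close> ends at a vertex
  \<open>w\<close> with \<open>Lw x \<le> D w\<close>, hence \<open>D p \<le> D w\<close>. Outside
  the subtree, \<open>w\<close> would either be on the stack between \<open>p\<close> and
  \<open>x\<close>, where only \<open>p\<close> itself fits, or be finished with a smaller number
  than \<open>x\<close>, which \<open>no_cross\<close> excludes.\<close>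

lemma below_closed:
  assumes x: "xs = x # p # ys" "P x = 4" and le: "D p \<le> Lw x"
    and u: "D x \<le> D u" and uw: "(u, w) \<in> E"
  shows "w = p \<or> D x \<le> D w"
proof (rule ccontr)
  assume n: "\<not> (w = p \<or> D x \<le> D w)"
  obtain k where k: "u \<in> {1..n}" "w \<in> {1..n}" "k \<in> {0..<4}" "A u k = w" "w \<noteq> 0"
    using uw by (rule E_E)
  obtain k' where k': "k' \<in> {0..<4}" "A w k' = u" using A_sym k by metis
  have px: "D p < D x" using decr[of 0 1] x by auto
  \<comment> \<open>Every edge of the subtree has been explored: \<open>x\<close> is the only stack
    vertex in it and has \<open>P x = 4\<close>; the others are finished, with value 5.\<close>
  have Pu: "k < P u"
  proof (cases "u \<in> set xs")
    case True
    then obtain i where i: "i < length xs" "xs ! i = u" by (auto simp: in_set_conv_nth)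
    then have "i = 0" using decr_le[of i 0] u x by auto
    then show ?thesis using i x k by auto
  next
    case False
    have "D x \<ge> 1" using D_xs[of x] D_le[of x] x by auto
    then have "D u \<noteq> 0" using u by auto
    then show ?thesis using P_done False k by auto
  qed
  then have "Lw x \<le> D w" using Lw_complete[of 0 u k] x u k by auto
  moreover have w0: "D w \<noteq> 0" using explored[of u k] Pu k by auto
  ultimately have "D p \<le> D w" "D w < D x" using le n by auto
  show False
  proof (cases "w \<in> set xs")
    case True
    then obtain i where i: "i < length xs" "xs ! i = w" by (auto simp: in_set_conv_nth)
    then have "i > 0" "i \<le> 1" using decr_le[of i 1] decr_le[of i 0] \<open>D p \<le> D w\<close> \<open>D w < D x\<close> x
      by (auto intro: gr0I)
    then have "i = 1" by simp
    then show False using i x n by auto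
  next
    case False
    then show False using no_cross[of x w k'] w0 k' k x \<open>D w < D x\<close> u by auto
  qed
qed

text \<open>By \<open>below_closed\<close> a path from \<open>q\<close> that avoids \<open>p\<close>
  never leaves the subtree of \<open>x\<close>, but \<open>r\<close> was discovered before
  \<open>x\<close>.\<close>

lemma pop_dominates:
  assumes x: "xs = x # p # ys" "P x = 4" and le: "D p \<le> Lw x" and q: "D x \<le> D q"
  shows "dominates p q"
  unfolding dominates_def
proof
  assume "(r, q) \<in> (Restr E (- {p}))\<^sup>*"
  then have "(q, r) \<in> (Restr E (- {p}))\<^sup>*" using sym_rtrancl[OF sym_Restr_E] by (meson symD)
  then have "D x \<le> D r"
  proof (induction rule: rtrancl_induct)
    case (step v w)
    then show ?case using below_closed[OF x le, of v w] by auto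
  qed (rule q)
  moreover have "D r < D x"
  proof -
    let ?m = "length xs - 1"
    have "xs ! ?m = r" using last x by (metis last_conv_nth list.distinct(1))
    then show ?thesis using decr[of 0 ?m] x by auto
  qed
  ultimately show False by simp
qed

text \<open>The low point names an edge from the subtree of \<open>x\<close> to a vertex
  \<open>?w\<close> discovered before \<open>p\<close>. The detour around \<open>p\<close> follows
  the stack from \<open>r\<close> to \<open>?w\<close>, takes this edge, and runs through
  \<open>x\<close> to \<open>q\<close> inside the subtree.\<close>

lemma pop_not_dominates:
  assumes x: "xs = x # p # ys" and lt: "Lw x < D p" and q: "D x \<le> D q"
  shows "\<not> dominates p q"
proof -
  have px: "D p < D x" using decr[of 0 1] x by auto
  obtain u k where u: "D x \<le> D u" "k \<in> {0..<4}" "A u k \<noteq> 0" "D (A u k) = Lw x"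
    using Lw_sound[of x] lt px x by auto
  let ?w = "A u k"
  have xx: "x \<in> set xs" using x by auto
  have uV: "u \<in> {1..n}" using D_V[of u] D_xs[OF xx] D_le[of x] u by fastforce
  have uw: "(u, ?w) \<in> E" using E_I uV u by auto
  have Lw1: "1 \<le> Lw x" using Lw_range[OF xx] by auto
  have wV: "?w \<in> {1..n}" using D_V[of ?w] u Lw1 by auto
  obtain k' where k': "k' \<in> {0..<4}" "A ?w k' = u" using A_sym uV u by metis
  \<comment> \<open>A finished vertex discovered before \<open>x\<close> has no edge into the
    subtree of \<open>x\<close>, by \<open>no_cross\<close>.\<close>
  have "?w \<in> set xs"
  proof (rule ccontr)
    assume "?w \<notin> set xs"
    then show False using no_cross[of x ?w k'] k' u Lw1 uV xx lt px by auto
  qed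
  then obtain i where i: "i < length xs" "xs ! i = ?w" by (auto simp: in_set_conv_nth)
  \<comment> \<open>\<open>?w\<close> lies strictly beneath \<open>p\<close>, whose index is 1, so
    the stack path to it avoids \<open>p\<close>.\<close>
  then have "i > 1" using decr_iff[of 1 i] u lt x by auto
  then have "p \<notin> set (drop i xs)"
    using dist x by (cases i; cases "i - 1") (auto dest: in_set_dropD)
  then have rw: "(r, ?w) \<in> (Restr E (- {p}))\<^sup>*" using stack_reach[of i p] i by auto
  have sub: "Restr E {w. D x \<le> D w} \<subseteq> Restr E (- {p})" using px by auto
  have xu: "(x, u) \<in> (Restr E (- {p}))\<^sup>*"
    using below[OF xx u(1)] rtrancl_mono[OF sub] by blast
  have xq: "(x, q) \<in> (Restr E (- {p}))\<^sup>*"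
    using below[OF xx q] rtrancl_mono[OF sub] by blast
  have "(?w, u) \<in> Restr E (- {p})"
    using symD[OF sym_E uw] u lt px by auto
  moreover have "(u, x) \<in> (Restr E (- {p}))\<^sup>*"
    using xu sym_rtrancl[OF sym_Restr_E] by (meson symD)
  ultimately have "(r, q) \<in> (Restr E (- {p}))\<^sup>*"
    using rw xq by (meson rtrancl_trans r_into_rtrancl)
  then show ?thesis by (simp add: dominates_def)
qed

lemma low_stay:
  assumes x: "xs = x # ys" "P x < 4"
    and Lw': "A x (P x) = 0 \<and> Lw' = Lw \<or>
      A x (P x) \<noteq> 0 \<and> D (A x (P x)) \<noteq> 0 \<and> Lw' = Lw(x := min (Lw x) (D (A x (P x))))"
  shows "low_state n A B r xs (P(x := P x + 1)) D R c Lw'"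
proof -
  interpret s: dfs_state n A B r xs "P(x := P x + 1)" D R c
    using stay[OF x] Lw' by blast
  have xV: "x \<in> {1..n}" "0 \<le> P x" "x \<in> set xs" using xs_V P_xs[of x] x by auto
  have le: "Lw' z \<le> Lw z" for z using Lw' by auto
  show ?thesis
  proof (unfold_locales, goal_cases)
    case (1 z)
    then show ?case using Lw_range[of z] Lw' D_le[of "A x (P x)"] by auto
  next
    case (2 z)
    show ?case
    proof (cases "Lw' z = Lw z")
      case True
      then show ?thesis using Lw_sound[of z] 2 by auto
    next
      case False
      then have "z = x" "A x (P x) \<noteq> 0" "D (A x (P x)) = Lw' z" using Lw' by (auto split: if_splits)
      then show ?thesis using x xV by (intro exI[of _ x] exI[of _ "P x"]) auto
    qed
  next
    case (3 i u k)
    show ?case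
    proof (cases "u = x \<and> k = P x")
      case True
      then show ?thesis using Lw' 3 x by (intro exI[of _ 0]) auto
    next
      case False
      then have "k < P u" using 3 by (auto split: if_splits)
      then obtain j where "j \<le> i" "Lw (xs ! j) \<le> D (A u k)"
        using Lw_complete[of i u k] 3 by auto
      then show ?thesis using le[of "xs ! j"] by (meson order_trans)
    qed
  qed
qed

lemma low_push:
  assumes x: "xs = x # ys" "P x < 4" and u: "A x (P x) = u" "u \<noteq> 0" "D u = 0"
  shows "low_state n A B r (u # xs) (P(x := P x + 1)) (D(u := c + 1)) (R(u := x)) (c + 1) (Lw(u := c + 1))"
proof -
  let ?D = "D(u := c + 1)"
  interpret s: dfs_state n A B r "u # xs" "P(x := P x + 1)" "D(u := c + 1)" "R(u := x)" "c + 1"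
    using push[OF x u] .
  have nu: "u \<notin> set xs" "u \<noteq> x" using D_xs u x by auto
  have c0: "c \<ge> 0" using D_le[of u] by simp
  have uV: "u \<in> {1..n}" using s.xs_V by auto
  have mono: "D w \<le> ?D w" for w using D_le[of w] u by simp
  show ?thesis
  proof (unfold_locales, goal_cases)
    case (1 z)
    then show ?case using Lw_range[of z] nu c0 by auto
  next
    case (2 z)
    then have z: "z \<in> set xs" "z \<noteq> u" by auto
    then obtain v k where v: "D z \<le> D v" "k \<in> {0..<4}" "A v k \<noteq> 0" "D (A v k) = Lw z"
      using Lw_sound[of z] 2 by auto
    have "A v k \<noteq> u" using v Lw_range[OF z(1)] u by auto
    then show ?case using v z mono[of v] by (intro exI[of _ v] exI[of _ k]) auto
  next
    case (3 i v k)
    show ?case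
    proof (cases "A v k = u")
      case True
      \<comment> \<open>The low point of the new vertex starts as its own number, so the top covers
        every edge into it.\<close>
      then show ?thesis by (intro exI[of _ 0]) auto
    next
      case False
      have "v \<noteq> u" using 3 P_new[OF uV u(3)] nu by auto
      then obtain i' where i: "i = Suc i'" "i' < length xs" using 3 D_le[of v] by (cases i) auto
      have "xs ! i' \<noteq> u" using i nu by (metis nth_mem)
      moreover have "k < P v" using False 3 u by (cases "v = x \<and> k = P x") (auto split: if_splits)
      ultimately obtain j where j: "j \<le> i'" "Lw (xs ! j) \<le> D (A v k)"
        using Lw_complete[of i' v k] 3 i \<open>v \<noteq> u\<close> by auto
      moreover have "xs ! j \<noteq> u" using i j nu by (metis nth_mem le_less_trans)
      ultimately show ?thesis using False i by (intro exI[of _ "Suc j"]) auto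
    qed
  qed
qed

text \<open>What \<open>x\<close> knew about its subtree passes to its parent, which now has index 0
  as \<open>x\<close> had before. An index \<open>j > 0\<close> in \<open>Lw_complete\<close>
  becomes \<open>j - 1\<close>, and 0 remains 0.\<close>

lemma low_pop:
  assumes x: "xs = x # ys" "P x = 4"
    and Lw': "ys = [] \<and> Lw' = Lw \<or> (\<exists>p zs. ys = p # zs \<and> Lw' = Lw(p := min (Lw p) (Lw x)))"
  shows "low_state n A B r ys (P(x := 5)) D R c Lw'"
proof -
  interpret s: dfs_state n A B r ys "P(x := 5)" D R c
    using pop[OF x] .
  have le: "Lw' z \<le> Lw z" for z using Lw' by auto
  have top: "D z \<le> D x" if "z \<in> set ys" for z
  proof -
    obtain i where "i < length ys" "ys ! i = z" using \<open>z \<in> set ys\<close> by (auto simp: in_set_conv_nth)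
    then show ?thesis using decr[of 0 "Suc i"] x by auto
  qed
  show ?thesis
  proof (unfold_locales, goal_cases)
    case (1 z)
    then show ?case using Lw_range[of z] Lw_range[of x] Lw' x by auto
  next
    case (2 z)
    show ?case
    proof (cases "Lw' z = Lw z")
      case True
      then show ?thesis using Lw_sound[of z] 2 x by auto
    next
      case False
      then have "Lw' z = Lw x" "Lw x < Lw z" using Lw' by (auto split: if_splits)
      then have "Lw x < D x" using Lw_range[of z] 2 x top[of z] by auto
      then obtain u k where "D x \<le> D u" "k \<in> {0..<4}" "A u k \<noteq> 0" "D (A u k) = Lw x"
        using Lw_sound[of x] x by auto
      then show ?thesis using top[OF 2(1)] \<open>Lw' z = Lw x\<close>
        by (intro exI[of _ u] exI[of _ k]) auto
    qed
  next
    case (3 i u k)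
    then obtain p zs where p: "ys = p # zs" "Lw' = Lw(p := min (Lw p) (Lw x))" using Lw' by auto
    have "k < P u" using 3 x by (auto split: if_splits)
    then obtain j where j: "j \<le> Suc i" "Lw (xs ! j) \<le> D (A u k)"
      using Lw_complete[of "Suc i" u k] 3 x by auto
    show ?case
    proof (cases j)
      case 0
      then show ?thesis using j p x by (intro exI[of _ 0]) auto
    next
      case (Suc j')
      then show ?thesis using j x le[of "ys ! j'"] by (intro exI[of _ j']) auto
    qed
  qed
qed

end

text \<open>\<open>Nd x \<noteq> 0\<close> requests that the parent of \<open>x\<close> in the search tree dominate the subtree of \<open>x\<close>. The
  request is decided when \<open>x\<close> is popped.\<close>

locale need_state = low_state +
  fixes Nd :: "int \<Rightarrow> int"
  assumes Nd_new: "\<And>u. D u = 0 \<Longrightarrow> Nd u = 0"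
    and Nd_sound: "\<And>i. Suc i < length xs \<Longrightarrow> Nd (xs ! i) \<noteq> 0 \<Longrightarrow>
      \<exists>q k. D (xs ! i) \<le> D q \<and> k \<in> {0..<4} \<and> B q k = xs ! Suc i"
    and Nd_complete: "\<And>q k. q \<in> {1..n} \<Longrightarrow> k \<in> {0..<4} \<Longrightarrow> k < P q \<Longrightarrow> B q k \<noteq> 0 \<Longrightarrow>
      dominates (B q k) q \<or>
      (\<exists>i. Suc i < length xs \<and> B q k = xs ! Suc i \<and> D (xs ! i) \<le> D q \<and> Nd (xs ! i) \<noteq> 0)"
begin

lemma reject_pop:
  assumes "xs = x # p # ys" "Nd x \<noteq> 0" "Lw x < D p"
  shows "\<not> all_dominated"
proof -
  obtain q k where q: "D x \<le> D q" "k \<in> {0..<4}" "B q k = p"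
    using Nd_sound[of 0] assms by auto
  have "D x \<noteq> 0" "p \<noteq> 0" using D_xs xs_V assms(1) by auto
  then have "D q \<noteq> 0" using q D_le[of x] by auto
  then have "(r, q) \<in> E\<^sup>*" by (rule D_reach)
  then show ?thesis
    using pop_not_dominates[OF assms(1,3) q(1)] q \<open>p \<noteq> 0\<close> unfolding all_dominated_def by blast
qed

lemma reject_stay:
  assumes "xs = x # ys" "0 \<le> k" "k < 4" "B x k \<noteq> 0" "\<not> (1 \<le> P (B x k) \<and> P (B x k) \<le> 4)"
  shows "\<not> all_dominated"
proof -
  have x: "x \<in> {1..n}" "D x \<noteq> 0" using xs_V D_xs assms(1) by auto
  have w: "B x k \<noteq> x" "B x k \<in> {1..n}" using B_irrefl[of x k] B_range[of x k] x assms by auto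
  then have "B x k \<notin> set xs" using set_tl_iff[OF assms(1)] assms by blast
  then show ?thesis
    using not_dominates_if_off_stack[OF assms(1)] D_reach[OF x(2)] assms unfolding all_dominated_def by auto
qed

text \<open>An empty stack has no neighbouring entries, hence no pending request, and every
  discovered vertex has all four directions explored.\<close>

lemma accept:
  assumes "xs = []"
  shows all_dominated
  unfolding all_dominated_def
proof (intro allI impI, elim conjE)
  fix q k assume q: "(r, q) \<in> E\<^sup>*" "k \<in> {0..<4}" "B q k \<noteq> 0"
  then have "D q \<noteq> 0" using empty_reach assms by blast
  then show "dominates (B q k) q"
    using Nd_complete[of q k] D_V P_done q assms by auto
qed

text \<open>\<open>P w - 1\<close> is the direction explored last from \<open>w\<close>, so
  \<open>A w (P w - 1)\<close> is the child of \<open>w\<close> on the stack. It gets the mark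
  because its subtree contains the top \<open>hd xs\<close>, where the request arises.\<close>

definition marked :: "(int \<Rightarrow> int) \<Rightarrow> bool" where
  "marked Nd' \<longleftrightarrow> (let x = hd xs; w = B x (P x) in w = 0 \<and> Nd' = Nd \<or>
     w \<noteq> 0 \<and> 1 \<le> P w \<and> P w \<le> 4 \<and> Nd' = Nd(A w (P w - 1) := 1))"

lemma marked_cases:
  assumes "marked Nd'" and x: "xs = x # ys" "P x < 4"
  shows "B x (P x) = 0 \<and> Nd' = Nd \<or>
    (\<exists>i. Suc i < length xs \<and> B x (P x) = xs ! Suc i \<and> Nd' = Nd(xs ! i := 1))"
proof (cases "B x (P x) = 0")
  case True
  then show ?thesis using assms(1) x(1) unfolding marked_def Let_def by simp
next
  case False
  let ?w = "B x (P x)"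
  have xV: "x \<in> {1..n}" "0 \<le> P x" using xs_V P_xs[of x] x by auto
  have w: "?w \<noteq> x" "?w \<in> {1..n}" using B_irrefl[of x "P x"] B_range[of x "P x"] xV x False by auto
  have m: "1 \<le> P ?w \<and> P ?w \<le> 4" "Nd' = Nd(A ?w (P ?w - 1) := 1)"
    using assms(1) x(1) False unfolding marked_def Let_def by simp_all
  then have "?w \<in> set xs" using set_tl_iff[OF x(1) w] by blast
  then obtain i where "i < length ys" "ys ! i = ?w" using x w by (auto simp: in_set_conv_nth)
  then show ?thesis using chain[of i] x m by auto
qed

lemma mark_sound:
  assumes "marked Nd'" and x: "xs = x # ys" "P x < 4" and i: "Suc i < length xs" "Nd' (xs ! i) \<noteq> 0"
  shows "\<exists>q k. D (xs ! i) \<le> D q \<and> k \<in> {0..<4} \<and> B q k = xs ! Suc i"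
proof (cases "Nd' (xs ! i) = Nd (xs ! i)")
  case True
  then show ?thesis using Nd_sound i by auto
next
  case False
  then obtain i' where i': "Suc i' < length xs" "B x (P x) = xs ! Suc i'" "Nd' = Nd(xs ! i' := 1)"
    using marked_cases[OF assms(1) x] by auto
  then have "xs ! i = xs ! i'" using False by (auto split: if_splits)
  then have "i = i'" using dist i i' by (simp add: nth_eq_iff_index_eq)
  moreover have "D (xs ! i) \<le> D x" using decr_le[of 0 i] i x by auto
  ultimately show ?thesis using i' x P_xs[of x] by (intro exI[of _ x] exI[of _ "P x"]) auto
qed

lemma mark_complete:
  assumes "marked Nd'" and x: "xs = x # ys" "P x < 4"
    and q: "q \<in> {1..n}" "k \<in> {0..<4}" "k < (P(x := P x + 1)) q" "B q k \<noteq> 0"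
  shows "dominates (B q k) q \<or>
      (\<exists>i. Suc i < length xs \<and> B q k = xs ! Suc i \<and> D (xs ! i) \<le> D q \<and> Nd' (xs ! i) \<noteq> 0)"
proof (cases "q = x \<and> k = P x")
  case True
  then obtain i where i: "Suc i < length xs" "B x (P x) = xs ! Suc i" "Nd' = Nd(xs ! i := 1)"
    using marked_cases[OF assms(1) x] q by auto
  moreover have "D (xs ! i) \<le> D x" using decr_le[of 0 i] i x by auto
  ultimately show ?thesis using True by (intro disjI2 exI[of _ i]) auto
next
  case False
  then have "k < P q" using q by (auto split: if_splits)
  then consider "dominates (B q k) q" | i where "Suc i < length xs" "B q k = xs ! Suc i"
      "D (xs ! i) \<le> D q" "Nd (xs ! i) \<noteq> 0"
    using Nd_complete[of q k] q by blast
  then show ?thesis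
  proof cases
    case (2 i)
    moreover have "Nd' (xs ! i) \<noteq> 0"
      using 2(4) marked_cases[OF assms(1) x] by (metis fun_upd_apply one_neq_zero)
    ultimately show ?thesis by blast
  qed blast
qed

lemma mark_new: "marked Nd' \<Longrightarrow> xs = x # ys \<Longrightarrow> P x < 4 \<Longrightarrow> D u = 0 \<Longrightarrow> Nd' u = 0"
proof -
  assume a: "marked Nd'" "xs = x # ys" "P x < 4" "D u = 0"
  then have "u \<notin> set xs" using D_xs by auto
  then show ?thesis
    using marked_cases[OF a(1-3)] Nd_new[OF a(4)] by (metis Suc_lessD fun_upd_other nth_mem)
qed

lemma need_stay:
  assumes m: "marked Nd'" and x: "xs = x # ys" "P x < 4"
    and Lw': "A x (P x) = 0 \<and> Lw' = Lw \<or>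
      A x (P x) \<noteq> 0 \<and> D (A x (P x)) \<noteq> 0 \<and> Lw' = Lw(x := min (Lw x) (D (A x (P x))))"
  shows "need_state n A B r xs (P(x := P x + 1)) D R c Lw' Nd'"
proof -
  interpret s: low_state n A B r xs "P(x := P x + 1)" D R c Lw'
    by (rule low_stay[OF x Lw'])
  show ?thesis
    by unfold_locales (fact mark_new[OF m x], fact mark_sound[OF m x], fact mark_complete[OF m x])
qed

lemma need_push:
  assumes m: "marked Nd'" and x: "xs = x # ys" "P x < 4" and u: "A x (P x) = u" "u \<noteq> 0" "D u = 0"
  shows "need_state n A B r (u # xs) (P(x := P x + 1)) (D(u := c + 1)) (R(u := x)) (c + 1)
    (Lw(u := c + 1)) Nd'"
proof -
  let ?D = "D(u := c + 1)"
  interpret s: low_state n A B r "u # xs" "P(x := P x + 1)" "D(u := c + 1)" "R(u := x)" "c + 1" "Lw(u := c + 1)"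
    by (rule low_push[OF x u])
  have nu: "u \<notin> set xs" using D_xs u by auto
  then have nu': "xs ! i \<noteq> u" if "i < length xs" for i using that by (metis nth_mem)
  have mono: "D w \<le> ?D w" for w using D_le[of w] u by simp
  show ?thesis
  proof (unfold_locales, goal_cases)
    case (1 v)
    then show ?case using mark_new[OF m x, of v] D_le[of u] by (auto split: if_splits)
  next
    case (2 i)
    show ?case
    proof (cases i)
      case 0
      then show ?thesis using 2 mark_new[OF m x u(3)] by auto
    next
      case (Suc i')
      then obtain q k where "D (xs ! i') \<le> D q" "k \<in> {0..<4}" "B q k = xs ! Suc i'"
        using mark_sound[OF m x, of i'] 2 by auto
      then show ?thesis using Suc 2 nu'[of i'] mono[of q] by (intro exI[of _ q] exI[of _ k]) auto
    qed
  next
    case (3 q k)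
    then consider "dominates (B q k) q" | i where "Suc i < length xs" "B q k = xs ! Suc i"
        "D (xs ! i) \<le> D q" "Nd' (xs ! i) \<noteq> 0"
      using mark_complete[OF m x, of q k] by blast
    then show ?case
    proof cases
      case (2 i)
      then show ?thesis using nu'[of i] mono[of q] by (intro disjI2 exI[of _ "Suc i"]) auto
    qed blast
  qed
qed

text \<open>Popping \<open>x\<close> decides the request at \<open>x\<close>: by
  \<open>pop_dominates\<close> it turns from pending into established domination. The other requests
  move down by one index.\<close>

lemma need_pop:
  assumes x: "xs = x # ys" "P x = 4"
    and Lw': "ys = [] \<and> Lw' = Lw \<or>
      (\<exists>p zs. ys = p # zs \<and> Lw' = Lw(p := min (Lw p) (Lw x)) \<and> (Nd x = 0 \<or> D p \<le> Lw x))"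
  shows "need_state n A B r ys (P(x := 5)) D R c Lw' Nd"
proof -
  interpret s: low_state n A B r ys "P(x := 5)" D R c Lw'
    by (rule low_pop[OF x]) (use Lw' in blast)
  show ?thesis
  proof (unfold_locales, goal_cases)
    case (1 u)
    then show ?case by (rule Nd_new)
  next
    case (2 i)
    then show ?case using Nd_sound[of "Suc i"] x by auto
  next
    case (3 q k)
    have "k < P q" using 3 x by (auto split: if_splits)
    then consider "dominates (B q k) q" | i where "Suc i < length xs" "B q k = xs ! Suc i"
        "D (xs ! i) \<le> D q" "Nd (xs ! i) \<noteq> 0"
      using Nd_complete[of q k] 3 by blast
    then show ?case
    proof cases
      case (2 i)
      show ?thesis
      proof (cases i)
        case 0
        then obtain p zs where p: "ys = p # zs" "Nd x = 0 \<or> D p \<le> Lw x" using Lw' 2 x by auto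
        then have "dominates p q" using pop_dominates[of x p zs q] 2 0 x by auto
        then show ?thesis using 2 0 p x by auto
      next
        case (Suc i')
        then show ?thesis using 2 x by (intro disjI2 exI[of _ i']) auto
      qed
    qed blast
  qed
qed

end

context bad_graph
begin

lemma need_init:
  "need_state n A B r [r] (\<lambda>_. 0) ((\<lambda>_. 0)(r := 1)) (\<lambda>_. 0) 1 ((\<lambda>_. 0)(r := 1)) (\<lambda>_. 0)"
proof -
  have e: "{u. u \<noteq> r \<longrightarrow> False} = {r}" by auto
  show ?thesis
    by unfold_locales (use root e in \<open>auto split: if_splits\<close>)
qed

end

section \<open>Cost and overflow of programs\<close>

definition bounded_state :: "int \<Rightarrow> state \<Rightarrow> bool" where
  "bounded_state N s \<longleftrightarrow> (\<forall>r. \<bar>regs s r\<bar> \<le> N) \<and> (\<forall>a. \<bar>mem s a\<bar> \<le> N)"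

text \<open>In a state bounded by \<open>N \<ge> 16\<close> an expression of degree \<open>k\<close> has intermediate values at most
  \<open>N ^ k\<close>. Hence a program of small degree that stores only values up to \<open>N\<close> never overflows.\<close>

primrec adeg :: "aexp \<Rightarrow> nat" where
  "adeg (Num n) = (if \<bar>n\<bar> \<le> 16 then 1 else 100)"
| "adeg (Reg r) = 1"
| "adeg (Mem a) = adeg a"
| "adeg (Add a b) = Suc (max (adeg a) (adeg b))"
| "adeg (Sub a b) = Suc (max (adeg a) (adeg b))"
| "adeg (Mul a b) = adeg a + adeg b"

primrec bdeg :: "bexp \<Rightarrow> nat" where
  "bdeg (Less a b) = max (adeg a) (adeg b)"
| "bdeg (Equal a b) = max (adeg a) (adeg b)"
| "bdeg (Not b) = bdeg b"
| "bdeg (And b c) = max (bdeg b) (bdeg c)"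

primrec cdeg :: "com \<Rightarrow> nat" where
  "cdeg Skip = 0"
| "cdeg (Assign r a) = adeg a"
| "cdeg (Store a b) = max (adeg a) (adeg b)"
| "cdeg (Seq c d) = max (cdeg c) (cdeg d)"
| "cdeg (Cond b c d) = max (bdeg b) (max (cdeg c) (cdeg d))"
| "cdeg (While b c) = max (bdeg b) (cdeg c)"

text \<open>What remains to be shown of \<open>afits\<close> once the size bounds follow from the
  degree.\<close>

primrec addresses_ok :: "state \<Rightarrow> aexp \<Rightarrow> bool" where
  "addresses_ok s (Num n) = True"
| "addresses_ok s (Reg r) = True"
| "addresses_ok s (Mem a) = (addresses_ok s a \<and> 0 \<le> aval s a)"
| "addresses_ok s (Add a b) = (addresses_ok s a \<and> addresses_ok s b)"
| "addresses_ok s (Sub a b) = (addresses_ok s a \<and> addresses_ok s b)"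
| "addresses_ok s (Mul a b) = (addresses_ok s a \<and> addresses_ok s b)"

primrec baddresses_ok :: "state \<Rightarrow> bexp \<Rightarrow> bool" where
  "baddresses_ok s (Less a b) = (addresses_ok s a \<and> addresses_ok s b)"
| "baddresses_ok s (Equal a b) = (addresses_ok s a \<and> addresses_ok s b)"
| "baddresses_ok s (Not b) = baddresses_ok s b"
| "baddresses_ok s (And b c) = (baddresses_ok s b \<and> baddresses_ok s c)"

text \<open>A sum costs one power beyond its larger term because \<open>2 \<le> N\<close>; hence the
  successor in \<open>adeg\<close> at \<open>Add\<close> and \<open>Sub\<close>.\<close>

lemma sum_le_power:
  fixes x y N :: int
  assumes "16 \<le> N" "\<bar>x\<bar> \<le> N ^ i" "\<bar>y\<bar> \<le> N ^ j"
  shows "\<bar>x\<bar> + \<bar>y\<bar> \<le> N ^ Suc (max i j)"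
proof -
  have "N ^ i \<le> N ^ max i j" "N ^ j \<le> N ^ max i j" "0 \<le> N ^ max i j"
    using assms(1) by (auto intro: power_increasing)
  moreover have "2 * N ^ max i j \<le> N * N ^ max i j"
    using assms(1) by (intro mult_right_mono) auto
  ultimately show ?thesis using assms(2,3) unfolding power_Suc by linarith
qed

text \<open>Literals of absolute value above 16 have degree 100, which the premise excludes; smaller
  ones are bounded by \<open>N\<close> itself.\<close>

lemma aval_bounded:
  assumes b: "bounded_state N s" and N: "16 \<le> N"
  shows "adeg e < 100 \<Longrightarrow> \<bar>aval s e\<bar> \<le> N ^ adeg e"
proof (induction e)
  case (Num n)
  then show ?case using N by (auto split: if_splits)
next
  case (Mem e)
  have "1 \<le> adeg e" by (induction e) auto
  then have "N ^ 1 \<le> N ^ adeg e" using N by (intro power_increasing) auto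
  moreover have "\<bar>mem s (aval s e)\<bar> \<le> N" using b by (simp add: bounded_state_def)
  ultimately show ?case by simp
next
  case (Add a b)
  then have "\<bar>aval s a\<bar> + \<bar>aval s b\<bar> \<le> N ^ Suc (max (adeg a) (adeg b))"
    by (intro sum_le_power[OF N]) auto
  then show ?case by simp
next
  case (Sub a b)
  then have "\<bar>aval s a\<bar> + \<bar>aval s b\<bar> \<le> N ^ Suc (max (adeg a) (adeg b))"
    by (intro sum_le_power[OF N]) auto
  then show ?case by simp
next
  case (Mul a b)
  then have "\<bar>aval s a\<bar> * \<bar>aval s b\<bar> \<le> N ^ adeg a * N ^ adeg b"
    using N by (intro mult_mono) auto
  then show ?case by (simp add: abs_mult power_add)
qed (use b in \<open>auto simp: bounded_state_def\<close>)

lemma afits_bounded: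
  assumes b: "bounded_state N s" and N: "16 \<le> N" and K: "K < 100"
  shows "adeg e \<le> K \<Longrightarrow> addresses_ok s e \<Longrightarrow> afits (N ^ K) s e"
proof (induction e)
  have le: "\<bar>aval s e\<bar> \<le> N ^ K" if "adeg e \<le> K" for e
  proof -
    have "\<bar>aval s e\<bar> \<le> N ^ adeg e" using aval_bounded[OF b N] that K by simp
    also have "\<dots> \<le> N ^ K" using that N by (intro power_increasing) auto
    finally show ?thesis .
  qed
  {
    case (Num n)
    then show ?case using le[OF Num(1)] by simp
  next
    case (Reg r)
    then show ?case using le[OF Reg(1)] by simp
  next
    case (Mem e)
    then show ?case using le[OF Mem.prems(1)] by simp
  next
    case (Add a b)
    then show ?case using le[OF Add.prems(1)] by simp
  next
    case (Sub a b)
    then show ?case using le[OF Sub.prems(1)] by simp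
  next
    case (Mul a b)
    \<comment> \<open>Degrees are positive, so each factor stays within \<open>K\<close> along with
      their sum.\<close>
    have "adeg a \<ge> 1" "adeg b \<ge> 1" by (induction a; simp) (induction b; simp)
    then show ?case using Mul le[OF Mul.prems(1)] by simp
  }
qed

lemma bfits_bounded:
  assumes "bounded_state N s" "16 \<le> N" "K < 100"
  shows "bdeg e \<le> K \<Longrightarrow> baddresses_ok s e \<Longrightarrow> bfits (N ^ K) s e"
  by (induction e) (use afits_bounded[OF assms] in auto)

text \<open>An upper bound only, since a conditional is charged for its longer branch. The value at
  \<open>While\<close> is a dummy: \<open>wp\<close> is false there.\<close>

primrec ctime :: "com \<Rightarrow> nat" where
  "ctime Skip = 1"
| "ctime (Assign r a) = acost a + 1"
| "ctime (Store a b) = acost a + acost b + 1"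
| "ctime (Seq c d) = ctime c + ctime d"
| "ctime (Cond b c d) = bcost b + 1 + max (ctime c) (ctime d)"
| "ctime (While b c) = 0"

text \<open>Only for loop-free programs. The bounds on stored values maintain \<^const>\<open>bounded_state\<close>, which
  replaces the overflow conditions of \<^const>\<open>exec\<close>.\<close>

primrec wp :: "int \<Rightarrow> com \<Rightarrow> (state \<Rightarrow> bool) \<Rightarrow> state \<Rightarrow> bool" where
  "wp N Skip Q s = Q s"
| "wp N (Assign r a) Q s = (addresses_ok s a \<and> \<bar>aval s a\<bar> \<le> N \<and> Q (s\<lparr>regs := (regs s)(r := aval s a)\<rparr>))"
| "wp N (Store a b) Q s = (addresses_ok s a \<and> addresses_ok s b \<and> 0 \<le> aval s a \<and> \<bar>aval s b\<bar> \<le> N \<and>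
     Q (s\<lparr>mem := (mem s)(aval s a := aval s b)\<rparr>))"
| "wp N (Seq c d) Q s = wp N c (wp N d Q) s"
| "wp N (Cond b c d) Q s = (baddresses_ok s b \<and> (if bval s b then wp N c Q s else wp N d Q s))"
| "wp N (While b c) Q s = False"

lemma wp_mono: "wp N c Q s \<Longrightarrow> (\<And>s. Q s \<Longrightarrow> Q' s) \<Longrightarrow> wp N c Q' s"
proof (induction c arbitrary: Q Q' s)
  case (Seq c d)
  show ?case using Seq.prems(1) unfolding wp.simps
    by (rule Seq.IH(1)) (rule Seq.IH(2)[OF _ Seq.prems(2)])
next
  case (Cond b c d)
  show ?case using Cond.prems(1) unfolding wp.simps
    by (auto split: if_splits intro: Cond.IH(1)[OF _ Cond.prems(2)] Cond.IH(2)[OF _ Cond.prems(2)])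
qed auto

definition runs :: "int \<Rightarrow> nat \<Rightarrow> com \<Rightarrow> state \<Rightarrow> nat \<Rightarrow> (state \<Rightarrow> bool) \<Rightarrow> bool" where
  "runs N K c s T Q \<longleftrightarrow> (\<exists>t s'. exec (N ^ K) c s t s' \<and> t \<le> T \<and> bounded_state N s' \<and> Q s')"

lemma wp_runs:
  assumes N: "16 \<le> N" "K < 100"
  shows "wp N c Q s \<Longrightarrow> bounded_state N s \<Longrightarrow> cdeg c \<le> K \<Longrightarrow> runs N K c s (ctime c) Q"
proof (induction c arbitrary: s Q)
  case Skip
  then show ?case unfolding runs_def using exec.Skip by fastforce
next
  case (Assign r a)
  then have "exec (N ^ K) (Assign r a) s (acost a + 1) (s\<lparr>regs := (regs s)(r := aval s a)\<rparr>)"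
    using N by (intro exec.Assign afits_bounded) auto
  then show ?case using Assign unfolding runs_def
    by (intro exI[of _ "acost a + 1"] exI[of _ "s\<lparr>regs := (regs s)(r := aval s a)\<rparr>"])
      (auto simp: bounded_state_def)
next
  case (Store a b)
  then have "exec (N ^ K) (Store a b) s (acost a + acost b + 1) (s\<lparr>mem := (mem s)(aval s a := aval s b)\<rparr>)"
    using N by (intro exec.Store afits_bounded) auto
  then show ?case using Store unfolding runs_def
    by (intro exI[of _ "acost a + acost b + 1"] exI[of _ "s\<lparr>mem := (mem s)(aval s a := aval s b)\<rparr>"])
      (auto simp: bounded_state_def)
next
  case (Seq c d)
  then have "runs N K c s (ctime c) (wp N d Q)" by auto
  then obtain t s' where 1: "exec (N ^ K) c s t s'" "t \<le> ctime c" "bounded_state N s'" "wp N d Q s'"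
    by (auto simp: runs_def)
  then have "runs N K d s' (ctime d) Q" using Seq by auto
  then obtain t' s'' where 2: "exec (N ^ K) d s' t' s''" "t' \<le> ctime d" "bounded_state N s''" "Q s''"
    by (auto simp: runs_def)
  show ?case unfolding runs_def
    using exec.Seq[OF 1(1) 2(1)] 1 2 by (intro exI[of _ "t + t'"] exI[of _ s'']) auto
next
  case (Cond b c d)
  have f: "bfits (N ^ K) s b" using Cond.prems by (intro bfits_bounded[OF _ N]) auto
  show ?case
  proof (cases "bval s b")
    case True
    then obtain t s' where 1: "exec (N ^ K) c s t s'" "t \<le> ctime c" "bounded_state N s'" "Q s'"
      using Cond.IH(1)[of Q s] Cond.prems by (auto simp: runs_def)
    show ?thesis unfolding runs_def
      using exec.CondTrue[OF f True 1(1)] 1 by (intro exI exI[of _ s'] conjI) auto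
  next
    case False
    then obtain t s' where 1: "exec (N ^ K) d s t s'" "t \<le> ctime d" "bounded_state N s'" "Q s'"
      using Cond.IH(2)[of Q s] Cond.prems by (auto simp: runs_def)
    show ?thesis unfolding runs_def
      using exec.CondFalse[OF f False 1(1)] 1 by (intro exI exI[of _ s'] conjI) auto
  qed
qed auto

lemma runs_Seq:
  assumes "runs N K c s T Q" "\<And>s'. bounded_state N s' \<Longrightarrow> Q s' \<Longrightarrow> runs N K d s' T' Q'"
  shows "runs N K (Seq c d) s (T + T') Q'"
proof -
  obtain t s' where 1: "exec (N ^ K) c s t s'" "t \<le> T" "bounded_state N s'" "Q s'"
    using assms by (auto simp: runs_def)
  then obtain t' s'' where 2: "exec (N ^ K) d s' t' s''" "t' \<le> T'" "bounded_state N s''" "Q' s''"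
    using assms(2)[of s'] by (auto simp: runs_def)
  show ?thesis unfolding runs_def
    using exec.Seq[OF 1(1) 2(1)] 1 2 by (intro exI[of _ "t + t'"] exI[of _ s'']) auto
qed

lemma runs_mono: "runs N K c s T Q \<Longrightarrow> T \<le> T' \<Longrightarrow> (\<And>s'. bounded_state N s' \<Longrightarrow> Q s' \<Longrightarrow> Q' s') \<Longrightarrow> runs N K c s T' Q'"
  unfolding runs_def by (meson order_trans)

text \<open>Each iteration lowers \<open>\<mu>\<close>, so there are at most \<open>\<mu> s\<close>
  of them; the last summand of the cost is the failing test.\<close>

lemma runs_While:
  assumes N: "16 \<le> N" "K < 100" and deg: "cdeg (While b c) \<le> K"
    and addr: "\<And>s. I s \<Longrightarrow> baddresses_ok s b"
    and body: "\<And>s. bounded_state N s \<Longrightarrow> I s \<Longrightarrow> bval s b \<Longrightarrow> wp N c (\<lambda>s'. I s' \<and> \<mu> s' < (\<mu> s :: nat)) s"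
  shows "bounded_state N s \<Longrightarrow> I s \<Longrightarrow>
    runs N K (While b c) s (\<mu> s * (bcost b + 1 + ctime c) + bcost b + 1) (\<lambda>s'. I s' \<and> \<not> bval s' b)"
proof (induction "\<mu> s" arbitrary: s rule: less_induct)
  case less
  have f: "bfits (N ^ K) s b" using less.prems addr deg by (intro bfits_bounded[OF _ N]) auto
  show ?case
  proof (cases "bval s b")
    case False
    then show ?thesis using exec.WhileFalse[OF f False] less.prems unfolding runs_def by fastforce
  next
    case True
    have "runs N K c s (ctime c) (\<lambda>s'. I s' \<and> \<mu> s' < \<mu> s)"
      using body less.prems True deg by (intro wp_runs[OF N]) auto
    then obtain t s' where 1: "exec (N ^ K) c s t s'" "t \<le> ctime c" "bounded_state N s'" "I s'" "\<mu> s' < \<mu> s"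
      by (auto simp: runs_def)
    obtain t' s'' where 2: "exec (N ^ K) (While b c) s' t' s''"
        "t' \<le> \<mu> s' * (bcost b + 1 + ctime c) + bcost b + 1" "bounded_state N s''" "I s''" "\<not> bval s'' b"
      using less.hyps[OF 1(5) 1(3,4)] by (auto simp: runs_def)
    have "Suc (\<mu> s') * (bcost b + 1 + ctime c) \<le> \<mu> s * (bcost b + 1 + ctime c)"
      using 1(5) by (intro mult_right_mono) auto
    then have "bcost b + 1 + t + t' \<le> \<mu> s * (bcost b + 1 + ctime c) + bcost b + 1"
      using 1(2) 2(2) by simp
    then show ?thesis unfolding runs_def
      using exec.WhileTrue[OF f True 1(1) 2(1)] 2 by (intro exI exI[of _ s''] conjI) auto
  qed
qed

section \<open>Instances as graphs\<close>

primrec dnum :: "dir \<Rightarrow> int" where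
  "dnum North = 0" | "dnum East = 1" | "dnum South = 2" | "dnum West = 3"

definition dir_of :: "int \<Rightarrow> dir" where
  "dir_of k = (if k = 0 then North else if k = 1 then East else if k = 2 then South else West)"

primrec dx :: "dir \<Rightarrow> int" where
  "dx North = 0" | "dx East = 1" | "dx South = 0" | "dx West = -1"

primrec dy :: "dir \<Rightarrow> int" where
  "dy North = 1" | "dy East = 0" | "dy South = -1" | "dy West = 0"

lemma shift_eq: "shift d (x, y) = (x + dx d, y + dy d)"
  by (cases d) auto

lemma dnum_range: "0 \<le> dnum d" "dnum d < 4" "dnum d \<in> {0..<4}"
  by (cases d; simp)+

lemma dnum_inj [simp]: "dnum d = dnum e \<longleftrightarrow> d = e"
  by (cases d; cases e; simp)

lemma dir_of_dnum [simp]: "dir_of (dnum d) = d"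
  by (cases d) (auto simp: dir_of_def)

lemma dnum_dir_of [simp]: "k \<in> {0..<4} \<Longrightarrow> dnum (dir_of k) = k"
  by (auto simp: dir_of_def)

section \<open>Decoding of the input list\<close>

lemma nth_concat_uniform:
  assumes "\<And>x. x \<in> set xs \<Longrightarrow> length (f x) = k" "i < length xs" "j < k"
  shows "concat (map f xs) ! (k * i + j) = f (xs ! i) ! j"
  using assms
proof (induction xs arbitrary: i)
  case (Cons x xs)
  show ?case
  proof (cases i)
    case 0
    then show ?thesis using Cons.prems by (simp add: nth_append)
  next
    case (Suc i')
    have "k * i + j = length (f x) + (k * i' + j)" using Suc Cons.prems by simp
    then have "concat (map f (x # xs)) ! (k * i + j) = concat (map f xs) ! (k * i' + j)"
      by (simp only: list.map concat.simps nth_append_length_plus)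
    then show ?thesis using Cons.IH[of i'] Cons.prems Suc by simp
  qed
qed simp

lemma length_concat_uniform:
  "(\<And>x. x \<in> set xs \<Longrightarrow> length (f x) = k) \<Longrightarrow> length (concat (map f xs)) = k * length xs"
  by (induction xs) auto

lemma length_tile_code [simp]: "length (tile_code t) = 8"
  by (simp add: tile_code_def)

lemma tile_code_nth:
  "tile_code t ! nat (2 * dnum d) = int (label (t d))"
  "tile_code t ! nat (2 * dnum d + 1) = int (strength (t d))"
  by (cases d; simp add: tile_code_def)+

text \<open>Injectivity lets a path of images be lifted edge by edge: the preimage of the source of
  an edge must be the point reached so far.\<close>

lemma rtrancl_map_prod_inj:
  assumes inj: "inj_on f X" and R: "R \<subseteq> X \<times> X" and xy: "x \<in> X" "y \<in> X"
  shows "(f x, f y) \<in> (map_prod f f ` R)\<^sup>* \<longleftrightarrow> (x, y) \<in> R\<^sup>*"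
proof
  have "\<forall>x y. x \<in> X \<longrightarrow> a = f x \<longrightarrow> (\<exists>y\<in>X. b = f y \<and> (x, y) \<in> R\<^sup>*)"
    if "(a, b) \<in> (map_prod f f ` R)\<^sup>*" for a b
    using that
  proof (induction rule: rtrancl_induct)
    case (step b c)
    then obtain u v where uv: "(u, v) \<in> R" "b = f u" "c = f v" by auto
    show ?case
    proof (intro allI impI)
      fix x assume "x \<in> X" "a = f x"
      then obtain y where "y \<in> X" "b = f y" "(x, y) \<in> R\<^sup>*" using step by blast
      moreover have "y = u" using uv R calculation inj by (auto dest: inj_onD)
      ultimately show "\<exists>y\<in>X. c = f y \<and> (x, y) \<in> R\<^sup>*"
        using uv R by (intro bexI[of _ v]) (auto intro: rtrancl_into_rtrancl)
    qed
  qed auto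
  moreover assume "(f x, f y) \<in> (map_prod f f ` R)\<^sup>*"
  ultimately show "(x, y) \<in> R\<^sup>*" using xy inj by (metis inj_onD)
next
  assume "(x, y) \<in> R\<^sup>*"
  then show "(f x, f y) \<in> (map_prod f f ` R)\<^sup>*"
  proof (induction rule: rtrancl_induct)
    case (step y z)
    then have "(f y, f z) \<in> map_prod f f ` R" by force
    with step show ?case by (meson rtrancl.rtrancl_into_rtrancl)
  qed simp
qed

locale tas_instance =
  fixes T :: "tile set" and s :: tile and \<alpha> :: assembly and ts :: "tile list" and ps :: "pos list"
  assumes tas: "is_tas \<lparr>tiles = T, seed = s, temperature = 1\<rparr>" and asm: "is_assembly T \<alpha>"
    and ts: "distinct ts" "set ts = T" and ps: "distinct ps" "set ps = dom \<alpha>"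
begin

definition S :: tas where "S = \<lparr>tiles = T, seed = s, temperature = 1\<rparr>"

lemma S_simps [simp]: "tiles S = T" "seed S = s" "temperature S = 1"
  by (simp_all add: S_def)

lemma tas_S: "is_tas S"
  using tas by (simp add: S_def)

definition m :: int where "m = int (length ts)"
definition n :: int where "n = int (length ps)"
definition L :: int where "L = 3 + 8 * m + 3 * n"

definition inp :: "int list" where "inp = instance_code S \<alpha> ts ps"

text \<open>The base of the power in \<open>word_bound\<close>. Registers and memory cells are kept
  at most \<open>N\<close> in absolute value.\<close>

definition N :: int where "N = 2 + int (length inp) + Max (insert 0 (abs ` set inp))"

definition im :: "int \<Rightarrow> int" where "im a = mem (initial_state inp) a"

definition tl_at :: "int \<Rightarrow> tile" where "tl_at j = ts ! nat j"

definition vpos :: "int \<Rightarrow> pos" where "vpos v = ps ! nat (v - 1)"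

definition vtx :: "pos \<Rightarrow> int" where
  "vtx p = (if p \<in> dom \<alpha> then (THE v. v \<in> {1..n} \<and> vpos v = p) else 0)"

definition vtile :: "int \<Rightarrow> tile" where "vtile v = the (\<alpha> (vpos v))"

definition tidx :: "int \<Rightarrow> int" where "tidx v = int (index_in ts (vtile v))"

lemma fin: "finite (dom \<alpha>)" and ran: "ran \<alpha> \<subseteq> T" and ne: "dom \<alpha> \<noteq> {}"
  using asm by (auto simp: is_assembly_def)

lemma n_ge: "n \<ge> 1" and m_ge: "m \<ge> 1"
proof -
  have "ps \<noteq> []" using ps(2) ne by (metis list.set(1))
  then show "n \<ge> 1" unfolding n_def using length_greater_0_conv[of ps] by linarith
  have "ts \<noteq> []" using ts tas by (auto simp: is_tas_def)
  then show "m \<ge> 1" unfolding m_def using length_greater_0_conv[of ts] by linarith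
qed

lemma vpos_inj: "v \<in> {1..n} \<Longrightarrow> w \<in> {1..n} \<Longrightarrow> vpos v = vpos w \<longleftrightarrow> v = w"
  using ps(1) by (auto simp: vpos_def n_def nth_eq_iff_index_eq)

lemma vpos_dom: "v \<in> {1..n} \<Longrightarrow> vpos v \<in> dom \<alpha>"
proof -
  assume "v \<in> {1..n}"
  then have "vpos v \<in> set ps" by (auto simp: vpos_def n_def intro!: nth_mem)
  then show ?thesis using ps by simp
qed

lemma vpos_surj: "p \<in> dom \<alpha> \<Longrightarrow> \<exists>v\<in>{1..n}. vpos v = p"
proof -
  assume "p \<in> dom \<alpha>"
  then have "p \<in> set ps" using ps by simp
  then obtain i where "i < length ps" "ps ! i = p" by (auto simp: in_set_conv_nth)
  then show ?thesis by (intro bexI[of _ "int i + 1"]) (auto simp: vpos_def n_def)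
qed

lemma vtx_vpos [simp]: "v \<in> {1..n} \<Longrightarrow> vtx (vpos v) = v"
  using vpos_dom[of v] vpos_inj unfolding vtx_def by auto

lemma vpos_vtx: "p \<in> dom \<alpha> \<Longrightarrow> vpos (vtx p) = p"
  using vpos_surj vtx_vpos by metis

lemma vtx_range: "p \<in> dom \<alpha> \<Longrightarrow> vtx p \<in> {1..n}"
  using vpos_surj vtx_vpos by metis

lemma vtx_eq_0: "vtx p = 0 \<longleftrightarrow> p \<notin> dom \<alpha>"
proof (cases "p \<in> dom \<alpha>")
  case True
  then show ?thesis using vtx_range[OF True] by auto
qed (simp add: vtx_def)

lemma vtx_eq_iff: "w \<in> {1..n} \<Longrightarrow> vtx p = w \<longleftrightarrow> p = vpos w"
  using vtx_vpos[of w] vpos_vtx[of p] vtx_eq_0[of p] by (cases "p \<in> dom \<alpha>") auto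

lemma vtx_le: "0 \<le> vtx p" "vtx p \<le> n"
  using vtx_range[of p] n_ge by (cases "p \<in> dom \<alpha>"; auto simp: vtx_def)+

lemma inj_vtx: "inj_on vtx (dom \<alpha>)"
  by (rule inj_onI) (metis vpos_vtx)

lemma index_in: "t \<in> T \<Longrightarrow> index_in ts t < length ts \<and> ts ! index_in ts t = t"
  unfolding index_in_def by (rule LeastI_ex) (use ts in \<open>auto simp: in_set_conv_nth\<close>)

lemma vtile: "v \<in> {1..n} \<Longrightarrow> \<alpha> (vpos v) = Some (vtile v)" "v \<in> {1..n} \<Longrightarrow> vtile v \<in> T"
proof -
  assume "v \<in> {1..n}"
  then obtain t where "\<alpha> (vpos v) = Some t" using vpos_dom by auto
  then show "\<alpha> (vpos v) = Some (vtile v)" by (simp add: vtile_def)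
  then show "vtile v \<in> T" using ran by (auto intro: ranI)
qed

lemma vtile_vtx: "\<alpha> p = Some t \<Longrightarrow> vtile (vtx p) = t"
  using vpos_vtx[of p] domI[of \<alpha> p t] by (simp add: vtile_def)

lemma tidx: "v \<in> {1..n} \<Longrightarrow> 0 \<le> tidx v \<and> tidx v < m \<and> tl_at (tidx v) = vtile v"
  using index_in[OF vtile(2)] by (auto simp: tidx_def m_def tl_at_def)

lemma length_inp: "int (length inp) = L"
proof -
  have "length (concat (map tile_code ts)) = 8 * length ts"
    by (rule length_concat_uniform) simp
  moreover have "length (concat (map (\<lambda>p. [fst p, snd p, int (index_in ts (the (\<alpha> p)))]) ps)) = 3 * length ps"
    by (rule length_concat_uniform) simp
  ultimately show ?thesis
    by (simp only: inp_def instance_code_def L_def m_def n_def length_append) simp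
qed

lemma L_ge: "L \<ge> 14" using n_ge m_ge by (simp add: L_def)

lemma im_nth: "0 \<le> a \<Longrightarrow> a < L \<Longrightarrow> im a = inp ! nat a"
  by (simp add: im_def initial_state_def length_inp)

lemma im_beyond: "L \<le> a \<Longrightarrow> im a = 0"
  by (simp add: im_def initial_state_def length_inp)

lemma L_le_N: "L + 2 \<le> N" "N \<ge> 16"
proof -
  have "0 \<le> Max (insert 0 (abs ` set inp))" by simp
  then show "L + 2 \<le> N" by (simp add: N_def length_inp)
  then show "N \<ge> 16" using L_ge by simp
qed

lemma im_bounded: "\<bar>im a\<bar> \<le> N"
proof (cases "0 \<le> a \<and> a < L")
  case True
  then have "im a \<in> set inp" using length_inp by (auto simp: im_nth intro!: nth_mem)
  then have "\<bar>im a\<bar> \<le> Max (insert 0 (abs ` set inp))" by (intro Max_ge) auto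
  then show ?thesis by (simp add: N_def)
next
  case False
  then show ?thesis using L_le_N by (auto simp: im_def initial_state_def length_inp)
qed

lemma inp_parts: "inp = [m, n, int (index_in ts s)] @ concat (map tile_code ts) @
     concat (map (\<lambda>p. [fst p, snd p, int (index_in ts (the (\<alpha> p)))]) ps)"
  by (simp add: inp_def instance_code_def m_def n_def)

lemma im_head: "im 0 = m" "im 1 = n" "im 2 = int (index_in ts s)"
  using L_ge im_nth[of 0] im_nth[of 1] im_nth[of 2] by (simp_all add: inp_parts)

lemma im_tile:
  assumes "0 \<le> j" "j < m"
  shows "im (3 + 8 * j + 2 * dnum d) = int (label (tl_at j d))"
    and "im (3 + 8 * j + 2 * dnum d + 1) = int (strength (tl_at j d))"
proof -
  have *: "im (3 + 8 * j + a) = tile_code (ts ! nat j) ! nat a" if a: "0 \<le> a" "a < 8" for a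
  proof -
    let ?i = "8 * nat j + nat a"
    have j: "nat j < length ts" using assms by (auto simp: m_def)
    have i: "nat (3 + 8 * j + a) = 3 + ?i" using assms a by (simp add: nat_add_distrib nat_mult_distrib)
    have len: "length (concat (map tile_code ts)) = 8 * length ts"
      by (rule length_concat_uniform) simp
    have lt: "?i < 8 * length ts" using j a by linarith
    have "im (3 + 8 * j + a) = inp ! (3 + ?i)"
      using im_nth[of "3 + 8 * j + a"] assms a n_ge i by (simp add: L_def)
    also have "\<dots> = concat (map tile_code ts) ! ?i"
      using lt len by (simp add: inp_parts nth_append)
    also have "\<dots> = tile_code (ts ! nat j) ! nat a"
      by (rule nth_concat_uniform) (use j a in auto)
    finally show ?thesis .
  qed
  show "im (3 + 8 * j + 2 * dnum d) = int (label (tl_at j d))"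
    using *[of "2 * dnum d"] dnum_range[of d] by (simp add: tile_code_nth tl_at_def)
  show "im (3 + 8 * j + 2 * dnum d + 1) = int (strength (tl_at j d))"
    using *[of "2 * dnum d + 1"] dnum_range[of d] by (simp add: tile_code_nth tl_at_def add.assoc)
qed

lemma im_pos:
  assumes "0 \<le> i" "i < n"
  shows "im (3 + 8 * m + 3 * i) = fst (vpos (i + 1))"
    and "im (3 + 8 * m + 3 * i + 1) = snd (vpos (i + 1))"
    and "im (3 + 8 * m + 3 * i + 2) = tidx (i + 1)"
proof -
  let ?f = "\<lambda>p. [fst p, snd p, int (index_in ts (the (\<alpha> p)))]"
  have *: "im (3 + 8 * m + 3 * i + int a) = ?f (ps ! nat i) ! a" if a: "a < 3" for a
  proof -
    let ?i = "3 * nat i + a"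
    have i': "nat i < length ps" using assms by (auto simp: n_def)
    have i: "nat (3 + 8 * m + 3 * i + int a) = 3 + (8 * length ts + ?i)"
      using assms a by (simp add: nat_add_distrib nat_mult_distrib m_def)
    have len: "length (concat (map tile_code ts)) = 8 * length ts"
      by (rule length_concat_uniform) simp
    have "im (3 + 8 * m + 3 * i + int a) = inp ! (3 + (8 * length ts + ?i))"
      using im_nth[of "3 + 8 * m + 3 * i + int a"] assms a m_ge i by (simp add: L_def)
    also have "\<dots> = concat (map ?f ps) ! ?i"
      using len by (simp add: inp_parts nth_append)
    also have "\<dots> = ?f (ps ! nat i) ! a"
      by (rule nth_concat_uniform) (use i' a in auto)
    finally show ?thesis .
  qed
  show "im (3 + 8 * m + 3 * i) = fst (vpos (i + 1))" using *[of 0] by (simp add: vpos_def)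
  show "im (3 + 8 * m + 3 * i + 1) = snd (vpos (i + 1))" using *[of 1] by (simp add: vpos_def)
  show "im (3 + 8 * m + 3 * i + 2) = tidx (i + 1)" using *[of 2] by (simp add: vpos_def tidx_def vtile_def)
qed

text \<open>\<open>badv v k\<close> is the neighbour which has to dominate \<open>v\<close>, and \<open>0\<close> if there is no such requirement.\<close>

definition adjv :: "int \<Rightarrow> int \<Rightarrow> int" where
  "adjv v k = (let d = dir_of k; q = shift d (vpos v) in
     if q \<in> dom \<alpha> \<and> interacts d (vtile v) (the (\<alpha> q)) then vtx q else 0)"

definition badv :: "int \<Rightarrow> int \<Rightarrow> int" where
  "badv v k = (let d = dir_of k; q = shift d (vpos v) in
     if q \<in> dom \<alpha> \<and> strength (vtile v d) > 0 \<and> \<not> forced S d (vtile v) (the (\<alpha> q)) then vtx q else 0)"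

definition viol :: "int \<Rightarrow> int \<Rightarrow> bool" where
  "viol v k \<longleftrightarrow> strength (vtile v (dir_of k)) > 0 \<and> shift (dir_of k) (vpos v) \<notin> dom \<alpha>"

lemma adjv_eq:
  assumes "v \<in> {1..n}" "w \<in> {1..n}"
  shows "adjv v k = w \<longleftrightarrow> vpos w = shift (dir_of k) (vpos v) \<and> interacts (dir_of k) (vtile v) (vtile w)"
    (is "_ \<longleftrightarrow> ?rhs")
proof -
  have "w \<noteq> 0" using assms by auto
  then have "adjv v k = w \<longleftrightarrow> vpos w = shift (dir_of k) (vpos v) \<and> adjv v k \<noteq> 0"
    using vtx_eq_iff[OF assms(2), of "shift (dir_of k) (vpos v)"] vtx_vpos[OF assms(2)]
    by (auto simp: adjv_def Let_def)
  also have "\<dots> \<longleftrightarrow> ?rhs"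
    using vpos_dom[OF assms(2)] vtx_vpos[OF assms(2)] vtile(1)[OF assms(2)] \<open>w \<noteq> 0\<close>
    unfolding adjv_def Let_def by auto
  finally show ?thesis .
qed

lemma badv_eq:
  assumes "v \<in> {1..n}" "w \<in> {1..n}"
  shows "badv v k = w \<longleftrightarrow> vpos w = shift (dir_of k) (vpos v) \<and> strength (vtile v (dir_of k)) > 0 \<and>
    \<not> forced S (dir_of k) (vtile v) (vtile w)" (is "_ \<longleftrightarrow> ?rhs")
proof -
  have "w \<noteq> 0" using assms by auto
  then have "badv v k = w \<longleftrightarrow> vpos w = shift (dir_of k) (vpos v) \<and> badv v k \<noteq> 0"
    using vtx_eq_iff[OF assms(2), of "shift (dir_of k) (vpos v)"] vtx_vpos[OF assms(2)]
    by (auto simp: badv_def Let_def)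
  also have "\<dots> \<longleftrightarrow> ?rhs"
    using vpos_dom[OF assms(2)] vtx_vpos[OF assms(2)] vtile(1)[OF assms(2)] \<open>w \<noteq> 0\<close>
    unfolding badv_def Let_def by auto
  finally show ?thesis .
qed

lemma adjv_range: "0 \<le> adjv v k" "adjv v k \<le> n" and badv_range: "0 \<le> badv v k" "badv v k \<le> n"
  using vtx_le n_ge by (auto simp: adjv_def badv_def Let_def)

end

text \<open>The search graph has a root only when the origin is occupied. An instance without the
  seed there is rejected before the search, so the program is treated in \<open>tas_instance\<close>
  and this locale is entered once the test has succeeded.\<close>

locale seeded_instance = tas_instance +
  assumes seed: "\<alpha> (0, 0) = Some s"
begin

definition root :: int where "root = vtx (0, 0)"

lemma root: "root \<in> {1..n}" "vpos root = (0, 0)"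
  unfolding root_def using vtx_range[of "(0, 0)"] vpos_vtx[of "(0, 0)"] seed by blast+

sublocale bad_graph n adjv badv root
proof
  show "1 \<le> root" "root \<le> n" using root by auto
  fix v k :: int assume v: "v \<in> {1..n}" and k: "k \<in> {0..<4}"
  show "adjv v k \<in> {0..n}" "badv v k \<in> {0..n}" using adjv_range badv_range by auto
  show "\<exists>k'\<in>{0..<4}. adjv (adjv v k) k' = v" if "adjv v k \<noteq> 0"
  proof -
    let ?w = "adjv v k"
    have w: "?w \<in> {1..n}" using adjv_range[of v k] that by auto
    then have "vpos ?w = shift (dir_of k) (vpos v)" "interacts (dir_of k) (vtile v) (vtile ?w)"
      using adjv_eq[OF v w] by auto
    then have "adjv ?w (dnum (opp (dir_of k))) = v"
      using adjv_eq[OF w v] interacts_sym by auto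
    then show ?thesis using dnum_range by blast
  qed
  show "badv v k \<noteq> v" using badv_eq[OF v v] shift_neq by metis
qed

lemma E_eq: "E = map_prod vtx vtx ` bonds \<alpha>"
proof (intro equalityI subrelI)
  fix v w assume "(v, w) \<in> E"
  then obtain k where k: "v \<in> {1..n}" "w \<in> {1..n}" "adjv v k = w" by (rule E_E)
  then have "vpos w = shift (dir_of k) (vpos v)" "interacts (dir_of k) (vtile v) (vtile w)"
    using adjv_eq by blast+
  then have "(vpos v, vpos w) \<in> bonds \<alpha>" using bondsI[of \<alpha> "vpos v" _ "dir_of k"] vtile k by metis
  then show "(v, w) \<in> map_prod vtx vtx ` bonds \<alpha>"
    using k by (intro image_eqI[of _ _ "(vpos v, vpos w)"]) auto
next
  fix v w assume "(v, w) \<in> map_prod vtx vtx ` bonds \<alpha>"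
  then obtain p q where pq: "(p, q) \<in> bonds \<alpha>" "v = vtx p" "w = vtx q" by auto
  then obtain d t u where *: "q = shift d p" "\<alpha> p = Some t" "\<alpha> q = Some u" "interacts d t u"
    by (auto elim: bondsE)
  have vw: "v \<in> {1..n}" "w \<in> {1..n}" unfolding pq using vtx_range * by blast+
  have "adjv v (dnum d) = w"
    using adjv_eq[OF vw] pq * vpos_vtx vtile_vtx by (metis dir_of_dnum domI)
  then show "(v, w) \<in> E" using E_I[of v "dnum d"] vw dnum_range by auto
qed

lemma Restr_E_eq: "p \<in> dom \<alpha> \<Longrightarrow> Restr E (- {vtx p}) = map_prod vtx vtx ` Restr (bonds \<alpha>) (- {p})"
  unfolding E_eq using bonds_dom by (force dest: inj_onD[OF inj_vtx])

lemma bonds_subset: "bonds \<alpha> \<subseteq> dom \<alpha> \<times> dom \<alpha>"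
  using bonds_dom by (intro subrelI) blast

lemma origin: "(0, 0) \<in> dom \<alpha>"
  using seed by blast

lemma reach_iff: "q \<in> dom \<alpha> \<Longrightarrow> (root, vtx q) \<in> E\<^sup>* \<longleftrightarrow> ((0, 0), q) \<in> (bonds \<alpha>)\<^sup>*"
  unfolding E_eq root_def by (rule rtrancl_map_prod_inj[OF inj_vtx bonds_subset origin])

lemma dominates_iff:
  assumes "p \<in> dom \<alpha>" "q \<in> dom \<alpha>"
  shows "dominates (vtx p) (vtx q) \<longleftrightarrow> ((0, 0), q) \<notin> (Restr (bonds \<alpha>) (- {p}))\<^sup>*"
proof -
  have "Restr (bonds \<alpha>) (- {p}) \<subseteq> dom \<alpha> \<times> dom \<alpha>" using bonds_subset by blast
  from rtrancl_map_prod_inj[OF inj_vtx this origin assms(2)] show ?thesis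
    unfolding dominates_def Restr_E_eq[OF assms(1)] by (simp add: root_def)
qed

lemma uniquely_produces_iff_graph:
  "uniquely_produces S \<alpha> \<longleftrightarrow> (\<forall>v\<in>{1..n}. \<forall>k\<in>{0..<4}. \<not> viol v k) \<and>
     {1..n} \<subseteq> E\<^sup>* `` {root} \<and> all_dominated" (is "_ \<longleftrightarrow> ?v \<and> ?c \<and> _")
proof -
  have trm: "(\<forall>q t d. \<alpha> q = Some t \<and> strength (t d) > 0 \<longrightarrow> shift d q \<in> dom \<alpha>) \<longleftrightarrow> ?v" (is "?t \<longleftrightarrow> _")
  proof
    assume ?t
    then show ?v using vtile unfolding viol_def by blast
  next
    assume v: ?v
    show ?t
    proof (intro allI impI, elim conjE)
      fix q t d assume "\<alpha> q = Some t" "strength (t d) > 0"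
      moreover have "\<not> viol (vtx q) (dnum d)" using v vtx_range dnum_range calculation by blast
      ultimately show "shift d q \<in> dom \<alpha>"
        unfolding viol_def using vtile_vtx[of q t] vpos_vtx[of q] by (metis dir_of_dnum domI)
    qed
  qed
  have conn: "dom \<alpha> \<subseteq> (bonds \<alpha>)\<^sup>* `` {(0, 0)} \<longleftrightarrow> ?c"
  proof
    assume c: "dom \<alpha> \<subseteq> (bonds \<alpha>)\<^sup>* `` {(0, 0)}"
    show ?c
    proof
      fix v assume v: "v \<in> {1..n}"
      then have "(root, vtx (vpos v)) \<in> E\<^sup>*" using c vpos_dom[OF v] reach_iff by blast
      then show "v \<in> E\<^sup>* `` {root}" using v by simp
    qed
  next
    assume c: ?c
    show "dom \<alpha> \<subseteq> (bonds \<alpha>)\<^sup>* `` {(0, 0)}"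
      using c vtx_range reach_iff by blast
  qed
  \<comment> \<open>\<open>all_dominated\<close> speaks of the vertices reached from the root; under
    \<open>?c\<close> these are all of them.\<close>
  have "(\<forall>q t d u. \<alpha> q = Some t \<and> \<alpha> (shift d q) = Some u \<and> strength (t d) > 0 \<and> \<not> forced S d t u \<longrightarrow>
      ((0, 0), q) \<notin> (Restr (bonds \<alpha>) (- {shift d q}))\<^sup>*) \<longleftrightarrow> all_dominated" (is "?b \<longleftrightarrow> _") if c: ?c
  proof
    assume b: ?b
    show all_dominated
      unfolding all_dominated_def
    proof (intro allI impI, elim conjE)
      fix q k assume q: "(root, q) \<in> E\<^sup>*" "k \<in> {0..<4}" "badv q k \<noteq> 0"
      let ?w = "badv q k"
      have qV: "q \<in> {1..n}" using q(1)
        by (induction rule: rtrancl_induct) (use root in \<open>auto elim: E_E\<close>)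
      have wV: "?w \<in> {1..n}" using badv_range[of q k] q(3) by auto
      have w: "vpos ?w = shift (dir_of k) (vpos q)" "strength (vtile q (dir_of k)) > 0"
        "\<not> forced S (dir_of k) (vtile q) (vtile ?w)"
        using badv_eq[OF qV wV, of k] by blast+
      have "((0, 0), vpos q) \<notin> (Restr (bonds \<alpha>) (- {vpos ?w}))\<^sup>*"
        unfolding w(1) by (rule b[rule_format]) (use w vtile(1)[OF qV] vtile(1)[OF wV] in auto)
      then show "dominates ?w q"
        using dominates_iff[OF vpos_dom[OF wV] vpos_dom[OF qV]] vtx_vpos[OF qV] vtx_vpos[OF wV] by simp
    qed
  next
    assume a: all_dominated
    show ?b
    proof (intro allI impI, elim conjE)
      fix q t d u
      assume q: "\<alpha> q = Some t" "\<alpha> (shift d q) = Some u" "0 < strength (t d)" "\<not> forced S d t u"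
      then have v: "vtx q \<in> {1..n}" "vtx (shift d q) \<in> {1..n}" using vtx_range by blast+
      have p: "vpos (vtx q) = q" "vpos (vtx (shift d q)) = shift d q"
        using vpos_vtx q(1,2) by blast+
      have "badv (vtx q) (dnum d) = vtx (shift d q)"
        unfolding badv_eq[OF v] p dir_of_dnum vtile_vtx[OF q(1)] vtile_vtx[OF q(2)] using q by blast
      moreover have "(root, vtx q) \<in> E\<^sup>*" using c v by auto
      ultimately have "dominates (vtx (shift d q)) (vtx q)"
        using a[unfolded all_dominated_def, rule_format, of "vtx q" "dnum d"] v(2) dnum_range(3)[of d]
        by auto
      then show "((0, 0), q) \<notin> (Restr (bonds \<alpha>) (- {shift d q}))\<^sup>*"
        using dominates_iff[of "shift d q" q] q by blast
    qed
  qed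
  then show ?thesis
    unfolding uniquely_produces_iff[OF tas_S S_simps(3) fin, unfolded S_simps, OF ran] trm conn
    using seed by (cases ?c) simp_all
qed

end

section \<open>Memory layout and preprocessing\<close>

text \<open>\<open>wp\<close> bounds every value that it lets be stored, so boundedness of the state
  is available at each intermediate point.\<close>

lemma wp_bounded: "wp N c Q s \<Longrightarrow> bounded_state N s \<Longrightarrow> wp N c (\<lambda>s. bounded_state N s \<and> Q s) s"
proof (induction c arbitrary: Q s)
  case (Seq c d)
  then have "wp N c (\<lambda>s. bounded_state N s \<and> wp N d Q s) s" by simp
  then show ?case unfolding wp.simps by (rule wp_mono) (use Seq.IH(2) in blast)
qed (auto simp: bounded_state_def)

lemma wp_SeqI:
  "bounded_state N s \<Longrightarrow> wp N c Q s \<Longrightarrow> (\<And>s'. bounded_state N s' \<Longrightarrow> Q s' \<Longrightarrow> wp N d R s') \<Longrightarrow> wp N (Seq c d) R s"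
  unfolding wp.simps by (rule wp_mono[OF wp_bounded]) auto

text \<open>Behind the input, which occupies the addresses below \<open>L\<close>, up to 16 tables are interleaved. Those in
  use are
  \<^item> 0: number of tile types with a given glue on a given side,
  \<^item> 1: vertex at a given position (vertices are numbered from 1, and 0 stands for none),
  \<^item> 2, 3: adjacent vertex, and adjacent vertex that has to dominate, in a given direction,
  \<^item> 4 to 8: the functions \<open>P\<close>, \<open>D\<close>, \<open>R\<close>, \<open>Lw\<close> and \<open>Nd\<close> of the search.\<close>

definition adr :: "int \<Rightarrow> int \<Rightarrow> int \<Rightarrow> int" where
  "adr L t i = L + (16 * i + t)"

text \<open>At a negative index \<open>adr\<close> points below the tables, where other data may be;
  reading 0 there lets a table serve as a total function of the search locales, which require for
  instance \<open>D_V\<close>.\<close>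

definition tab :: "int \<Rightarrow> (int \<Rightarrow> int) \<Rightarrow> int \<Rightarrow> int \<Rightarrow> int" where
  "tab L M t i = (if 0 \<le> i then M (adr L t i) else 0)"

lemma adr_nonneg [simp]: "0 \<le> L \<Longrightarrow> 0 \<le> t \<Longrightarrow> 0 \<le> i \<Longrightarrow> 0 \<le> adr L t i"
  by (simp add: adr_def)

lemma tab_upd:
  assumes "0 \<le> t" "t < 16" "0 \<le> t'" "t' < 16" "0 \<le> i"
  shows "tab L (M(adr L t i := x)) t' = (if t = t' then (tab L M t')(i := x) else tab L M t')"
proof -
  have "adr L t' j = adr L t i \<longleftrightarrow> t' = t \<and> j = i" for j
  proof
    assume "adr L t' j = adr L t i"
    then have e: "16 * j + t' = 16 * i + t" by (simp add: adr_def)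
    from arg_cong[OF e, of "\<lambda>x. x mod 16"] have "t' = t" using assms by simp
    with e show "t' = t \<and> j = i" by simp
  qed simp
  then show ?thesis using assms by (auto simp: tab_def fun_eq_iff)
qed

definition adrE :: "int \<Rightarrow> aexp \<Rightarrow> aexp" where
  "adrE t e = Add (Reg ''L'') (Add (Mul (Num 16) e) (Num t))"

definition tabE :: "int \<Rightarrow> aexp \<Rightarrow> aexp" where
  "tabE t e = Mem (adrE t e)"

lemma aval_adrE [simp]: "aval s (adrE t e) = adr (regs s ''L'') t (aval s e)"
  by (simp add: adrE_def adr_def)

lemma addresses_ok_adrE [simp]: "addresses_ok s (adrE t e) = addresses_ok s e"
  by (simp add: adrE_def)

lemma aval_tabE [simp]: "0 \<le> aval s e \<Longrightarrow> aval s (tabE t e) = tab (regs s ''L'') (mem s) t (aval s e)"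
  by (simp add: tabE_def tab_def)

lemma addresses_ok_tabE [simp]:
  "0 \<le> regs s ''L'' \<Longrightarrow> 0 \<le> t \<Longrightarrow> 0 \<le> aval s e \<Longrightarrow> addresses_ok s (tabE t e) = addresses_ok s e"
  by (simp add: tabE_def)

text \<open>A pairing of label and strength by squares, with the side as last digit to base 4.
  Direct addressing calls for an injective code made of sums and products, as the machine has no
  division.\<close>

definition gcode :: "int \<Rightarrow> int \<Rightarrow> int \<Rightarrow> int" where
  "gcode k l st = 4 * ((l + st) * (l + st) + l) + k"

text \<open>\<open>x * (2 * x + 1)\<close> is the triangular number with index \<open>2 * x\<close>,
  or with index \<open>- 2 * x - 1\<close> if \<open>x\<close> is negative. It maps the integers
  injectively to nonnegative ones without a test of the sign; the pairing of \<open>gcode\<close> is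
  applied afterwards.\<close>

definition pcode :: "pos \<Rightarrow> int" where
  "pcode p = (let z = (\<lambda>x. x * (2 * x + 1)); a = z (fst p); b = z (snd p) in (a + b) * (a + b) + a)"

text \<open>With \<open>c = a + b\<close> the code lies between \<open>c * c\<close> and
  \<open>c * c + c\<close>, hence below the next square. So it determines \<open>c\<close>, and then
  \<open>a\<close>.\<close>

lemma pairing_inj:
  fixes a b a' b' :: int
  assumes "0 \<le> a" "0 \<le> b" "0 \<le> a'" "0 \<le> b'" and eq: "(a + b) * (a + b) + a = (a' + b') * (a' + b') + a'"
  shows "a = a' \<and> b = b'"
proof -
  have *: "u * u + c < v * v" if "u < v" "c \<le> u" "0 \<le> u" for u v c :: int
  proof -
    have "(u + 1) * (u + 1) \<le> v * v" using that by (intro mult_mono) auto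
    then show ?thesis using that by (simp add: algebra_simps)
  qed
  have "\<not> a + b < a' + b'" using *[of "a + b" "a' + b'" a] assms by auto
  moreover have "\<not> a' + b' < a + b" using *[of "a' + b'" "a + b" a'] assms by auto
  ultimately have "a + b = a' + b'" by simp
  with eq show ?thesis by simp
qed

lemma fold_int_nonneg: "0 \<le> x * (2 * x + 1)" for x :: int
  by (cases "0 \<le> x") (auto simp: zero_le_mult_iff)

text \<open>The difference of the two sides has the factor \<open>x - y\<close>; its cofactor is odd
  and cannot vanish.\<close>

lemma fold_int_inj: "x * (2 * x + 1) = y * (2 * y + 1) \<Longrightarrow> x = y" for x y :: int
proof -
  assume "x * (2 * x + 1) = y * (2 * y + 1)"
  then have "(x - y) * (2 * (x + y) + 1) = 0" by (simp add: algebra_simps)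
  moreover have "2 * (x + y) + 1 \<noteq> 0" by presburger
  ultimately show ?thesis by simp
qed

lemma pcode_inj [simp]: "pcode p = pcode q \<longleftrightarrow> p = q"
proof
  assume "pcode p = pcode q"
  from pairing_inj[OF fold_int_nonneg fold_int_nonneg fold_int_nonneg fold_int_nonneg this[unfolded pcode_def Let_def]]
  show "p = q" using fold_int_inj by (metis prod_eq_iff)
qed simp

lemma pcode_nonneg [simp]: "0 \<le> pcode p"
  using fold_int_nonneg by (simp add: pcode_def Let_def)

lemma base4_inj:
  fixes a a' k k' :: int
  shows "4 * a + k = 4 * a' + k' \<Longrightarrow> 0 \<le> k \<Longrightarrow> k < 4 \<Longrightarrow> 0 \<le> k' \<Longrightarrow> k' < 4 \<Longrightarrow> k = k' \<and> a = a'"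
  by presburger

lemma gcode_inj:
  "gcode (dnum d) (int l) (int st) = gcode (dnum e) (int l') (int st') \<longleftrightarrow> d = e \<and> l = l' \<and> st = st'"
proof
  assume eq: "gcode (dnum d) (int l) (int st) = gcode (dnum e) (int l') (int st')"
  have "dnum d = dnum e"
    "(int l + int st) * (int l + int st) + int l = (int l' + int st') * (int l' + int st') + int l'"
    using base4_inj[OF eq[unfolded gcode_def] dnum_range(1,2) dnum_range(1,2)] by blast+
  with pairing_inj[OF _ _ _ _ this(2)] show "d = e \<and> l = l' \<and> st = st'" by simp
qed simp

lemma gcode_nonneg [simp]: "0 \<le> gcode (dnum d) (int l) (int st)"
  using dnum_range[of d] by (simp add: gcode_def)

definition glueE :: "aexp \<Rightarrow> dir \<Rightarrow> aexp" where
  "glueE e d = Add (Add (Num 3) (Mul (Num 8) e)) (Num (2 * dnum d))"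

definition gcodeE :: "dir \<Rightarrow> aexp" where
  "gcodeE d = Add (Mul (Num 4) (Add (Mul (Add (Reg ''l'') (Reg ''s'')) (Add (Reg ''l'') (Reg ''s''))) (Reg ''l''))) (Num (dnum d))"

definition foldE :: "aexp \<Rightarrow> aexp" where
  "foldE e = Mul e (Add (Mul (Num 2) e) (Num 1))"

definition pcodeE :: "aexp \<Rightarrow> aexp \<Rightarrow> aexp" where
  "pcodeE a b = Add (Mul (Add (foldE a) (foldE b)) (Add (foldE a) (foldE b))) (foldE a)"

text \<open>Address of the record of vertex \<open>e + 1\<close>.\<close>

definition posE :: "aexp \<Rightarrow> aexp" where
  "posE e = Add (Add (Num 3) (Mul (Num 8) (Reg ''m''))) (Mul (Num 3) e)"

lemma aval_exprs [simp]:
  "aval s (glueE e d) = 3 + 8 * aval s e + 2 * dnum d"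
  "aval s (gcodeE d) = gcode (dnum d) (regs s ''l'') (regs s ''s'')"
  "aval s (pcodeE a b) = pcode (aval s a, aval s b)"
  "aval s (posE e) = 3 + 8 * regs s ''m'' + 3 * aval s e"
  by (simp_all add: glueE_def gcodeE_def gcode_def pcodeE_def foldE_def pcode_def posE_def Let_def)

lemma addresses_ok_exprs [simp]:
  "addresses_ok s (glueE e d) = addresses_ok s e"
  "addresses_ok s (gcodeE d)"
  "addresses_ok s (pcodeE a b) = (addresses_ok s a \<and> addresses_ok s b)"
  "addresses_ok s (posE e) = addresses_ok s e"
  by (auto simp: glueE_def gcodeE_def pcodeE_def foldE_def posE_def)

primrec seqs :: "com list \<Rightarrow> com" where
  "seqs [] = Skip"
| "seqs (c # cs) = Seq c (seqs cs)"

abbreviation dirs :: "dir list" where "dirs \<equiv> [North, East, South, West]"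

abbreviation incr :: com where "incr \<equiv> Assign ''i'' (Add (Reg ''i'') (Num 1))"

definition count_dir :: "dir \<Rightarrow> com" where
  "count_dir d = seqs
    [Assign ''l'' (Mem (glueE (Reg ''i'') d)),
     Assign ''s'' (Mem (Add (glueE (Reg ''i'') d) (Num 1))),
     Store (adrE 0 (gcodeE d)) (Add (tabE 0 (gcodeE d)) (Num 1))]"

definition count_tile :: com where
  "count_tile = Seq (seqs (map count_dir dirs)) incr"

definition enter_pos :: com where
  "enter_pos = seqs
    [Assign ''x'' (Mem (posE (Reg ''i''))),
     Assign ''y'' (Mem (Add (posE (Reg ''i'')) (Num 1))),
     Store (adrE 1 (pcodeE (Reg ''x'') (Reg ''y''))) (Add (Reg ''i'') (Num 1)),
     incr]"

text \<open>Failure only raises the flag \<open>rej\<close>; linking still runs, and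
  \<open>dfs_start\<close> consults the flag. Tile indices may be compared in place of tiles by
  \<open>index_in_inj\<close>.\<close>

definition find_seed :: com where
  "find_seed = seqs
    [Assign ''r'' (tabE 1 (pcodeE (Num 0) (Num 0))),
     Cond (Equal (Reg ''r'') (Num 0)) (Assign ''rej'' (Num 1))
       (Cond (Equal (Mem (Add (posE (Sub (Reg ''r'') (Num 1))) (Num 2))) (Mem (Num 2)))
          Skip (Assign ''rej'' (Num 1))),
     Assign ''i'' (Num 0)]"

definition eidx :: "int \<Rightarrow> int \<Rightarrow> int" where
  "eidx v k = 4 * v + k"

definition edgeE :: "dir \<Rightarrow> aexp" where
  "edgeE d = Add (Mul (Num 4) (Add (Reg ''i'') (Num 1))) (Num (dnum d))"

text \<open>If the neighbour carries the facing glue, a count of 1 says that no other tile type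
  could attach here through this glue, so no domination is required. A mismatch always requires it,
  a missing neighbour rejects, and null glues leave both tables at 0.\<close>

definition link_dir :: "dir \<Rightarrow> com" where
  "link_dir d = seqs
    [Assign ''l'' (Mem (glueE (Reg ''t'') d)),
     Assign ''s'' (Mem (Add (glueE (Reg ''t'') d) (Num 1))),
     Cond (Less (Num 0) (Reg ''s''))
       (seqs
         [Assign ''j'' (tabE 1 (pcodeE (Add (Reg ''x'') (Num (dx d))) (Add (Reg ''y'') (Num (dy d))))),
          Cond (Equal (Reg ''j'') (Num 0)) (Assign ''rej'' (Num 1))
            (seqs
              [Assign ''u'' (Mem (Add (posE (Sub (Reg ''j'') (Num 1))) (Num 2))),
               Cond (And (Equal (Mem (glueE (Reg ''u'') (opp d))) (Reg ''l''))
                      (Equal (Mem (Add (glueE (Reg ''u'') (opp d)) (Num 1))) (Reg ''s'')))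
                 (seqs
                   [Store (adrE 2 (edgeE d)) (Reg ''j''),
                    Cond (Equal (tabE 0 (gcodeE (opp d))) (Num 1)) Skip
                      (Store (adrE 3 (edgeE d)) (Reg ''j''))])
                 (Store (adrE 3 (edgeE d)) (Reg ''j''))])])
       Skip]"

definition link_pos :: com where
  "link_pos = seqs
    [Assign ''x'' (Mem (posE (Reg ''i''))),
     Assign ''y'' (Mem (Add (posE (Reg ''i'')) (Num 1))),
     Assign ''t'' (Mem (Add (posE (Reg ''i'')) (Num 2))),
     seqs (map link_dir dirs), incr]"

lemma aval_edgeE [simp]: "aval s (edgeE d) = eidx (regs s ''i'' + 1) (dnum d)"
  and addresses_ok_edgeE [simp]: "addresses_ok s (edgeE d)"
  by (auto simp: edgeE_def eidx_def)

context tas_instance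
begin

section \<open>Invariants of the preprocessing loops\<close>

definition base :: "state \<Rightarrow> bool" where
  "base st \<longleftrightarrow> regs st ''m'' = m \<and> regs st ''n'' = n \<and> regs st ''L'' = L \<and> regs st ''out'' = 0 \<and>
     (\<forall>a. 0 \<le> a \<and> a < L \<longrightarrow> mem st a = im a)"

definition zero_from :: "int \<Rightarrow> state \<Rightarrow> bool" where
  "zero_from k st \<longleftrightarrow> (\<forall>t i. k \<le> t \<and> t \<le> 8 \<longrightarrow> tab L (mem st) t i = 0)"

definition gcount :: "int \<Rightarrow> dir \<Rightarrow> glue \<Rightarrow> int" where
  "gcount i e g = int (card {j \<in> {0..<i}. tl_at j e = g})"

text \<open>\<open>D\<close> holds the sides of tile \<open>i\<close> treated so far, so that one
  invariant serves between the four unrolled sides as well as between iterations;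
  \<open>linked\<close> and \<open>checked\<close> follow the same pattern.\<close>

definition counted :: "int \<Rightarrow> dir set \<Rightarrow> state \<Rightarrow> bool" where
  "counted i D st \<longleftrightarrow> (\<forall>e l k. tab L (mem st) 0 (gcode (dnum e) (int l) (int k)) =
     gcount (if e \<in> D then i + 1 else i) e (Glue l k))"

lemma gcount_Suc: "0 \<le> i \<Longrightarrow> gcount (i + 1) e g = gcount i e g + (if tl_at i e = g then 1 else 0)"
proof -
  assume "0 \<le> i"
  then have "{j \<in> {0..<i + 1}. tl_at j e = g} =
      (if tl_at i e = g then insert i {j \<in> {0..<i}. tl_at j e = g} else {j \<in> {0..<i}. tl_at j e = g})"
    by (auto simp: less_le)
  moreover have "i \<notin> {j \<in> {0..<i}. tl_at j e = g}" "finite {j \<in> {0..<i}. tl_at j e = g}"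
    by (simp, rule finite_subset[of _ "{0..<i}"]) auto
  ultimately show ?thesis by (simp add: gcount_def del: mem_Collect_eq atLeastLessThan_iff)
qed

lemma gcount_le: "0 \<le> i \<Longrightarrow> 0 \<le> gcount i e g \<and> gcount i e g \<le> i"
proof -
  assume "0 \<le> i"
  have "card {j \<in> {0..<i}. tl_at j e = g} \<le> card {0..<i}" by (intro card_mono) auto
  then show ?thesis using \<open>0 \<le> i\<close> by (simp add: gcount_def)
qed

text \<open>\<open>v = 0\<close> is the exit condition of the search loop, so a rejection during
  preprocessing skips the search.\<close>

definition idle :: "state \<Rightarrow> bool" where
  "idle st \<longleftrightarrow> base st \<and> regs st ''v'' = 0 \<and> regs st ''c'' = 0"

definition inv1 :: "int \<Rightarrow> dir set \<Rightarrow> state \<Rightarrow> bool" where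
  "inv1 i D st \<longleftrightarrow> idle st \<and> regs st ''rej'' = 0 \<and> regs st ''i'' = i \<and> 0 \<le> i \<and> i \<le> m \<and>
     counted i D st \<and> zero_from 1 st"

lemma adr_not_less [simp]: "0 \<le> t \<Longrightarrow> 0 \<le> i \<Longrightarrow> \<not> adr L t i < L"
  by (simp add: adr_def)

lemma neq_adr [simp]: "a < L \<Longrightarrow> 0 \<le> t \<Longrightarrow> 0 \<le> i \<Longrightarrow> a \<noteq> adr L t i"
  using adr_not_less by metis

lemma L_nonneg [simp]: "0 \<le> L"
  using L_ge by simp

lemma count_dir_wp:
  assumes b: "bounded_state N st" and inv: "inv1 i D st" and d: "d \<notin> D" and i: "i < m"
  shows "wp N (count_dir d) (inv1 i (insert d D)) st"
proof -
  have i0: "0 \<le> i" and regs: "regs st ''L'' = L" "regs st ''i'' = i" using inv by (auto simp: inv1_def idle_def base_def)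
  obtain l k where g: "tl_at i d = Glue l k" by (cases "tl_at i d")
  let ?a = "3 + 8 * i + 2 * dnum d"
  have a: "0 \<le> ?a" "?a + 1 < L" using i0 i dnum_range[of d] n_ge by (auto simp: L_def)
  then have ml: "mem st ?a = int l" "mem st (?a + 1) = int k"
    using im_tile[OF i0 i, of d] inv g by (auto simp: inv1_def idle_def base_def)
  then have bl: "int l \<le> N" "int k \<le> N"
    using b unfolding bounded_state_def by (metis abs_of_nat)+
  have t: "tab L (mem st) 0 (gcode (dnum d) (int l) (int k)) = gcount i d (Glue l k)"
    using inv d by (auto simp: inv1_def counted_def)
  have c: "0 \<le> gcount i d (Glue l k)" "gcount i d (Glue l k) + 1 \<le> N"
    using gcount_le[OF i0, of d "Glue l k"] i L_le_N n_ge m_ge by (auto simp: L_def)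
  have cnt: "gcount (i + 1) d g' = gcount i d g' + (if g' = Glue l k then 1 else 0)" for g'
    using gcount_Suc[OF i0, of d g'] g by auto
  show ?thesis
    using a ml bl t c inv
    by (auto simp: count_dir_def regs inv1_def idle_def base_def counted_def zero_from_def tab_upd gcode_inj cnt add.assoc)
qed


lemma count_tile_wp:
  assumes b: "bounded_state N st" and inv: "inv1 i {} st" and i: "i < m"
  shows "wp N count_tile (inv1 (i + 1) {}) st"
proof -
  have all: "{West, South, East, North} = UNIV" using dir.exhaust by auto
  have step: "bounded_state N st \<Longrightarrow> inv1 i D st \<Longrightarrow> d \<notin> D \<Longrightarrow>
      (\<And>st'. bounded_state N st' \<Longrightarrow> inv1 i (insert d D) st' \<Longrightarrow> wp N c Q st') \<Longrightarrow>
      wp N (Seq (count_dir d) c) Q st" for D d c Q st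
    by (rule wp_SeqI[OF _ count_dir_wp[OF _ _ _ i]])
  have "wp N (seqs (map count_dir dirs)) (inv1 i UNIV) st"
    unfolding list.map seqs.simps
    by (rule step[OF b inv], simp, rule step, assumption+, simp, rule step, assumption+, simp,
        rule step, assumption+, simp) (simp add: all)
  then show ?thesis unfolding count_tile_def
  proof (rule wp_SeqI[OF b])
    fix st' assume "inv1 i UNIV st'"
    then show "wp N incr (inv1 (i + 1) {}) st'"
      using i L_le_N n_ge by (auto simp: inv1_def idle_def base_def counted_def zero_from_def L_def)
  qed
qed

lemma tile_input:
  assumes "base st" "0 \<le> j" "j < m"
  shows "mem st (3 + 8 * j + 2 * dnum d) = int (label (tl_at j d))"
    "mem st (3 + 8 * j + 2 * dnum d + 1) = int (strength (tl_at j d))"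
    "0 \<le> 3 + 8 * j + 2 * dnum d"
proof -
  have "0 \<le> 3 + 8 * j + 2 * dnum d" "3 + 8 * j + 2 * dnum d + 1 < L"
    using assms dnum_range[of d] n_ge by (auto simp: L_def)
  then show "mem st (3 + 8 * j + 2 * dnum d) = int (label (tl_at j d))"
    "mem st (3 + 8 * j + 2 * dnum d + 1) = int (strength (tl_at j d))"
    "0 \<le> 3 + 8 * j + 2 * dnum d"
    using assms im_tile[OF assms(2,3), of d] by (auto simp: base_def)
qed

lemma pos_input:
  assumes "base st" "v \<in> {1..n}"
  shows "mem st (3 + 8 * m + 3 * (v - 1)) = fst (vpos v)"
    "mem st (3 + 8 * m + 3 * (v - 1) + 1) = snd (vpos v)"
    "mem st (3 + 8 * m + 3 * (v - 1) + 2) = tidx v"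
    "0 \<le> 3 + 8 * m + 3 * (v - 1)"
  using assms im_pos[of "v - 1"] m_ge by (auto simp: base_def L_def)

definition placed :: "int \<Rightarrow> state \<Rightarrow> bool" where
  "placed i st \<longleftrightarrow> (\<forall>p. tab L (mem st) 1 (pcode p) = (if vtx p \<le> i then vtx p else 0))"

definition inv2 :: "int \<Rightarrow> state \<Rightarrow> bool" where
  "inv2 i st \<longleftrightarrow> idle st \<and> regs st ''rej'' = 0 \<and> regs st ''i'' = i \<and> 0 \<le> i \<and> i \<le> n \<and>
     counted m {} st \<and> placed i st \<and> zero_from 2 st"

lemma inv1_inv2: "inv1 m {} st \<Longrightarrow> bounded_state N st \<Longrightarrow> wp N (Assign ''i'' (Num 0)) (inv2 0) st"
  using n_ge L_le_N vtx_le(1) order_antisym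
  by (auto simp: inv1_def inv2_def idle_def base_def zero_from_def counted_def placed_def)

lemma bounded_mem: "bounded_state N st \<Longrightarrow> mem st a = x \<Longrightarrow> \<bar>x\<bar> \<le> N"
  by (auto simp: bounded_state_def)

lemma enter_pos_wp:
  assumes b: "bounded_state N st" and inv: "inv2 i st" and i: "i < n"
  shows "wp N enter_pos (inv2 (i + 1)) st"
proof -
  have regs: "regs st ''L'' = L" "regs st ''i'' = i" "regs st ''m'' = m" and i0: "0 \<le> i" and base: "base st"
    using inv by (auto simp: inv2_def idle_def base_def)
  have v: "i + 1 \<in> {1..n}" using i i0 by simp
  note pos = pos_input[OF base v, simplified]
  note bd = bounded_mem[OF b pos(1)] bounded_mem[OF b pos(2)]
  have iN: "i + 1 \<le> N" using i L_le_N m_ge by (auto simp: L_def)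
  have "vtx p = i + 1 \<longleftrightarrow> p = vpos (i + 1)" for p by (rule vtx_eq_iff[OF v])
  then have pl: "(if vtx p \<le> i + 1 then vtx p else 0) =
      (if p = vpos (i + 1) then i + 1 else if vtx p \<le> i then vtx p else 0)" for p
    by (smt (verit))
  show ?thesis
    using inv i0 i iN bd m_ge
    by (auto simp: enter_pos_def regs pos inv2_def idle_def base_def counted_def placed_def zero_from_def tab_upd pl)
qed

lemma index_in_inj: "t \<in> T \<Longrightarrow> u \<in> T \<Longrightarrow> index_in ts t = index_in ts u \<longleftrightarrow> t = u"
  using index_in by metis

definition seed_ok :: bool where "seed_ok \<longleftrightarrow> \<alpha> (0, 0) = Some s"

definition linked :: "int \<Rightarrow> dir set \<Rightarrow> state \<Rightarrow> bool" where
  "linked i D st \<longleftrightarrow> (\<forall>v\<in>{1..n}. \<forall>e.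
     tab L (mem st) 2 (eidx v (dnum e)) = (if v \<le> i \<or> v = i + 1 \<and> e \<in> D then adjv v (dnum e) else 0) \<and>
     tab L (mem st) 3 (eidx v (dnum e)) = (if v \<le> i \<or> v = i + 1 \<and> e \<in> D then badv v (dnum e) else 0))"

definition checked :: "int \<Rightarrow> dir set \<Rightarrow> state \<Rightarrow> bool" where
  "checked i D st \<longleftrightarrow> (regs st ''rej'' = 0 \<longleftrightarrow>
     seed_ok \<and> (\<forall>v\<in>{1..n}. \<forall>e. v \<le> i \<or> v = i + 1 \<and> e \<in> D \<longrightarrow> \<not> viol v (dnum e)))"

definition inv3 :: "int \<Rightarrow> dir set \<Rightarrow> state \<Rightarrow> bool" where
  "inv3 i D st \<longleftrightarrow> idle st \<and> regs st ''i'' = i \<and> 0 \<le> i \<and> i \<le> n \<and> regs st ''r'' = vtx (0, 0) \<and>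
     counted m {} st \<and> placed n st \<and> zero_from 4 st \<and> linked i D st \<and> checked i D st"

lemma placed_n:
  assumes "placed n st"
  shows "tab L (mem st) 1 (pcode p) = vtx p"
proof -
  have "tab L (mem st) 1 (pcode p) = (if vtx p \<le> n then vtx p else 0)"
    using assms unfolding placed_def by blast
  then show ?thesis using vtx_le(2)[of p] by simp
qed

lemma find_seed_wp:
  assumes b: "bounded_state N st" and inv: "inv2 n st"
  shows "wp N find_seed (inv3 0 {}) st"
proof -
  have regs: "regs st ''L'' = L" "regs st ''m'' = m" "regs st ''rej'' = 0" and base: "base st"
    using inv by (auto simp: inv2_def idle_def base_def)
  let ?r = "vtx (0, 0)"
  have t: "tab L (mem st) 1 (pcode (0, 0)) = ?r" using inv placed_n by (auto simp: inv2_def)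
  have rN: "0 \<le> ?r" "?r \<le> N" using vtx_le[of "(0, 0)"] L_le_N m_ge n_ge by (auto simp: L_def)
  have N1: "1 \<le> N" using L_le_N by simp
  have s2: "mem st 2 = int (index_in ts s)" using base L_ge im_head by (auto simp: base_def)
  have z: "linked 0 {} st'" if "zero_from 2 st'" for st'
    using that by (auto simp: linked_def zero_from_def)
  show ?thesis
  proof (cases "?r = 0")
    case True
    then have "\<not> seed_ok" using vtx_eq_0[of "(0, 0)"] by (auto simp: seed_ok_def)
    then show ?thesis
      using inv True n_ge N1 z
      by (auto simp: find_seed_def regs t inv2_def inv3_def idle_def base_def counted_def placed_def
          zero_from_def linked_def checked_def)
  next
    case False
    then have r: "?r \<in> {1..n}" and d: "(0, 0) \<in> dom \<alpha>" using vtx_range vtx_eq_0 by blast+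
    note pos = pos_input[OF base r]
    have "tidx ?r = int (index_in ts s) \<longleftrightarrow> seed_ok"
    proof -
      have "s \<in> T" using tas by (simp add: is_tas_def)
      then have "tidx ?r = int (index_in ts s) \<longleftrightarrow> vtile ?r = s"
        using index_in_inj[OF vtile(2)[OF r]] by (simp add: tidx_def)
      also have "\<dots> \<longleftrightarrow> seed_ok"
        using vtile(1)[OF r] vpos_vtx[OF d] by (auto simp: seed_ok_def)
      finally show ?thesis .
    qed
    then show ?thesis
      using inv False n_ge N1 rN z pos(3,4) s2 vtx_le(2)[of "(0, 0)"]
      by (auto simp: find_seed_def regs t inv2_def inv3_def idle_def base_def counted_def placed_def
          zero_from_def linked_def checked_def)
  qed
qed

text \<open>\<open>ts\<close> lists every type once, so counting indices counts tile types. When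
  \<open>u\<close> carries the glue itself, a count of one leaves \<open>u\<close> as the only such
  type.\<close>

lemma forced_iff_gcount:
  assumes "u \<in> T"
  shows "forced S d t u \<longleftrightarrow> interacts d t u \<and> gcount m (opp d) (t d) = 1"
proof (cases "u (opp d) = t d")
  case True
  let ?J = "{j \<in> {0..<m}. tl_at j (opp d) = t d}" and ?U = "{u' \<in> T. u' (opp d) = t d}"
  have "bij_betw tl_at ?J ?U"
    unfolding bij_betw_def
  proof
    show "inj_on tl_at ?J" using ts(1) by (auto simp: inj_on_def tl_at_def m_def nth_eq_iff_index_eq)
    show "tl_at ` ?J = ?U"
    proof
      show "tl_at ` ?J \<subseteq> ?U" using ts(2) by (auto simp: tl_at_def m_def intro!: nth_mem)
      show "?U \<subseteq> tl_at ` ?J"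
      proof
        fix u' assume u': "u' \<in> ?U"
        then have "int (index_in ts u') \<in> ?J" "tl_at (int (index_in ts u')) = u'"
          using index_in[of u'] by (auto simp: tl_at_def m_def)
        then show "u' \<in> tl_at ` ?J" by (metis imageI)
      qed
    qed
  qed
  then have "card ?J = card ?U" by (rule bij_betw_same_card)
  moreover have "card ?U = 1 \<longleftrightarrow> ?U = {u}"
  proof
    assume "card ?U = 1"
    then obtain x where "?U = {x}" by (auto simp: card_1_singleton_iff)
    moreover have "u \<in> ?U" using True assms by auto
    ultimately show "?U = {u}" by auto
  qed simp
  ultimately show ?thesis unfolding forced_def gcount_def S_simps by simp
qed (auto simp: forced_def interacts_def)

lemma eidx_inj [simp]: "eidx v (dnum e) = eidx w (dnum d) \<longleftrightarrow> v = w \<and> e = d"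
  unfolding eidx_def
proof
  assume eq: "4 * v + dnum e = 4 * w + dnum d"
  from base4_inj[OF eq dnum_range(1,2) dnum_range(1,2)] show "v = w \<and> e = d" by simp
qed simp

definition inv3x :: "int \<Rightarrow> dir set \<Rightarrow> state \<Rightarrow> bool" where
  "inv3x i D st \<longleftrightarrow> inv3 i D st \<and> regs st ''x'' = fst (vpos (i + 1)) \<and> regs st ''y'' = snd (vpos (i + 1)) \<and>
     regs st ''t'' = tidx (i + 1)"

text \<open>Shared by all branches of \<open>link_dir\<close>, which differ only in the values
  written to scratch registers and to the two cells for direction \<open>d\<close>.\<close>

lemma inv3x_step:
  assumes inv: "inv3x i D st" and v: "i + 1 \<in> {1..n}"
    and regs': "regs st' = (regs st)(''l'' := l, ''s'' := k, ''j'' := j, ''u'' := u, ''rej'' := rej)"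
    and mem': "mem st' = M'"
    and inp: "\<And>a. 0 \<le> a \<Longrightarrow> a < L \<Longrightarrow> M' a = mem st a"
    and same: "\<And>t. 0 \<le> t \<Longrightarrow> t < 16 \<Longrightarrow> t \<noteq> 2 \<Longrightarrow> t \<noteq> 3 \<Longrightarrow> tab L M' t = tab L (mem st) t"
    and t2: "tab L M' 2 = (tab L (mem st) 2)(eidx (i + 1) (dnum d) := adjv (i + 1) (dnum d))"
    and t3: "tab L M' 3 = (tab L (mem st) 3)(eidx (i + 1) (dnum d) := badv (i + 1) (dnum d))"
    and rej: "rej = 0 \<longleftrightarrow> regs st ''rej'' = 0 \<and> \<not> viol (i + 1) (dnum d)"
  shows "inv3x i (insert d D) st'"
proof -
  have "zero_from 4 st'"
    unfolding zero_from_def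
  proof (intro allI impI)
    fix t a :: int assume t: "4 \<le> t \<and> t \<le> 8"
    then have "tab L M' t = tab L (mem st) t" using same by auto
    then show "tab L (mem st') t a = 0" using t inv by (simp add: mem' inv3x_def inv3_def zero_from_def)
  qed
  moreover have "checked i (insert d D) st'"
    using inv rej v by (auto simp: inv3x_def inv3_def checked_def regs')
  moreover have "linked i (insert d D) st'"
    using inv by (auto simp: inv3x_def inv3_def linked_def mem' t2 t3)
  ultimately show ?thesis
    using inv inp same[of 0] same[of 1]
    by (auto simp: inv3x_def inv3_def idle_def base_def counted_def placed_def regs' mem')
qed

lemma link_dir_wp:
  assumes b: "bounded_state N st" and inv: "inv3x i D st" and d: "d \<notin> D" and i: "i < n"
  shows "wp N (link_dir d) (inv3x i (insert d D)) st"
proof -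
  have regs: "regs st ''L'' = L" "regs st ''i'' = i" "regs st ''m'' = m" and i0: "0 \<le> i" and base: "base st"
    and xyt: "regs st ''x'' = fst (vpos (i + 1))" "regs st ''y'' = snd (vpos (i + 1))" "regs st ''t'' = tidx (i + 1)"
    using inv by (auto simp: inv3x_def inv3_def idle_def base_def)
  let ?v = "i + 1"
  have v: "?v \<in> {1..n}" using i i0 by simp
  let ?q = "shift d (vpos ?v)" and ?e = "eidx ?v (dnum d)"
  have q: "(fst (vpos ?v) + dx d, snd (vpos ?v) + dy d) = ?q" by (metis shift_eq prod.collapse)
  have tv: "0 \<le> tidx ?v" "tidx ?v < m" "tl_at (tidx ?v) = vtile ?v" using tidx[OF v] by auto
  obtain l k where g: "vtile ?v d = Glue l k" by (cases "vtile ?v d")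
  note tl = tile_input[OF base tv(1,2), of d, unfolded tv(3) g glue.sel]
  have bl: "int l \<le> N" "int k \<le> N" using bounded_mem[OF b tl(1)] bounded_mem[OF b tl(2)] by auto
  have e0: "0 \<le> ?e" using i0 dnum_range[of d] by (simp add: eidx_def)
  have z: "tab L (mem st) 2 ?e = 0" "tab L (mem st) 3 ?e = 0"
    using inv v d by (auto simp: inv3x_def inv3_def linked_def)
  \<comment> \<open>Both cells are still 0, so a branch that stores nothing also has the form of an
    update, with value 0.\<close>
  have same: "(tab L (mem st) 2)(?e := 0) = tab L (mem st) 2" "(tab L (mem st) 3)(?e := 0) = tab L (mem st) 3"
    using z by auto
  have N1: "1 \<le> N" using L_le_N by simp
  have p: "tab L (mem st) 1 (pcode ?q) = vtx ?q" using inv placed_n by (auto simp: inv3x_def inv3_def)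
  have qN: "0 \<le> vtx ?q" "vtx ?q \<le> N" using vtx_le[of ?q] L_le_N m_ge n_ge by (auto simp: L_def)
  show ?thesis
  proof (cases "k = 0")
    case True
    then have "adjv ?v (dnum d) = 0" "badv ?v (dnum d) = 0" "\<not> viol ?v (dnum d)"
      using g by (auto simp: adjv_def badv_def viol_def interacts_def Let_def)
    then have "inv3x i (insert d D) st'"
      if "regs st' = (regs st)(''l'' := int l, ''s'' := int k)" "mem st' = mem st" for st'
      by (intro inv3x_step[OF inv v, where st' = st' and d = d and l = "int l" and k = "int k" and
            j = "regs st ''j''" and u = "regs st ''u''" and rej = "regs st ''rej''"])
        (use that same in auto)
    then show ?thesis using True tl bl by (simp add: link_dir_def xyt)
  next
    case k: False
    show ?thesis
    proof (cases "vtx ?q = 0")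
      case True
      then have "?q \<notin> dom \<alpha>" using vtx_eq_0 by blast
      then have "adjv ?v (dnum d) = 0" "badv ?v (dnum d) = 0" "viol ?v (dnum d)"
        using g k by (auto simp: adjv_def badv_def viol_def interacts_def Let_def)
      then have "inv3x i (insert d D) st'"
        if "regs st' = (regs st)(''l'' := int l, ''s'' := int k, ''j'' := 0, ''rej'' := 1)" "mem st' = mem st" for st'
        by (intro inv3x_step[OF inv v, where st' = st' and d = d and l = "int l" and k = "int k" and
              j = 0 and u = "regs st ''u''" and rej = 1])
          (use that same in auto)
      then show ?thesis using True k tl bl N1 by (simp add: link_dir_def xyt regs q p)
    next
      case False
      let ?w = "vtx ?q"
      have qd: "?q \<in> dom \<alpha>" using False vtx_eq_0 by blast
      then have w: "?w \<in> {1..n}" by (rule vtx_range)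
      note pos = pos_input[OF base w]
      have tw: "0 \<le> tidx ?w" "tidx ?w < m" "tl_at (tidx ?w) = vtile ?w" using tidx[OF w] by auto
      obtain l' k' where g': "vtile ?w (opp d) = Glue l' k'" by (cases "vtile ?w (opp d)")
      note tl' = tile_input[OF base tw(1,2), of "opp d", unfolded tw(3) g' glue.sel]
      have aq: "the (\<alpha> ?q) = vtile ?w" using vpos_vtx[OF qd] by (simp add: vtile_def)
      have int: "interacts d (vtile ?v) (vtile ?w) \<longleftrightarrow> l' = l \<and> k' = k"
        using g g' k by (auto simp: interacts_def)
      have adj: "adjv ?v (dnum d) = (if l' = l \<and> k' = k then ?w else 0)"
        using qd by (auto simp: adjv_def Let_def aq int)
      have cnt: "tab L (mem st) 0 (gcode (dnum (opp d)) (int l) (int k)) = gcount m (opp d) (Glue l k)"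
        using inv by (auto simp: inv3x_def inv3_def counted_def)
      have bad: "badv ?v (dnum d) = (if l' = l \<and> k' = k \<and> gcount m (opp d) (Glue l k) = 1 then 0 else ?w)"
        using qd k g forced_iff_gcount[OF vtile(2)[OF w], of d "vtile ?v"] by (auto simp: badv_def Let_def aq int)
      have nv: "\<not> viol ?v (dnum d)" using qd by (simp add: viol_def)
      have tN: "tidx ?w \<le> N" using bounded_mem[OF b pos(3)] by auto
      have fin: "inv3x i (insert d D) st'"
        if "regs st' = (regs st)(''l'' := int l, ''s'' := int k, ''j'' := ?w, ''u'' := tidx ?w)"
          "\<And>a. 0 \<le> a \<Longrightarrow> a < L \<Longrightarrow> mem st' a = mem st a"
          "\<And>t. 0 \<le> t \<Longrightarrow> t < 16 \<Longrightarrow> t \<noteq> 2 \<Longrightarrow> t \<noteq> 3 \<Longrightarrow> tab L (mem st') t = tab L (mem st) t"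
          "tab L (mem st') 2 = (tab L (mem st) 2)(?e := adjv ?v (dnum d))"
          "tab L (mem st') 3 = (tab L (mem st) 3)(?e := badv ?v (dnum d))" for st'
        by (intro inv3x_step[OF inv v, where st' = st' and d = d and l = "int l" and k = "int k" and
              j = ?w and u = "tidx ?w" and rej = "regs st ''rej''" and M' = "mem st'"])
          (use that nv in auto)
      note exec = link_dir_def xyt regs q p
      show ?thesis
      proof (cases "l' = l \<and> k' = k")
        case True
        have "adjv ?v (dnum d) = ?w" using True adj by simp
        moreover have "badv ?v (dnum d) = (if gcount m (opp d) (Glue l k) = 1 then 0 else ?w)"
          using True bad by simp
        ultimately show ?thesis
          using False True k tl tl' bl qN pos tw tN e0 cnt same
          by (simp add: exec tab_upd) (intro conjI impI fin; simp add: tab_upd)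
      next
        case neq: False
        have "adjv ?v (dnum d) = 0" "badv ?v (dnum d) = ?w" using neq adj bad by auto
        then show ?thesis
          using False neq k tl tl' bl qN pos tw tN e0 cnt same
          by (simp add: exec tab_upd) (intro conjI impI fin; simp add: tab_upd)
      qed
    qed
  qed
qed

end

section \<open>The search program\<close>

definition eidxE :: "aexp \<Rightarrow> aexp \<Rightarrow> aexp" where
  "eidxE a b = Add (Mul (Num 4) a) b"

lemma aval_eidxE [simp]: "aval s (eidxE a b) = eidx (aval s a) (aval s b)"
  and addresses_ok_eidxE [simp]: "addresses_ok s (eidxE a b) = (addresses_ok s a \<and> addresses_ok s b)"
  by (auto simp: eidxE_def eidx_def)

lemma eidx_nonneg [simp]: "0 \<le> v \<Longrightarrow> 0 \<le> k \<Longrightarrow> 0 \<le> eidx v k"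
  by (simp add: eidx_def)

definition dfs_start :: com where
  "dfs_start = Cond (Equal (Reg ''rej'') (Num 0))
     (seqs
       [Assign ''v'' (Reg ''r''), Assign ''c'' (Num 1),
        Store (adrE 5 (Reg ''r'')) (Num 1), Store (adrE 7 (Reg ''r'')) (Num 1)])
     Skip"

text \<open>\<open>P\<close> at the current vertex is advanced before the request is inspected. This
  does not disturb the test for stack membership, as the requested vertex differs from the current
  one.\<close>

definition mark :: com where
  "mark = seqs
    [Store (adrE 4 (Reg ''v'')) (Add (Reg ''k'') (Num 1)),
     Assign ''w'' (tabE 3 (eidxE (Reg ''v'') (Reg ''k''))),
     Cond (Equal (Reg ''w'') (Num 0)) Skip
       (seqs
         [Assign ''q'' (tabE 4 (Reg ''w'')),
          Cond (And (Less (Num 0) (Reg ''q'')) (Less (Reg ''q'') (Num 5)))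
            (Store (adrE 8 (tabE 2 (eidxE (Reg ''w'') (Sub (Reg ''q'') (Num 1))))) (Num 1))
            (Assign ''rej'' (Num 1))])]"

text \<open>After a rejection by \<open>mark\<close>, 0 in \<open>v\<close> ends the search loop at
  its next test.\<close>

definition advance :: com where
  "advance = Cond (Equal (Reg ''rej'') (Num 0))
    (seqs
      [Assign ''u'' (tabE 2 (eidxE (Reg ''v'') (Reg ''k''))),
       Cond (Equal (Reg ''u'') (Num 0)) Skip
         (Cond (Equal (tabE 5 (Reg ''u'')) (Num 0))
           (seqs
             [Assign ''c'' (Add (Reg ''c'') (Num 1)),
              Store (adrE 5 (Reg ''u'')) (Reg ''c''),
              Store (adrE 7 (Reg ''u'')) (Reg ''c''),
              Store (adrE 6 (Reg ''u'')) (Reg ''v''),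
              Assign ''v'' (Reg ''u'')])
           (Cond (Less (tabE 5 (Reg ''u'')) (tabE 7 (Reg ''v'')))
             (Store (adrE 7 (Reg ''v'')) (tabE 5 (Reg ''u'')))
             Skip))])
    (Assign ''v'' (Num 0))"

text \<open>The predecessor of the root is 0, so popping the root leaves 0 in \<open>v\<close> and
  ends the loop; a failed request ends it in the same way.\<close>

definition retreat :: com where
  "retreat = seqs
    [Store (adrE 4 (Reg ''v'')) (Num 5),
     Assign ''w'' (tabE 6 (Reg ''v'')),
     Cond (Equal (Reg ''w'') (Num 0)) Skip
       (Cond (And (Not (Equal (tabE 8 (Reg ''v'')) (Num 0))) (Less (tabE 7 (Reg ''v'')) (tabE 5 (Reg ''w''))))
         (seqs [Assign ''rej'' (Num 1), Assign ''w'' (Num 0)])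
         (Cond (Less (tabE 7 (Reg ''v'')) (tabE 7 (Reg ''w'')))
           (Store (adrE 7 (Reg ''w'')) (tabE 7 (Reg ''v'')))
           Skip)),
     Assign ''v'' (Reg ''w'')]"

definition dfs_step :: com where
  "dfs_step = Seq (Assign ''k'' (tabE 4 (Reg ''v'')))
     (Cond (Less (Reg ''k'') (Num 4)) (Seq mark advance) retreat)"

definition finish :: com where
  "finish = Cond (And (Equal (Reg ''rej'') (Num 0)) (Equal (Reg ''c'') (Reg ''n'')))
     (Assign ''out'' (Num 1)) Skip"

context tas_instance
begin

lemma link_pos_wp:
  assumes b: "bounded_state N st" and inv: "inv3 i {} st" and i: "i < n"
  shows "wp N link_pos (inv3 (i + 1) {}) st"
proof -
  have regs: "regs st ''i'' = i" "regs st ''m'' = m" and i0: "0 \<le> i" and base: "base st"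
    using inv by (auto simp: inv3_def idle_def base_def)
  have v: "i + 1 \<in> {1..n}" using i i0 by simp
  note pos = pos_input[OF base v, simplified]
  have all: "{West, South, East, North} = UNIV" using dir.exhaust by auto
  have step: "bounded_state N st \<Longrightarrow> inv3x i D st \<Longrightarrow> d \<notin> D \<Longrightarrow>
      (\<And>st'. bounded_state N st' \<Longrightarrow> inv3x i (insert d D) st' \<Longrightarrow> wp N c Q st') \<Longrightarrow>
      wp N (Seq (link_dir d) c) Q st" for D d c Q st
    by (rule wp_SeqI[OF _ link_dir_wp[OF _ _ _ i]])
  have links: "wp N (seqs (map link_dir dirs)) (inv3x i UNIV) st'"
    if "bounded_state N st'" "inv3x i {} st'" for st'
    unfolding list.map seqs.simps
    by (rule step[OF that], simp, rule step, assumption+, simp, rule step, assumption+, simp,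
        rule step, assumption+, simp) (simp add: all)
  have 1: "wp N (seqs [Assign ''x'' (Mem (posE (Reg ''i''))),
     Assign ''y'' (Mem (Add (posE (Reg ''i'')) (Num 1))),
     Assign ''t'' (Mem (Add (posE (Reg ''i'')) (Num 2)))]) (inv3x i {}) st"
    using inv m_ge i0 pos bounded_mem[OF b pos(1)] bounded_mem[OF b pos(2)] bounded_mem[OF b pos(3)]
    by (simp add: regs) (simp add: inv3x_def inv3_def idle_def base_def counted_def placed_def
        zero_from_def linked_def checked_def)
  have 2: "wp N (Seq (seqs (map link_dir dirs)) (seqs [incr])) (inv3 (i + 1) {}) st'"
    if "bounded_state N st'" "inv3x i {} st'" for st'
  proof (rule wp_SeqI[OF that(1) links[OF that]])
    fix st' assume s: "inv3x i UNIV st'"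
    have "i + 1 \<le> N" using i L_le_N m_ge by (simp add: L_def)
    moreover have "v \<le> i \<or> v = i + 1 \<longleftrightarrow> v \<le> i + 1" for v by auto
    ultimately show "wp N (seqs [incr]) (inv3 (i + 1) {}) st'"
      using s i i0 by (simp add: inv3x_def inv3_def idle_def base_def counted_def placed_def
          zero_from_def linked_def checked_def)
  qed
  show ?thesis
    using wp_mono[OF wp_bounded[OF 1 b], of "wp N (Seq (seqs (map link_dir dirs)) (seqs [incr])) (inv3 (i + 1) {})"] 2
    unfolding link_pos_def by simp
qed

definition graph :: "state \<Rightarrow> bool" where
  "graph st \<longleftrightarrow> (\<forall>v\<in>{1..n}. \<forall>k\<in>{0..<4}.
     tab L (mem st) 2 (eidx v k) = adjv v k \<and> tab L (mem st) 3 (eidx v k) = badv v k)"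

text \<open>Of the stack only the top appears, in \<open>v\<close>; the rest is implicit in
  \<open>P\<close> and \<open>R\<close>.\<close>

definition view :: "state \<Rightarrow> int \<Rightarrow> int \<Rightarrow> (int \<Rightarrow> int) \<Rightarrow> (int \<Rightarrow> int) \<Rightarrow> (int \<Rightarrow> int) \<Rightarrow> (int \<Rightarrow> int) \<Rightarrow> (int \<Rightarrow> int) \<Rightarrow> bool" where
  "view st v c P D R Lw Nd \<longleftrightarrow> base st \<and> graph st \<and> regs st ''v'' = v \<and> regs st ''c'' = c \<and>
     tab L (mem st) 4 = P \<and> tab L (mem st) 5 = D \<and> tab L (mem st) 6 = R \<and> tab L (mem st) 7 = Lw \<and>
     tab L (mem st) 8 = Nd"

lemma bounded_tab: "bounded_state N st \<Longrightarrow> \<bar>tab L (mem st) t i\<bar> \<le> N"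
  using L_le_N by (auto simp: bounded_state_def tab_def)

end

context seeded_instance
begin

lemma mark_wp:
  assumes b: "bounded_state N st" and ns: "need_state n adjv badv root xs P D R c Lw Nd"
    and x: "xs = x # ys" "P x < 4" and view: "view st x c P D R Lw Nd" and k: "regs st ''k'' = P x"
    and rej: "regs st ''rej'' = 0"
  shows "wp N mark (\<lambda>s'. \<exists>Nd'. view s' x c (P(x := P x + 1)) D R Lw Nd' \<and> regs s' ''k'' = P x \<and>
    (regs s' ''rej'' = 0 \<and> need_state.marked adjv badv xs P Nd Nd' \<or>
     regs s' ''rej'' \<noteq> 0 \<and> \<not> all_dominated)) st"
proof -
  interpret need_state n adjv badv root xs P D R c Lw Nd by (rule ns)
  have xV: "x \<in> {1..n}" and Px: "0 \<le> P x" using xs_V P_xs[of x] x by auto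
  have v: "base st" "graph st" "regs st ''v'' = x" "regs st ''c'' = c" "regs st ''L'' = L"
    "tab L (mem st) 4 = P" "tab L (mem st) 5 = D" "tab L (mem st) 6 = R" "tab L (mem st) 7 = Lw"
    "tab L (mem st) 8 = Nd"
    using view by (auto simp: view_def base_def)
  let ?w = "badv x (P x)"
  have t3: "tab L (mem st) 3 (eidx x (P x)) = ?w" using v(2) xV Px x by (auto simp: graph_def)
  have wN: "0 \<le> ?w" "?w \<le> N" using badv_range[of x "P x"] L_le_N m_ge n_ge by (auto simp: L_def)
  have N: "16 \<le> N" using L_le_N by simp
  have PN: "\<bar>P u\<bar> \<le> N" for u using bounded_tab[OF b, of 4 u] v by simp
  have wx: "?w \<noteq> x" using B_irrefl[OF xV, of "P x"] Px x by simp
  have x0: "0 \<le> x" using xV by simp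
  define Q where "Q s' \<longleftrightarrow> (\<exists>Nd'. view s' x c (P(x := P x + 1)) D R Lw Nd' \<and> regs s' ''k'' = P x \<and>
    (regs s' ''rej'' = 0 \<and> marked Nd' \<or> regs s' ''rej'' \<noteq> 0 \<and> \<not> all_dominated))" for s'
  have fin: "Q s'"
    if "base s'" "graph s'" "regs s' ''v'' = x" "regs s' ''c'' = c" "regs s' ''k'' = P x"
    "tab L (mem s') 4 = P(x := P x + 1)" "tab L (mem s') 5 = D" "tab L (mem s') 6 = R"
    "tab L (mem s') 7 = Lw" "regs s' ''rej'' = 0 \<and> marked (tab L (mem s') 8) \<or>
      regs s' ''rej'' \<noteq> 0 \<and> \<not> all_dominated" for s'
    using that by (auto simp: view_def Q_def)
  have "wp N mark Q st"
  proof (cases "?w = 0")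
    case True
    have "marked Nd" using True x(1) unfolding marked_def Let_def by simp
    then show ?thesis
      using v x0 Px x(2) k t3 True N rej
      by (simp add: mark_def tab_upd) (rule fin; simp add: tab_upd base_def graph_def)
  next
    case False
    then have w: "?w \<in> {1..n}" using badv_range[of x "P x"] by auto
    show ?thesis
    proof (cases "1 \<le> P ?w \<and> P ?w \<le> 4")
      case True
      have m: "marked (Nd(adjv ?w (P ?w - 1) := 1))" using True False x(1) unfolding marked_def Let_def by simp
      have t2: "tab L (mem st) 2 (eidx ?w (P ?w - 1)) = adjv ?w (P ?w - 1)"
        using v(2) w True by (auto simp: graph_def)
      have a0: "0 \<le> adjv ?w (P ?w - 1)" using adjv_range by simp
      show ?thesis
        using v x0 Px x(2) k t3 True False N rej wN PN[of ?w] wx t2 a0 m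
        by (simp add: mark_def tab_upd) (rule fin; simp add: tab_upd base_def graph_def)
    next
      case neg: False
      have "\<not> all_dominated" using reject_stay[OF x(1) Px x(2) False neg] .
      then show ?thesis
        using v x0 Px x(2) k t3 neg False N rej wN PN[of ?w] wx
        by (simp add: mark_def tab_upd) (intro conjI impI; (rule fin)?; simp add: tab_upd base_def graph_def)
    qed
  qed
  then show ?thesis unfolding Q_def .
qed

lemma advance_wp:
  assumes b: "bounded_state N st" and ns: "need_state n adjv badv root xs P D R c Lw Nd"
    and x: "xs = x # ys" "P x < 4" and view: "view st x c (P(x := P x + 1)) D R Lw Nd'"
    and k: "regs st ''k'' = P x"
    and rej: "regs st ''rej'' = 0" and m: "need_state.marked adjv badv xs P Nd Nd'"
  shows "wp N advance (\<lambda>s'. regs s' ''rej'' = 0 \<and> (\<exists>xs' D' R' c' Lw'. xs' \<noteq> [] \<and>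
    need_state n adjv badv root xs' (P(x := P x + 1)) D' R' c' Lw' Nd' \<and>
    view s' (hd xs') c' (P(x := P x + 1)) D' R' Lw' Nd')) st"
proof -
  interpret need_state n adjv badv root xs P D R c Lw Nd by (rule ns)
  have xV: "x \<in> {1..n}" and Px: "0 \<le> P x" using xs_V P_xs[of x] x by auto
  let ?P = "P(x := P x + 1)"
  have v: "base st" "graph st" "regs st ''v'' = x" "regs st ''c'' = c" "regs st ''L'' = L"
    "tab L (mem st) 4 = ?P" "tab L (mem st) 5 = D" "tab L (mem st) 6 = R" "tab L (mem st) 7 = Lw"
    "tab L (mem st) 8 = Nd'"
    using view by (auto simp: view_def base_def)
  let ?u = "adjv x (P x)"
  have t2: "tab L (mem st) 2 (eidx x (P x)) = ?u" using v(2) xV Px x by (auto simp: graph_def)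
  have uN: "0 \<le> ?u" "?u \<le> N" using adjv_range[of x "P x"] L_le_N m_ge n_ge by (auto simp: L_def)
  have N: "16 \<le> N" using L_le_N by simp
  have DN: "\<bar>D u\<bar> \<le> N" for u using bounded_tab[OF b, of 5 u] v by simp
  have xN: "0 \<le> x" "x \<le> N" using xV L_le_N m_ge by (auto simp: L_def)
  define Q where "Q s' \<longleftrightarrow> regs s' ''rej'' = 0 \<and> (\<exists>xs' D' R' c' Lw'. xs' \<noteq> [] \<and>
    need_state n adjv badv root xs' ?P D' R' c' Lw' Nd' \<and> view s' (hd xs') c' ?P D' R' Lw' Nd')" for s'
  have fin: "Q s'"
    if "base s'" "graph s'" "regs s' ''v'' = y" "regs s' ''rej'' = 0"
    "tab L (mem s') 4 = ?P" "tab L (mem s') 8 = Nd'"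
    "need_state n adjv badv root (y # ys') ?P (tab L (mem s') 5) (tab L (mem s') 6)
       (regs s' ''c'') (tab L (mem s') 7) Nd'" for s' y ys'
    unfolding Q_def using that by (intro conjI exI[of _ "y # ys'"] exI) (auto simp: view_def)
  have "wp N advance Q st"
  proof (cases "?u = 0")
    case True
    have "need_state n adjv badv root xs ?P D R c Lw Nd'"
      by (rule need_stay[OF m x]) (use True in simp)
    then show ?thesis
      using v xN Px x k t2 True N rej
      by (simp add: advance_def) (rule fin[where y = x and ys' = ys]; simp add: base_def graph_def)
  next
    case u0: False
    show ?thesis
    proof (cases "D ?u = 0")
      case True
      have new: "need_state n adjv badv root (?u # xs) ?P (D(?u := c + 1)) (R(?u := x)) (c + 1) (Lw(?u := c + 1)) Nd'"
        by (rule need_push[OF m x refl u0 True])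
      \<comment> \<open>Counting the discovered vertices after the push bounds the new number, which
        is about to be stored.\<close>
      then have "c + 1 \<le> n" using dfs_state.c_le[of n adjv badv root "?u # xs"]
        unfolding need_state_def low_state_def by blast
      then have c: "0 \<le> c" "c + 1 \<le> N" using D_le[of x] L_le_N m_ge n_ge by (auto simp: L_def)
      show ?thesis
        using v xN Px x k t2 True u0 N rej uN c new
        by (simp add: advance_def tab_upd)
          (rule fin[where y = ?u and ys' = xs]; simp add: tab_upd base_def graph_def)
    next
      case False
      have stay: "need_state n adjv badv root xs ?P D R c (Lw(x := min (Lw x) (D ?u))) Nd'"
        by (rule need_stay[OF m x]) (use u0 False in simp)
      show ?thesis
      proof (cases "D ?u < Lw x")
        case True
        then show ?thesis
          using v xN Px x k t2 False u0 N rej uN DN[of ?u] stay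
          by (simp add: advance_def tab_upd)
            (rule fin[where y = x and ys' = ys]; simp add: tab_upd base_def graph_def)
      next
        case neg: False
        then have "Lw(x := min (Lw x) (D ?u)) = Lw" by (auto simp: min_def)
        then show ?thesis
          using v xN Px x k t2 False u0 neg N rej uN stay
          by (simp add: advance_def tab_upd)
            (rule fin[where y = x and ys' = ys]; simp add: base_def graph_def)
      qed
    qed
  qed
  then show ?thesis unfolding Q_def .
qed

lemma retreat_wp:
  assumes b: "bounded_state N st" and ns: "need_state n adjv badv root xs P D R c Lw Nd"
    and x: "xs = x # ys" "P x = 4" and view: "view st x c P D R Lw Nd"
    and rej: "regs st ''rej'' = 0"
  shows "wp N retreat (\<lambda>s'. base s' \<and> tab L (mem s') 4 = P(x := 5) \<and>
    (regs s' ''rej'' \<noteq> 0 \<and> regs s' ''v'' = 0 \<and> \<not> all_dominated \<or>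
     regs s' ''rej'' = 0 \<and> (\<exists>Lw'. need_state n adjv badv root ys (P(x := 5)) D R c Lw' Nd \<and>
       view s' (if ys = [] then 0 else hd ys) c (P(x := 5)) D R Lw' Nd))) st"
proof -
  interpret need_state n adjv badv root xs P D R c Lw Nd by (rule ns)
  have xV: "x \<in> {1..n}" using xs_V x by auto
  let ?P = "P(x := 5)"
  have v: "base st" "graph st" "regs st ''v'' = x" "regs st ''c'' = c" "regs st ''L'' = L"
    "tab L (mem st) 4 = P" "tab L (mem st) 5 = D" "tab L (mem st) 6 = R" "tab L (mem st) 7 = Lw"
    "tab L (mem st) 8 = Nd"
    using view by (auto simp: view_def base_def)
  have N: "16 \<le> N" using L_le_N by simp
  have xN: "0 \<le> x" using xV by auto
  have LN: "\<bar>Lw u\<bar> \<le> N" for u using bounded_tab[OF b, of 7 u] v by simp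
  define Q where "Q s' \<longleftrightarrow> base s' \<and> tab L (mem s') 4 = ?P \<and>
    (regs s' ''rej'' \<noteq> 0 \<and> regs s' ''v'' = 0 \<and> \<not> all_dominated \<or>
     regs s' ''rej'' = 0 \<and> (\<exists>Lw'. need_state n adjv badv root ys ?P D R c Lw' Nd \<and>
       view s' (if ys = [] then 0 else hd ys) c ?P D R Lw' Nd))" for s'
  have fin: "Q s'"
    if "base s'" "graph s'" "regs s' ''v'' = (if ys = [] then 0 else hd ys)" "regs s' ''rej'' = 0"
    "regs s' ''c'' = c" "tab L (mem s') 4 = ?P" "tab L (mem s') 5 = D" "tab L (mem s') 6 = R" "tab L (mem s') 8 = Nd"
    "need_state n adjv badv root ys ?P D R c (tab L (mem s') 7) Nd" for s'
    using that by (auto simp: view_def Q_def)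
  have "wp N retreat Q st"
  proof (cases ys)
    case Nil
    then have "R x = 0" using last x R_root by simp
    moreover have "need_state n adjv badv root ys ?P D R c Lw Nd"
      by (rule need_pop[OF x]) (use Nil in simp)
    ultimately show ?thesis
      using v xN x(2) N rej Nil
      by (simp add: retreat_def tab_upd) (rule fin; simp add: tab_upd base_def graph_def)
  next
    case (Cons p zs)
    have pV: "p \<in> {1..n}" using xs_V x Cons by auto
    then have pN: "0 \<le> p" "p \<le> N" "p \<noteq> 0" using L_le_N m_ge by (auto simp: L_def)
    have Rx: "R x = p" using chain[of 0] x Cons by simp
    have xs2: "xs = x # p # zs" using x Cons by simp
    show ?thesis
    proof (cases "Nd x \<noteq> 0 \<and> Lw x < D p")
      case True
      then have "\<not> all_dominated" using reject_pop[OF xs2] by blast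
      then show ?thesis
        using v xN x(2) N rej pN Rx True
        by (simp add: retreat_def tab_upd) (simp add: Q_def tab_upd base_def)
    next
      case False
      have pop: "need_state n adjv badv root ys ?P D R c (Lw(p := min (Lw p) (Lw x))) Nd"
        by (rule need_pop[OF x]) (use Cons False in auto)
      show ?thesis
      proof (cases "Lw x < Lw p")
        case True
        then have "Lw(p := min (Lw p) (Lw x)) = Lw(p := Lw x)" by auto
        with False show ?thesis
          using v xN x(2) N rej pN Rx True LN[of x] pop Cons
          by (cases "Nd x = 0"; simp add: retreat_def tab_upd) (rule fin; simp add: tab_upd base_def graph_def)+
      next
        case neg: False
        then have "Lw(p := min (Lw p) (Lw x)) = Lw" by (auto simp: min_def)
        with False show ?thesis
          using v xN x(2) N rej pN Rx neg pop Cons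
          by (cases "Nd x = 0"; simp add: retreat_def tab_upd) (rule fin; simp add: tab_upd base_def graph_def)+
      qed
    qed
  qed
  then show ?thesis unfolding Q_def .
qed

end

section \<open>The complete program\<close>

definition setup_regs :: com where
  "setup_regs = seqs
    [Assign ''m'' (Mem (Num 0)), Assign ''n'' (Mem (Num 1)),
     Assign ''L'' (Add (Num 3) (Add (Mul (Num 8) (Reg ''m'')) (Mul (Num 3) (Reg ''n''))))]"

definition count_loop :: com where
  "count_loop = While (Less (Reg ''i'') (Reg ''m'')) count_tile"

definition enter_loop :: com where
  "enter_loop = While (Less (Reg ''i'') (Reg ''n'')) enter_pos"

definition link_loop :: com where
  "link_loop = While (Less (Reg ''i'') (Reg ''n'')) link_pos"

definition dfs_loop :: com where
  "dfs_loop = While (Not (Equal (Reg ''v'') (Num 0))) dfs_step"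

definition verifier :: com where
  "verifier = Seq setup_regs (Seq count_loop (Seq (Assign ''i'' (Num 0)) (Seq enter_loop
     (Seq find_seed (Seq link_loop (Seq dfs_start (Seq dfs_loop finish)))))))"

text \<open>The largest degree is 18, for the look-up of a neighbouring position in
  \<open>link_dir\<close>: the code is quartic in the coordinates, and the additions and constant
  factors raise the degree further. The bound 30 becomes the word length parameter.\<close>

lemma cdeg_verifier:
  "cdeg setup_regs \<le> 30" "cdeg count_loop \<le> 30" "cdeg enter_loop \<le> 30" "cdeg find_seed \<le> 30"
  "cdeg link_loop \<le> 30" "cdeg dfs_start \<le> 30" "cdeg dfs_loop \<le> 30" "cdeg finish \<le> 30"
  by (simp_all add: setup_regs_def count_loop_def enter_loop_def find_seed_def link_loop_def dfs_start_def
      dfs_loop_def finish_def count_tile_def count_dir_def enter_pos_def link_pos_def link_dir_def dfs_step_def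
      mark_def advance_def retreat_def adrE_def tabE_def glueE_def gcodeE_def foldE_def pcodeE_def posE_def
      edgeE_def eidxE_def)

definition loop_cost :: "bexp \<Rightarrow> com \<Rightarrow> nat \<Rightarrow> nat" where
  "loop_cost b c k = k * (bcost b + 1 + ctime c) + bcost b + 1"

text \<open>A loop that iterates at least once can charge its final failing test to an iteration,
  hence the second \<open>bcost b + 1\<close>.\<close>

definition loop_rate :: "bexp \<Rightarrow> com \<Rightarrow> nat" where
  "loop_rate b c = 2 * bcost b + 2 + ctime c"

lemma loop_cost_le: "1 \<le> k \<Longrightarrow> loop_cost b c k \<le> k * loop_rate b c"
proof -
  assume "1 \<le> k"
  then have "1 * (bcost b + 1) \<le> k * (bcost b + 1)" by (intro mult_right_mono) auto
  then show ?thesis by (simp add: loop_cost_def loop_rate_def algebra_simps)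
qed

text \<open>Potential of the search: each step raises \<open>P\<close> at one vertex by one, four
  times for its directions and once for its removal, so at most five steps fall on a vertex.\<close>

lemma sum_decrease:
  assumes "\<And>v. v \<in> {1..n} \<Longrightarrow> P v \<le> 5" "x \<in> {1..n}" "P x \<le> 4"
  shows "nat (\<Sum>v\<in>{1..n::int}. 5 - (P(x := P x + 1)) v) < nat (\<Sum>v\<in>{1..n}. 5 - P v)"
proof -
  have "(\<Sum>v\<in>{1..n}. 5 - (P(x := P x + 1)) v) < (\<Sum>v\<in>{1..n}. 5 - P v)"
    using assms by (intro sum_strict_mono_ex1) auto
  moreover have "0 \<le> (\<Sum>v\<in>{1..n}. 5 - (P(x := P x + 1)) v)"
    using assms by (intro sum_nonneg) auto
  ultimately show ?thesis by simp
qed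

context dfs_state
begin

lemma P_le: "v \<in> {1..n} \<Longrightarrow> P v \<le> 5"
  using P_new[of v] P_xs[of v] P_done[of v] by (cases "v \<in> set xs"; cases "D v = 0") auto

text \<open>\<open>c\<close> counts the discovered vertices, so \<open>finish\<close> can test
  connectivity by a single comparison.\<close>

lemma all_found_iff: "c = n \<longleftrightarrow> {1..n} \<subseteq> {u. D u \<noteq> 0}"
proof
  have sub: "{u. D u \<noteq> 0} \<subseteq> {1..n}" using D_V by auto
  have n: "n = int (card {1..n})" using root by simp
  show "{1..n} \<subseteq> {u. D u \<noteq> 0}" if "c = n"
    using card_subset_eq[OF _ sub] that c_card n by auto
  show "c = n" if "{1..n} \<subseteq> {u. D u \<noteq> 0}"
    using sub that c_card n by (metis subset_antisym)
qed

end

context tas_instance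
begin

definition good_start :: bool where
  "good_start \<longleftrightarrow> seed_ok \<and> (\<forall>v\<in>{1..n}. \<forall>k\<in>{0..<4}. \<not> viol v k)"

text \<open>Written with \<open>vtx (0, 0)\<close> because \<open>root\<close> belongs to
  \<open>seeded_instance\<close>; \<open>good_start\<close> contains what is needed to enter that
  locale. An empty stack shows as 0 in \<open>v\<close>.\<close>

definition searching :: "state \<Rightarrow> bool" where
  "searching st \<longleftrightarrow> regs st ''rej'' = 0 \<and> good_start \<and> (\<exists>xs P D R c Lw Nd.
     need_state n adjv badv (vtx (0, 0)) xs P D R c Lw Nd \<and>
     view st (if xs = [] then 0 else hd xs) c P D R Lw Nd)"

definition rejected :: "state \<Rightarrow> bool" where
  "rejected st \<longleftrightarrow> base st \<and> regs st ''rej'' \<noteq> 0 \<and> regs st ''v'' = 0 \<and> \<not> uniquely_produces S \<alpha>"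

definition steps_left :: "state \<Rightarrow> nat" where
  "steps_left st = nat (\<Sum>v\<in>{1..n}. 5 - tab L (mem st) 4 v)"

lemma not_good_start: "\<not> good_start \<Longrightarrow> \<not> uniquely_produces S \<alpha>"
proof
  assume ng: "\<not> good_start" and u: "uniquely_produces S \<alpha>"
  have seed: "\<alpha> (0, 0) = Some s"
    using u unfolding uniquely_produces_iff[OF tas_S S_simps(3) fin, unfolded S_simps, OF ran] by blast
  then interpret seeded_instance T s \<alpha> ts ps by unfold_locales
  show False using u ng seed unfolding uniquely_produces_iff_graph good_start_def seed_ok_def by blast
qed

lemma checked_n: "checked n {} st \<Longrightarrow> regs st ''rej'' = 0 \<longleftrightarrow> good_start"
proof -
  assume "checked n {} st"
  moreover have "(\<forall>e. \<not> viol v (dnum e)) \<longleftrightarrow> (\<forall>k\<in>{0..<4}. \<not> viol v k)" for v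
    using dnum_range(3) dnum_dir_of by metis
  ultimately show ?thesis unfolding checked_def good_start_def by auto
qed

lemma linked_n: "linked n {} st \<Longrightarrow> graph st"
  unfolding graph_def
proof (intro ballI)
  fix v k :: int assume "linked n {} st" and v: "v \<in> {1..n}" and k: "k \<in> {0..<4}"
  then have "tab L (mem st) 2 (eidx v (dnum (dir_of k))) = adjv v (dnum (dir_of k)) \<and>
      tab L (mem st) 3 (eidx v (dnum (dir_of k))) = badv v (dnum (dir_of k))"
    unfolding linked_def by (auto simp del: dnum_dir_of)
  then show "tab L (mem st) 2 (eidx v k) = adjv v k \<and> tab L (mem st) 3 (eidx v k) = badv v k"
    using k by simp
qed

lemma dfs_start_wp:
  assumes b: "bounded_state N st" and inv: "inv3 n {} st"
  shows "wp N dfs_start (\<lambda>s'. (searching s' \<or> rejected s') \<and> tab L (mem s') 4 = (\<lambda>_. 0)) st"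
proof -
  have rej: "regs st ''rej'' = 0 \<longleftrightarrow> good_start" and gr: "graph st"
    using inv checked_n linked_n by (auto simp: inv3_def)
  show ?thesis
  proof (cases good_start)
    case False
    then show ?thesis
      using inv rej not_good_start by (auto simp: dfs_start_def rejected_def inv3_def idle_def zero_from_def)
  next
    case True
    then interpret seeded_instance T s \<alpha> ts ps
      by unfold_locales (simp add: good_start_def seed_ok_def)
    have v: "base st" "regs st ''r'' = root" "regs st ''L'' = L"
      using inv by (auto simp: inv3_def idle_def base_def root_def)
    have z: "tab L (mem st) t = (\<lambda>_. 0)" if "4 \<le> t" "t \<le> 8" for t
      using inv that by (auto simp: inv3_def zero_from_def)
    have rN: "0 \<le> root" "root \<le> N" "16 \<le> N" using root L_le_N m_ge by (auto simp: L_def)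
    define Q where "Q s' \<longleftrightarrow> (searching s' \<or> rejected s') \<and> tab L (mem s') 4 = (\<lambda>_. 0)" for s'
    have fin: "Q s'" if "base s'" "graph s'" "regs s' ''v'' = root" "regs s' ''c'' = 1" "regs s' ''rej'' = 0"
      "tab L (mem s') 4 = (\<lambda>_. 0)" "tab L (mem s') 5 = (\<lambda>_. 0)(root := 1)" "tab L (mem s') 6 = (\<lambda>_. 0)"
      "tab L (mem s') 7 = (\<lambda>_. 0)(root := 1)" "tab L (mem s') 8 = (\<lambda>_. 0)" for s'
    proof -
      have "searching s'"
        unfolding searching_def using that need_init True
        by (intro conjI exI[of _ "[root]"] exI) (auto simp: view_def root_def)
      then show ?thesis using that by (simp add: Q_def)
    qed
    have "wp N dfs_start Q st"
      using v rN True rej gr z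
      by (simp add: dfs_start_def) (rule fin; simp add: tab_upd base_def graph_def)
    then show ?thesis unfolding Q_def .
  qed
qed

lemma dfs_step_wp:
  assumes b: "bounded_state N st" and inv: "searching st \<or> rejected st" and v0: "regs st ''v'' \<noteq> 0"
  shows "wp N dfs_step (\<lambda>s'. (searching s' \<or> rejected s') \<and> steps_left s' < steps_left st) st"
proof -
  have s: "searching st" using inv v0 by (auto simp: rejected_def)
  then interpret seeded_instance T s \<alpha> ts ps
    by unfold_locales (simp add: searching_def good_start_def seed_ok_def)
  have good: good_start and rej: "regs st ''rej'' = 0" using s by (auto simp: searching_def)
  obtain xs P D R c Lw Nd where ns: "need_state n adjv badv root xs P D R c Lw Nd"
    and view: "view st (if xs = [] then 0 else hd xs) c P D R Lw Nd"
    using s by (auto simp: searching_def root_def)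
  interpret need_state n adjv badv root xs P D R c Lw Nd by (rule ns)
  obtain x ys where x: "xs = x # ys" using view v0 by (cases xs) (auto simp: view_def)
  have xV: "x \<in> {1..n}" and Px: "0 \<le> P x" "P x \<le> 4" using xs_V P_xs[of x] x by auto
  have view: "view st x c P D R Lw Nd" using view x by simp
  then have v: "regs st ''L'' = L" "regs st ''v'' = x" "tab L (mem st) 4 = P"
    by (auto simp: view_def base_def)
  have less: "steps_left s' < steps_left st" if "tab L (mem s') 4 = P(x := P x + 1)" for s'
    unfolding steps_left_def that v(3) by (rule sum_decrease) (use P_le xV Px(2) in auto)
  have not_unique: "\<not> uniquely_produces S \<alpha>" if "\<not> all_dominated"
    using that uniquely_produces_iff_graph by blast
  let ?Q = "\<lambda>s'. (searching s' \<or> rejected s') \<and> steps_left s' < steps_left st"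
  define st1 where "st1 = st\<lparr>regs := (regs st)(''k'' := P x)\<rparr>"
  have PN: "\<bar>P x\<bar> \<le> N" using Px L_le_N by simp
  have b1: "bounded_state N st1" using b PN by (auto simp: bounded_state_def st1_def)
  have view1: "view st1 x c P D R Lw Nd" and k1: "regs st1 ''k'' = P x" and rej1: "regs st1 ''rej'' = 0"
    using view rej by (auto simp: view_def st1_def base_def graph_def)
  have start: "wp N dfs_step ?Q st \<longleftrightarrow> wp N (Cond (Less (Reg ''k'') (Num 4)) (Seq mark advance) retreat) ?Q st1"
    using v xV PN by (simp add: dfs_step_def st1_def)
  show ?thesis
  proof (cases "P x < 4")
    case True
    have "wp N (Seq mark advance) ?Q st1"
    proof (rule wp_SeqI[OF b1 mark_wp[OF b1 ns x True view1 k1 rej1]], elim exE conjE)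
      fix s2 Nd'
      assume b2: "bounded_state N s2" and view2: "view s2 x c (P(x := P x + 1)) D R Lw Nd'"
        and k2: "regs s2 ''k'' = P x"
        and "regs s2 ''rej'' = 0 \<and> marked Nd' \<or> regs s2 ''rej'' \<noteq> 0 \<and> \<not> all_dominated"
      then consider "regs s2 ''rej'' = 0" "marked Nd'" | "regs s2 ''rej'' \<noteq> 0" "\<not> all_dominated" by blast
      then show "wp N advance ?Q s2"
      proof cases
        case 1
        show ?thesis
        proof (rule wp_mono[OF advance_wp[OF b2 ns x True view2 k2 1]], elim exE conjE)
          fix s3 xs' D' R' c' Lw'
          assume 3: "regs s3 ''rej'' = 0" "xs' \<noteq> []"
            "need_state n adjv badv root xs' (P(x := P x + 1)) D' R' c' Lw' Nd'"
            "view s3 (hd xs') c' (P(x := P x + 1)) D' R' Lw' Nd'"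
          then have "view s3 (if xs' = [] then 0 else hd xs') c' (P(x := P x + 1)) D' R' Lw' Nd'" by simp
          then have "searching s3" using 3 good unfolding searching_def root_def by blast
          moreover have "tab L (mem s3) 4 = P(x := P x + 1)" using 3 by (simp add: view_def)
          ultimately show "?Q s3" using less by blast
        qed
      next
        case 2
        have "base s2" "tab L (mem s2) 4 = P(x := P x + 1)" using view2 by (auto simp: view_def)
        then show ?thesis
          using 2 not_unique less[of "s2\<lparr>regs := (regs s2)(''v'' := 0)\<rparr>"] L_le_N
          by (simp add: advance_def rejected_def base_def)
      qed
    qed
    then show ?thesis unfolding start using True by (simp add: k1)
  next
    case False
    then have P4: "P x = 4" using Px by simp
    have "wp N retreat ?Q st1"
    proof (rule wp_mono[OF retreat_wp[OF b1 ns x P4 view1 rej1]])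
      fix s'
      assume *: "base s' \<and> tab L (mem s') 4 = P(x := 5) \<and>
        (regs s' ''rej'' \<noteq> 0 \<and> regs s' ''v'' = 0 \<and> \<not> all_dominated \<or>
         regs s' ''rej'' = 0 \<and> (\<exists>Lw'. need_state n adjv badv root ys (P(x := 5)) D R c Lw' Nd \<and>
           view s' (if ys = [] then 0 else hd ys) c (P(x := 5)) D R Lw' Nd))"
      then have "searching s' \<or> rejected s'"
        using good not_unique unfolding searching_def rejected_def root_def by blast
      moreover have "steps_left s' < steps_left st" using * P4 by (intro less) simp
      ultimately show "?Q s'" by blast
    qed
    then show ?thesis unfolding start using False by (simp add: k1)
  qed
qed

lemma finish_wp:
  assumes "bounded_state N st" and inv: "searching st \<or> rejected st" and v0: "regs st ''v'' = 0"
  shows "wp N finish (\<lambda>s'. regs s' ''out'' = (if uniquely_produces S \<alpha> then 1 else 0)) st"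
proof (cases "rejected st")
  case True
  then show ?thesis by (simp add: finish_def rejected_def base_def)
next
  case False
  then have s: "searching st" using inv by blast
  then interpret seeded_instance T s \<alpha> ts ps
    by unfold_locales (simp add: searching_def good_start_def seed_ok_def)
  have good: good_start and rej: "regs st ''rej'' = 0" using s by (auto simp: searching_def)
  obtain xs P D R c Lw Nd where ns: "need_state n adjv badv root xs P D R c Lw Nd"
    and view: "view st (if xs = [] then 0 else hd xs) c P D R Lw Nd"
    using s by (auto simp: searching_def root_def)
  interpret need_state n adjv badv root xs P D R c Lw Nd by (rule ns)
  \<comment> \<open>Vertices are positive, so 0 in \<open>v\<close> can only stand for the empty
    stack.\<close>
  have nil: "xs = []"
  proof (rule ccontr)
    assume "xs \<noteq> []"
    then have "hd xs = 0" using view v0 by (simp add: view_def)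
    moreover have "hd xs \<in> {1..n}" using xs_V hd_in_set[OF \<open>xs \<noteq> []\<close>] by blast
    ultimately have "0 \<in> {1..n}" by simp
    then show False by simp
  qed
  have "uniquely_produces S \<alpha> \<longleftrightarrow> {1..n} \<subseteq> E\<^sup>* `` {root}"
    using good accept[OF nil] unfolding uniquely_produces_iff_graph good_start_def by blast
  also have "\<dots> \<longleftrightarrow> c = n"
    using empty_reach[OF nil] unfolding all_found_iff by auto
  finally have "uniquely_produces S \<alpha> \<longleftrightarrow> c = n" .
  then show ?thesis
    using rej view L_le_N by (simp add: finish_def view_def base_def)
qed

definition total_cost :: nat where
  "total_cost = ctime setup_regs + (loop_cost (Less (Reg ''i'') (Reg ''m'')) count_tile (length ts) +
     (ctime (Assign ''i'' (Num 0)) + (loop_cost (Less (Reg ''i'') (Reg ''n'')) enter_pos (length ps) + (ctime find_seed +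
     (loop_cost (Less (Reg ''i'') (Reg ''n'')) link_pos (length ps) + (ctime dfs_start +
     (loop_cost (Not (Equal (Reg ''v'') (Num 0))) dfs_step (5 * length ps) + ctime finish)))))))"

lemma initial_bounded: "bounded_state N (initial_state inp)"
  using im_bounded L_le_N by (auto simp: bounded_state_def im_def initial_state_def)

lemma setup_wp: "wp N setup_regs (inv1 0 {}) (initial_state inp)"
proof -
  have im: "mem (initial_state inp) a = im a" for a by (simp add: im_def)
  have r: "regs (initial_state inp) r = 0" for r by (simp add: initial_state_def)
  \<comment> \<open>Memory behind the input is 0, so all tables start as zero functions without an
    initialisation pass.\<close>
  have z: "tab L im t = (\<lambda>_. 0)" if "0 \<le> t" for t
    using that im_beyond by (auto simp: tab_def adr_def)
  have mem: "mem (initial_state inp) = im" by (simp add: im_def fun_eq_iff)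
  have "m \<le> N" "n \<le> N" "L \<le> N" using L_le_N n_ge m_ge by (auto simp: L_def)
  then show ?thesis
    using n_ge m_ge L_nonneg
    by (simp add: setup_regs_def mem r im_head L_def[symmetric] add.assoc[symmetric] inv1_def idle_def
        base_def counted_def zero_from_def z gcount_def)
qed

lemma runs_verifier:
  "runs N 30 verifier (initial_state inp) total_cost
     (\<lambda>s'. regs s' ''out'' = (if uniquely_produces S \<alpha> then 1 else 0))"
proof -
  have N: "16 \<le> N" "(30::nat) < 100" using L_le_N by auto
  note deg = cdeg_verifier
  note wpr = wp_runs[OF N]
  have count: "runs N 30 count_loop st (loop_cost (Less (Reg ''i'') (Reg ''m'')) count_tile (length ts)) (inv1 m {})"
    if "bounded_state N st" "inv1 0 {} st" for st
    unfolding count_loop_def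
  proof (rule runs_mono[OF runs_While[OF N deg(2)[unfolded count_loop_def],
        where I = "\<lambda>s. \<exists>i. inv1 i {} s" and \<mu> = "\<lambda>s. nat (m - regs s ''i'')"]])
    fix s assume s: "bounded_state N s" "\<exists>i. inv1 i {} s" "bval s (Less (Reg ''i'') (Reg ''m''))"
    then obtain i where i: "inv1 i {} s" "i < m" by (auto simp: inv1_def idle_def base_def)
    show "wp N count_tile (\<lambda>s'. (\<exists>i. inv1 i {} s') \<and> nat (m - regs s' ''i'') < nat (m - regs s ''i'')) s"
      by (rule wp_mono[OF count_tile_wp[OF s(1) i]]) (use i in \<open>auto simp: inv1_def\<close>)
  next
    show "nat (m - regs st ''i'') * (bcost (Less (Reg ''i'') (Reg ''m'')) + 1 + ctime count_tile) +
        bcost (Less (Reg ''i'') (Reg ''m'')) + 1 \<le> loop_cost (Less (Reg ''i'') (Reg ''m'')) count_tile (length ts)"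
      using that by (simp add: loop_cost_def inv1_def m_def)
  next
    fix s assume "(\<exists>i. inv1 i {} s) \<and> \<not> bval s (Less (Reg ''i'') (Reg ''m''))"
    then show "inv1 m {} s" by (auto simp: inv1_def idle_def base_def)
  qed (use that in auto)
  have enter: "runs N 30 enter_loop st (loop_cost (Less (Reg ''i'') (Reg ''n'')) enter_pos (length ps)) (inv2 n)"
    if "bounded_state N st" "inv2 0 st" for st
    unfolding enter_loop_def
  proof (rule runs_mono[OF runs_While[OF N deg(3)[unfolded enter_loop_def],
        where I = "\<lambda>s. \<exists>i. inv2 i s" and \<mu> = "\<lambda>s. nat (n - regs s ''i'')"]])
    fix s assume s: "bounded_state N s" "\<exists>i. inv2 i s" "bval s (Less (Reg ''i'') (Reg ''n''))"
    then obtain i where i: "inv2 i s" "i < n" by (auto simp: inv2_def idle_def base_def)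
    show "wp N enter_pos (\<lambda>s'. (\<exists>i. inv2 i s') \<and> nat (n - regs s' ''i'') < nat (n - regs s ''i'')) s"
      by (rule wp_mono[OF enter_pos_wp[OF s(1) i]]) (use i in \<open>auto simp: inv2_def\<close>)
  next
    show "nat (n - regs st ''i'') * (bcost (Less (Reg ''i'') (Reg ''n'')) + 1 + ctime enter_pos) +
        bcost (Less (Reg ''i'') (Reg ''n'')) + 1 \<le> loop_cost (Less (Reg ''i'') (Reg ''n'')) enter_pos (length ps)"
      using that by (simp add: loop_cost_def inv2_def n_def)
  next
    fix s assume "(\<exists>i. inv2 i s) \<and> \<not> bval s (Less (Reg ''i'') (Reg ''n''))"
    then show "inv2 n s" by (auto simp: inv2_def idle_def base_def)
  qed (use that in auto)
  have link: "runs N 30 link_loop st (loop_cost (Less (Reg ''i'') (Reg ''n'')) link_pos (length ps)) (inv3 n {})"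
    if "bounded_state N st" "inv3 0 {} st" for st
    unfolding link_loop_def
  proof (rule runs_mono[OF runs_While[OF N deg(5)[unfolded link_loop_def],
        where I = "\<lambda>s. \<exists>i. inv3 i {} s" and \<mu> = "\<lambda>s. nat (n - regs s ''i'')"]])
    fix s assume s: "bounded_state N s" "\<exists>i. inv3 i {} s" "bval s (Less (Reg ''i'') (Reg ''n''))"
    then obtain i where i: "inv3 i {} s" "i < n" by (auto simp: inv3_def idle_def base_def)
    show "wp N link_pos (\<lambda>s'. (\<exists>i. inv3 i {} s') \<and> nat (n - regs s' ''i'') < nat (n - regs s ''i'')) s"
      by (rule wp_mono[OF link_pos_wp[OF s(1) i]]) (use i in \<open>auto simp: inv3_def\<close>)
  next
    show "nat (n - regs st ''i'') * (bcost (Less (Reg ''i'') (Reg ''n'')) + 1 + ctime link_pos) +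
        bcost (Less (Reg ''i'') (Reg ''n'')) + 1 \<le> loop_cost (Less (Reg ''i'') (Reg ''n'')) link_pos (length ps)"
      using that by (simp add: loop_cost_def inv3_def n_def)
  next
    fix s assume "(\<exists>i. inv3 i {} s) \<and> \<not> bval s (Less (Reg ''i'') (Reg ''n''))"
    then show "inv3 n {} s" by (auto simp: inv3_def idle_def base_def)
  qed (use that in auto)
  have dfs: "runs N 30 dfs_loop st (loop_cost (Not (Equal (Reg ''v'') (Num 0))) dfs_step (5 * length ps))
      (\<lambda>s. (searching s \<or> rejected s) \<and> regs s ''v'' = 0)"
    if st: "bounded_state N st" "(searching st \<or> rejected st) \<and> tab L (mem st) 4 = (\<lambda>_. 0)" for st
    unfolding dfs_loop_def
  proof (rule runs_mono[OF runs_While[OF N deg(7)[unfolded dfs_loop_def],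
        where I = "\<lambda>s. searching s \<or> rejected s" and \<mu> = steps_left]])
    fix s assume "bounded_state N s" "searching s \<or> rejected s" "bval s (Not (Equal (Reg ''v'') (Num 0)))"
    then show "wp N dfs_step (\<lambda>s'. (searching s' \<or> rejected s') \<and> steps_left s' < steps_left s) s"
      by (intro dfs_step_wp) auto
  next
    have "steps_left st = 5 * length ps" using st by (simp add: steps_left_def n_def)
    then show "steps_left st * (bcost (Not (Equal (Reg ''v'') (Num 0))) + 1 + ctime dfs_step) +
        bcost (Not (Equal (Reg ''v'') (Num 0))) + 1 \<le>
        loop_cost (Not (Equal (Reg ''v'') (Num 0))) dfs_step (5 * length ps)"
      by (simp add: loop_cost_def)
  qed (use st in auto)
  let ?Q = "\<lambda>s'. regs s' ''out'' = (if uniquely_produces S \<alpha> then 1 else 0)"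
  have r8: "runs N 30 finish st (ctime finish) ?Q"
    if "bounded_state N st" "(searching st \<or> rejected st) \<and> regs st ''v'' = 0" for st
    by (rule wpr[OF finish_wp that(1) deg(8)]) (use that in auto)
  note r7 = runs_Seq[OF dfs r8]
  have r6: "runs N 30 (Seq dfs_start (Seq dfs_loop finish)) st (ctime dfs_start +
      (loop_cost (Not (Equal (Reg ''v'') (Num 0))) dfs_step (5 * length ps) + ctime finish)) ?Q"
    if "bounded_state N st" "inv3 n {} st" for st
    by (rule runs_Seq[OF wpr[OF dfs_start_wp[OF that] that(1) deg(6)] r7])
  note r5 = runs_Seq[OF link r6]
  have r4: "runs N 30 (Seq find_seed (Seq link_loop (Seq dfs_start (Seq dfs_loop finish)))) st (ctime find_seed +
      (loop_cost (Less (Reg ''i'') (Reg ''n'')) link_pos (length ps) + (ctime dfs_start +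
      (loop_cost (Not (Equal (Reg ''v'') (Num 0))) dfs_step (5 * length ps) + ctime finish)))) ?Q"
    if "bounded_state N st" "inv2 n st" for st
    by (rule runs_Seq[OF wpr[OF find_seed_wp[OF that] that(1) deg(4)] r5])
  note r3 = runs_Seq[OF enter r4]
  have r2: "runs N 30 (Assign ''i'' (Num 0)) st (ctime (Assign ''i'' (Num 0))) (inv2 0)"
    if "bounded_state N st" "inv1 m {} st" for st
    by (rule wpr[OF inv1_inv2[OF that(2,1)] that(1)]) simp
  note r1 = runs_Seq[OF count runs_Seq[OF r2 r3]]
  show ?thesis
    unfolding verifier_def total_cost_def
    by (rule runs_Seq[OF wpr[OF setup_wp initial_bounded deg(1)] r1])
qed

lemma verifier_answers:
  "\<exists>t. answers_in verifier 30 inp (uniquely_produces S \<alpha>) t \<and> t \<le> total_cost"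
proof -
  have "word_bound 30 inp = N ^ 30" by (simp add: word_bound_def N_def)
  with runs_verifier show ?thesis unfolding runs_def answers_in_def by fastforce
qed

lemma asm_size_eq: "asm_size \<alpha> = length ps" and card_T: "card T = length ts"
  using ps ts by (simp_all add: asm_size_def distinct_card[symmetric])

end

text \<open>Mirrors \<open>total_cost\<close> summand by summand, so that
  \<open>total_cost_le\<close> can compare the two sums term by term.\<close>

definition rate :: "nat \<Rightarrow> nat" where
  "rate K = ctime setup_regs + ((K + 1) * loop_rate (Less (Reg ''i'') (Reg ''m'')) count_tile +
     (ctime (Assign ''i'' (Num 0)) + (loop_rate (Less (Reg ''i'') (Reg ''n'')) enter_pos + (ctime find_seed +
     (loop_rate (Less (Reg ''i'') (Reg ''n'')) link_pos + (ctime dfs_start +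
     (5 * loop_rate (Not (Equal (Reg ''v'') (Num 0))) dfs_step + ctime finish)))))))"

lemma (in tas_instance) total_cost_le:
  assumes "length ts \<le> K * length ps"
  shows "total_cost \<le> rate K * length ps"
proof -
  let ?n = "length ps"
  have n: "1 \<le> ?n" using n_ge by (simp add: n_def)
  have m: "1 \<le> length ts" using m_ge by (simp add: m_def)
  have "length ts * a \<le> (K + 1) * a * ?n" for a
  proof -
    have "length ts * a \<le> ((K + 1) * ?n) * a" using assms by (intro mult_right_mono) auto
    then show ?thesis by (simp only: mult_ac)
  qed
  then have 1: "loop_cost b d (length ts) \<le> (K + 1) * loop_rate b d * ?n" for b d
    using loop_cost_le[OF m] order_trans by blast
  have 2: "loop_cost b d ?n \<le> loop_rate b d * ?n" for b d
    using loop_cost_le[OF n] by (simp only: mult.commute)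
  have 3: "loop_cost b d (5 * ?n) \<le> 5 * loop_rate b d * ?n" for b d
    using loop_cost_le[of "5 * ?n" b d] n by (simp add: mult_ac)
  have const: "a \<le> a * ?n" for a using n by (cases ?n) auto
  have add: "a + b \<le> (a' + b') * ?n" if "a \<le> a' * ?n" "b \<le> b' * ?n" for a b a' b'
    using that by (simp only: add_mult_distrib add_mono)
  show ?thesis
    unfolding total_cost_def rate_def by (rule add 1 2 3 const)+
qed

theorem theorem4p1:
  shows "\<exists>prog k. \<forall>K::nat. \<exists>C::real. \<forall>T s \<alpha> xs.
    let S = \<lparr>tiles = T, seed = s, temperature = 1\<rparr> in
      is_tas S \<and> is_assembly T \<alpha> \<and> card T \<le> K * asm_size \<alpha> \<and> encodes xs S \<alpha> \<longrightarrow>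
      (\<exists>t. answers_in prog k xs (uniquely_produces S \<alpha>) t \<and>
           real t \<le> C * real (asm_size \<alpha>) * max 1 (log 2 (real (card T))))"
  unfolding Let_def
proof (rule exI[of _ verifier], rule exI[of _ 30], intro allI)
  fix K :: nat
  show "\<exists>C::real. \<forall>T s \<alpha> xs. is_tas \<lparr>tiles = T, seed = s, temperature = 1\<rparr> \<and> is_assembly T \<alpha> \<and>
      card T \<le> K * asm_size \<alpha> \<and> encodes xs \<lparr>tiles = T, seed = s, temperature = 1\<rparr> \<alpha> \<longrightarrow>
      (\<exists>t. answers_in verifier 30 xs (uniquely_produces \<lparr>tiles = T, seed = s, temperature = 1\<rparr> \<alpha>) t \<and>
           real t \<le> C * real (asm_size \<alpha>) * max 1 (log 2 (real (card T))))"
  proof (intro exI[of _ "real (rate K)"] allI impI, elim conjE)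
    fix T s \<alpha> xs
    assume tas: "is_tas \<lparr>tiles = T, seed = s, temperature = 1\<rparr>" and asm: "is_assembly T \<alpha>"
      and card: "card T \<le> K * asm_size \<alpha>" and enc: "encodes xs \<lparr>tiles = T, seed = s, temperature = 1\<rparr> \<alpha>"
    then obtain ts ps where l: "distinct ts" "set ts = T" "distinct ps" "set ps = dom \<alpha>"
      and xs: "xs = instance_code \<lparr>tiles = T, seed = s, temperature = 1\<rparr> \<alpha> ts ps"
      unfolding encodes_def by auto
    interpret tas_instance T s \<alpha> ts ps
      using tas asm l by unfold_locales
    obtain t where t: "answers_in verifier 30 xs (uniquely_produces \<lparr>tiles = T, seed = s, temperature = 1\<rparr> \<alpha>) t"
      "t \<le> total_cost"
      using verifier_answers xs by (auto simp: inp_def S_def)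
    have "t \<le> rate K * asm_size \<alpha>"
      using t(2) total_cost_le[of K] card by (simp add: asm_size_eq card_T)
    \<comment> \<open>The bound is linear already; the factor 1 is written out to be replaced by the
      larger maximum with the logarithm.\<close>
    then have "real t \<le> real (rate K) * real (asm_size \<alpha>) * 1"
      by (metis mult.right_neutral of_nat_le_iff of_nat_mult)
    also have "\<dots> \<le> real (rate K) * real (asm_size \<alpha>) * max 1 (log 2 (real (card T)))"
      by (intro mult_left_mono) auto
    finally show "\<exists>t. answers_in verifier 30 xs (uniquely_produces \<lparr>tiles = T, seed = s, temperature = 1\<rparr> \<alpha>) t \<and>
        real t \<le> real (rate K) * real (asm_size \<alpha>) * max 1 (log 2 (real (card T)))"
      using t(1) by blast
  qed
qed

end
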